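(* Let $\mathbf{k}$ be $\mathbb{Z}$ or a prime field $\mathbb{F}_q$, and let $\mathcal{K}$ be a matroid on the vertex set $[m]=\{1,\dots,m\}$. Then the Tor-module $\mathrm{Tor}_{\mathbf{k}[v_1,\dots,v_m]}(\mathbf{k}[\mathcal{K}];\mathbf{k})$ is isomorphic to the free (bigraded) complex $\mathring{C}_*$ over $\mathbf{k}$ generated by the set $\mathring{\mathcal{M}}$ of $\mathcal{M}$-critical generators $u_Av_B$ of $R^*(\mathcal{K})$, where $\mathcal{M}$ is the matching defined in the context.
   Context: A finite simplicial complex $\mathcal{K}$ is a matroid if for all simplices $\sigma,\tau\in\mathcal{K}$ with $|\sigma|>|\tau|$ there is $v\in\sigma\setminus\tau$ with $\tau\cup\{v\}\in\mathcal{K}$. The Stanley–Reisner ring is $\mathbf{k}[\mathcal{K}]=\mathbf{k}[v_1,\dots,v_m]/(v_{i_1}\cdots v_{i_k} : \{i_1,\dots,i_k\}\notin\mathcal{K})$. Let $R^*(\mathcal{K})=\Lambda[u_1,\dots,u_m]\otimes\mathbf{k}[\mathcal{K}]/(v_i^2=u_iv_i=0,\ 1\le i\le m)$. As a $\mathbf{k}$-module it is free on the elements $u_Av_B$ with $A,B\subseteq[m]$, $A\cap B=\emptyset$, $B\in\mathcal{K}$; the bidegree of $u_Av_B$ is $(-|A|,2(|A|+|B|))$. The differential is $$\partial(u_{\{a_1<\dots<a_i\}}v_B)=\sum_{1\le k\le i,\ \{a_k\}\cup B\in\mathcal{K}}(-1)^k u_{\{a_1,\dots,a_i\}\setminus\{a_k\}}\,v_{\{a_k\}\cup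 B}.$$ Its bigraded homology is the Tor-module $\mathrm{Tor}_{\mathbf{k}[v_1,\dots,v_m]}(\mathbf{k}[\mathcal{K}];\mathbf{k})$. Write $[a-1]=\{1,\dots,a-1\}$. For every generator $u_Av_B$ define $M(u_Av_B)$ = the set of $a\in A$ such that $\{a\}\cup B\in\mathcal{K}$, $\{x\}\cup B\notin\mathcal{K}$ for all $x\in A\cap[a-1]$, and for every $y\in B\cap[a-1]$ there is $x\in A\cap[y-1]$ with $\{x\}\cup (B\setminus\{y\})\in\mathcal{K}$; $N(u_Av_B)$ = the set of $b\in B$ such that $\{x\}\cup(B\setminus\{b\})\notin\mathcal{K}$ for all $x\in A\cap[b-1]$, and for every $y\in B\cap[b-1]$ there is $x\in A\cap[y-1]$ with $\{x\}\cup(B\setminus\{y\})\in\mathcal{K}$. The matching is the set of edges $\mathcal{M}=\{u_Av_B\to u_{A\setminus\{a\}}v_{\{a\}\cup B}\mid a\in M(u_Av_B)\}$, which equals $\{u_{\{b\}\cup A}v_{B\setminus\{b\}}\to u_Av_B\mid b\in N(u_Av_B)\}$. A generator $u_Av_B$ is $\mathcal{M}$-critical if it is not an endpoint of any edge of $\mathcal{M}$, and $\mathring{\mathcal{M}}$ is the set of $\mathcal{M}$-critical generators; $\mathring{C}_*$ is the free $\mathbf{k}$-module on $\mathring{\mathcal{M}}$ with the bigrading inherited from $R^*(\mathcal{K})$. *)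

theory Defs
  imports
    "HOL-Algebra.Algebra"
    "HOL-Algebra.Algebraic_Closure_Type"
    "HOL-Library.Poly_Mapping"
    "HOL-Number_Theory.Residues"
begin

section \<open>Modules\<close>

text \<open>The fields \<open>mult\<close> and \<open>one\<close> of a module record play no role for its module structure.\<close>

definition regular_module :: "('r, 'b) ring_scheme \<Rightarrow> ('r, 'r) module" where
  "regular_module A =
    \<lparr>carrier = carrier A, monoid.mult = undefined, one = undefined, ring.zero = \<zero>\<^bsub>A\<^esub>, add = add A,
     module.smult = monoid.mult A\<rparr>"

text \<open>The direct sum of copies of \<open>M\<close> indexed by \<open>S\<close>.\<close>

definition copower :: "('r, 'm) module \<Rightarrow> 'x set \<Rightarrow> ('r, 'x \<Rightarrow> 'm) module" where
  "copower M S =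
    \<lparr>carrier = {f. (\<forall>x\<in>S. f x \<in> carrier M) \<and> (\<forall>x. x \<notin> S \<longrightarrow> f x = \<zero>\<^bsub>M\<^esub>) \<and>
                   finite {x \<in> S. f x \<noteq> \<zero>\<^bsub>M\<^esub>}},
     monoid.mult = undefined, one = undefined,
     ring.zero = (\<lambda>x. \<zero>\<^bsub>M\<^esub>), add = (\<lambda>f g x. f x \<oplus>\<^bsub>M\<^esub> g x),
     module.smult = (\<lambda>r f x. r \<odot>\<^bsub>M\<^esub> f x)\<rparr>"

definition free_module :: "('r, 'b) ring_scheme \<Rightarrow> 'x set \<Rightarrow> ('r, 'x \<Rightarrow> 'r) module" where
  "free_module A S = copower (regular_module A) S"

definition quotient_module :: "('r, 'm) module \<Rightarrow> 'm set \<Rightarrow> ('r, 'm set) module" where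
  "quotient_module M H =
    \<lparr>carrier = a_rcosets\<^bsub>M\<^esub> H, monoid.mult = undefined, one = undefined, ring.zero = H, add = set_add M,
     module.smult = (\<lambda>r C. \<Union>x\<in>C. H +>\<^bsub>M\<^esub> (r \<odot>\<^bsub>M\<^esub> x))\<rparr>"

definition restrict_scalars :: "('k \<Rightarrow> 'r) \<Rightarrow> ('r, 'm) module \<Rightarrow> ('k, 'm) module" where
  "restrict_scalars \<iota> M =
    \<lparr>carrier = carrier M, monoid.mult = undefined, one = undefined, ring.zero = \<zero>\<^bsub>M\<^esub>, add = add M,
     module.smult = (\<lambda>c x. \<iota> c \<odot>\<^bsub>M\<^esub> x)\<rparr>"

definition module_iso ::
    "('r, 'b) ring_scheme \<Rightarrow> ('r, 'm) module \<Rightarrow> ('r, 'n) module \<Rightarrow> ('m \<Rightarrow> 'n) set" where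
  "module_iso R M N =
    {h \<in> iso (add_monoid M) (add_monoid N).
       \<forall>r\<in>carrier R. \<forall>x\<in>carrier M. h (r \<odot>\<^bsub>M\<^esub> x) = r \<odot>\<^bsub>N\<^esub> h x}"

definition module_isomorphic ::
    "('r, 'b) ring_scheme \<Rightarrow> ('r, 'm) module \<Rightarrow> ('r, 'n) module \<Rightarrow> bool" where
  "module_isomorphic R M N \<longleftrightarrow> module_iso R M N \<noteq> {}"


section \<open>Graded free resolutions and Tor\<close>

text \<open>
  A complex \<open>\<dots> \<rightarrow> F\<^sub>1 \<rightarrow> F\<^sub>0 \<rightarrow> M\<close> of graded free \<open>A\<close>-modules is given by homogeneous bases:
  \<open>F\<^sub>i\<close> has the basis \<open>basis F i\<close>, the element \<open>x\<close> of which has internal degree \<open>bdeg F i x\<close>;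
  \<open>dmat F i x y\<close> is the coefficient of the basis element \<open>y\<close> of \<open>F\<^sub>i\<close> in the image of the basis
  element \<open>x\<close> of \<open>F\<^bsub>i+1\<^esub>\<close>, and \<open>aug F x\<close> is the image in \<open>M\<close> of the basis element \<open>x\<close> of \<open>F\<^sub>0\<close>.
\<close>

record ('x, 'r, 'm) free_cx =
  basis :: "nat \<Rightarrow> 'x set"
  bdeg :: "nat \<Rightarrow> 'x \<Rightarrow> int"
  dmat :: "nat \<Rightarrow> 'x \<Rightarrow> 'x \<Rightarrow> 'r"
  aug :: "'x \<Rightarrow> 'm"

text \<open>
  For a free module \<open>F\<close> with basis \<open>S\<close>, the tensor product \<open>F \<otimes>\<^sub>A N\<close> is \<open>copower N S\<close>, where the
  function \<open>f\<close> stands for the sum of all \<open>x \<otimes> f x\<close>. In these terms the following is the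
  differential \<open>F\<^bsub>i+1\<^esub> \<otimes>\<^sub>A N \<rightarrow> F\<^sub>i \<otimes>\<^sub>A N\<close>; the differential of \<open>F\<close> itself is the case \<open>N = A\<close>.
\<close>

definition tensor_diff ::
    "('x, 'r, 'm) free_cx \<Rightarrow> ('r, 'n) module \<Rightarrow> nat \<Rightarrow> ('x \<Rightarrow> 'n) \<Rightarrow> ('x \<Rightarrow> 'n)" where
  "tensor_diff F N i f =
    (\<lambda>y. if y \<in> basis F i
         then \<Oplus>\<^bsub>N\<^esub>x\<in>{x \<in> basis F (Suc i). f x \<noteq> \<zero>\<^bsub>N\<^esub>}. dmat F i x y \<odot>\<^bsub>N\<^esub> f x
         else \<zero>\<^bsub>N\<^esub>)"

definition aug_map ::
    "('r, 'b) ring_scheme \<Rightarrow> ('r, 'm) module \<Rightarrow> ('x, 'r, 'm) free_cx \<Rightarrow> ('x \<Rightarrow> 'r) \<Rightarrow> 'm" where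
  "aug_map A M F f = (\<Oplus>\<^bsub>M\<^esub>x\<in>{x \<in> basis F 0. f x \<noteq> \<zero>\<^bsub>A\<^esub>}. f x \<odot>\<^bsub>M\<^esub> aug F x)"

text \<open>The families \<open>gA\<close>, \<open>gM\<close> (and \<open>gN\<close> below) are the homogeneous components of \<open>A\<close>, \<open>M\<close>, \<open>N\<close>.\<close>

definition graded_free_resolution ::
    "('r, 'b) ring_scheme \<Rightarrow> (int \<Rightarrow> 'r set) \<Rightarrow> ('r, 'm) module \<Rightarrow> (int \<Rightarrow> 'm set) \<Rightarrow>
     ('x, 'r, 'm) free_cx \<Rightarrow> bool" where
  "graded_free_resolution A gA M gM F \<longleftrightarrow>
     (\<forall>i. \<forall>x\<in>basis F (Suc i). finite {y \<in> basis F i. dmat F i x y \<noteq> \<zero>\<^bsub>A\<^esub>} \<and>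
        (\<forall>y\<in>basis F i. dmat F i x y \<in> gA (bdeg F (Suc i) x - bdeg F i y))) \<and>
     (\<forall>x\<in>basis F 0. aug F x \<in> gM (bdeg F 0 x)) \<and>
     aug_map A M F ` carrier (free_module A (basis F 0)) = carrier M \<and>
     tensor_diff F (regular_module A) 0 ` carrier (free_module A (basis F 1)) =
       {f \<in> carrier (free_module A (basis F 0)). aug_map A M F f = \<zero>\<^bsub>M\<^esub>} \<and>
     (\<forall>i. tensor_diff F (regular_module A) (Suc i) ` carrier (free_module A (basis F (i + 2))) =
       {f \<in> carrier (free_module A (basis F (Suc i))).
          tensor_diff F (regular_module A) i f = \<zero>\<^bsub>free_module A (basis F i)\<^esub>})"

definition tensor_component ::
    "('r, 'n) module \<Rightarrow> (int \<Rightarrow> 'n set) \<Rightarrow> ('x, 'r, 'm) free_cx \<Rightarrow> nat \<Rightarrow> int \<Rightarrow> ('x \<Rightarrow> 'n) set" where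
  "tensor_component N gN F i d =
    {f \<in> carrier (copower N (basis F i)). \<forall>x\<in>basis F i. f x \<in> gN (d - bdeg F i x)}"

definition tor_cycles ::
    "('r, 'n) module \<Rightarrow> (int \<Rightarrow> 'n set) \<Rightarrow> ('x, 'r, 'm) free_cx \<Rightarrow> nat \<Rightarrow> int \<Rightarrow> ('x \<Rightarrow> 'n) set" where
  "tor_cycles N gN F i d =
    {f \<in> tensor_component N gN F i d.
       \<forall>j. i = Suc j \<longrightarrow> tensor_diff F N j f = \<zero>\<^bsub>copower N (basis F j)\<^esub>}"

definition tor_boundaries ::
    "('r, 'n) module \<Rightarrow> (int \<Rightarrow> 'n set) \<Rightarrow> ('x, 'r, 'm) free_cx \<Rightarrow> nat \<Rightarrow> int \<Rightarrow> ('x \<Rightarrow> 'n) set" where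
  "tor_boundaries N gN F i d = tensor_diff F N i ` tensor_component N gN F (Suc i) d"

text \<open>
  The component of bidegree \<open>(-i, d)\<close> of \<open>Tor\<^sub>A(M; N)\<close>, i.e. the part of internal degree \<open>d\<close> of
  \<open>H\<^sub>i(F \<otimes>\<^sub>A N)\<close>, computed from a graded free resolution \<open>F\<close> of \<open>M\<close>. It is regarded as a
  module over a ring of scalars of degree 0 that acts via \<open>\<iota>\<close>.
\<close>

definition Tor ::
    "('k \<Rightarrow> 'r) \<Rightarrow> ('r, 'n) module \<Rightarrow> (int \<Rightarrow> 'n set) \<Rightarrow> ('x, 'r, 'm) free_cx \<Rightarrow> nat \<Rightarrow> int \<Rightarrow>
     ('k, ('x \<Rightarrow> 'n) set) module" where
  "Tor \<iota> N gN F i d =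
    quotient_module
      ((restrict_scalars \<iota> (copower N (basis F i)))\<lparr>carrier := tor_cycles N gN F i d\<rparr>)
      (tor_boundaries N gN F i d)"


section \<open>The Stanley--Reisner ring\<close>

abbreviation coeff_ring :: "'k::comm_ring_1 ring" where
  "coeff_ring \<equiv> ring_of_type_algebra"

definition integers_or_prime_field :: "'k::comm_ring_1 itself \<Rightarrow> bool" where
  "integers_or_prime_field _ \<longleftrightarrow>
     (coeff_ring :: 'k ring) \<simeq> int_ring \<or>
     (\<exists>q::nat. Factorial_Ring.prime q \<and> (coeff_ring :: 'k ring) \<simeq> residue_ring (int q))"

definition simplicial_complex_on :: "nat \<Rightarrow> nat set set \<Rightarrow> bool" where
  "simplicial_complex_on m K \<longleftrightarrow>
     K \<subseteq> Pow {1..m} \<and> {} \<in> K \<and> (\<forall>\<sigma>\<in>K. \<forall>\<tau>. \<tau> \<subseteq> \<sigma> \<longrightarrow> \<tau> \<in> K)"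

definition matroid_on :: "nat \<Rightarrow> nat set set \<Rightarrow> bool" where
  "matroid_on m K \<longleftrightarrow> simplicial_complex_on m K \<and>
     (\<forall>\<sigma>\<in>K. \<forall>\<tau>\<in>K. card \<sigma> > card \<tau> \<longrightarrow> (\<exists>v\<in>\<sigma> - \<tau>. \<tau> \<union> {v} \<in> K))"

text \<open>Polynomials map exponent vectors, which are themselves finitely supported, to coefficients.\<close>

type_synonym 'k mpoly = "(nat \<Rightarrow>\<^sub>0 nat) \<Rightarrow>\<^sub>0 'k"

definition mpoly_ring :: "nat \<Rightarrow> 'k::comm_ring_1 mpoly ring" where
  "mpoly_ring m =
    ring_of_type_algebra\<lparr>carrier := {p. \<forall>t\<in>Poly_Mapping.keys p. Poly_Mapping.keys t \<subseteq> {1..m}}\<rparr>"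

definition const :: "'k \<Rightarrow> 'k::comm_ring_1 mpoly" where
  "const c = Poly_Mapping.single 0 c"

text \<open>The product of the variables \<open>v\<^sub>i\<close>, \<open>i \<in> \<sigma>\<close>.\<close>

definition var_prod :: "nat set \<Rightarrow> 'k::comm_ring_1 mpoly" where
  "var_prod \<sigma> = (\<Prod>i\<in>\<sigma>. Poly_Mapping.single (Poly_Mapping.single i 1) 1)"

text \<open>Every variable has degree 2.\<close>

definition mpoly_grading :: "nat \<Rightarrow> int \<Rightarrow> 'k::comm_ring_1 mpoly set" where
  "mpoly_grading m d =
    {p \<in> carrier (mpoly_ring m). \<forall>t\<in>Poly_Mapping.keys p.
       int (2 * (\<Sum>i\<in>Poly_Mapping.keys t. Poly_Mapping.lookup t i)) = d}"

definition SR_ideal :: "nat \<Rightarrow> nat set set \<Rightarrow> 'k::comm_ring_1 mpoly set" where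
  "SR_ideal m K = Idl\<^bsub>mpoly_ring m\<^esub> (var_prod ` {\<sigma>. \<sigma> \<subseteq> {1..m} \<and> \<sigma> \<notin> K})"

definition SR_ring :: "nat \<Rightarrow> nat set set \<Rightarrow> 'k::comm_ring_1 mpoly set ring" where
  "SR_ring m K = mpoly_ring m Quot SR_ideal m K"

definition SR_module :: "nat \<Rightarrow> nat set set \<Rightarrow> ('k::comm_ring_1 mpoly, 'k mpoly set) module" where
  "SR_module m K =
    \<lparr>carrier = carrier (SR_ring m K), monoid.mult = monoid.mult (SR_ring m K), one = \<one>\<^bsub>SR_ring m K\<^esub>,
     ring.zero = \<zero>\<^bsub>SR_ring m K\<^esub>, add = add (SR_ring m K),
     module.smult = (\<lambda>p C. (SR_ideal m K +>\<^bsub>mpoly_ring m\<^esub> p) \<otimes>\<^bsub>SR_ring m K\<^esub> C)\<rparr>"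

definition SR_grading :: "nat \<Rightarrow> nat set set \<Rightarrow> int \<Rightarrow> 'k::comm_ring_1 mpoly set set" where
  "SR_grading m K d = (\<lambda>p. SR_ideal m K +>\<^bsub>mpoly_ring m\<^esub> p) ` mpoly_grading m d"

text \<open>The module \<open>k = k[v\<^sub>1,\<dots>,v\<^sub>m]/(v\<^sub>1,\<dots>,v\<^sub>m)\<close>, on which a polynomial acts by its constant term.\<close>

definition trivial_module :: "('k::comm_ring_1 mpoly, 'k) module" where
  "trivial_module =
    \<lparr>carrier = UNIV, monoid.mult = (*), one = 1, ring.zero = 0, add = (+),
     module.smult = (\<lambda>p c. Poly_Mapping.lookup p 0 * c)\<rparr>"

definition trivial_grading :: "int \<Rightarrow> 'k::comm_ring_1 set" where
  "trivial_grading d = (if d = 0 then UNIV else {0})"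

definition SR_resolution ::
    "nat \<Rightarrow> nat set set \<Rightarrow> ('x, 'k::comm_ring_1 mpoly, 'k mpoly set) free_cx \<Rightarrow> bool" where
  "SR_resolution m K F \<longleftrightarrow>
     graded_free_resolution (mpoly_ring m) (mpoly_grading m) (SR_module m K) (SR_grading m K) F"

definition SR_Tor ::
    "('x, 'k::comm_ring_1 mpoly, 'k mpoly set) free_cx \<Rightarrow> nat \<Rightarrow> int \<Rightarrow> ('k, ('x \<Rightarrow> 'k) set) module" where
  "SR_Tor F i d = Tor const trivial_module trivial_grading F i d"


section \<open>The matching on the generators of \<open>R\<^sup>*(K)\<close>\<close>

text \<open>The generator \<open>u\<^sub>A v\<^sub>B\<close> is represented by the pair \<open>(A, B)\<close>.\<close>

type_synonym gen = "nat set \<times> nat set"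

definition generators :: "nat \<Rightarrow> nat set set \<Rightarrow> gen set" where
  "generators m K = {(A, B). A \<subseteq> {1..m} \<and> B \<subseteq> {1..m} \<and> A \<inter> B = {} \<and> B \<in> K}"

definition bidegree :: "gen \<Rightarrow> int \<times> int" where
  "bidegree = (\<lambda>(A, B). (- int (card A), 2 * (int (card A) + int (card B))))"

definition match_up :: "nat set set \<Rightarrow> gen \<Rightarrow> nat set" where
  "match_up K = (\<lambda>(A, B). {a \<in> A. {a} \<union> B \<in> K \<and>
     (\<forall>x \<in> A \<inter> {1..<a}. {x} \<union> B \<notin> K) \<and>
     (\<forall>y \<in> B \<inter> {1..<a}. \<exists>x \<in> A \<inter> {1..<y}. {x} \<union> (B - {y}) \<in> K)})"

definition matching :: "nat \<Rightarrow> nat set set \<Rightarrow> (gen \<times> gen) set" where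
  "matching m K =
    {((A, B), (A - {a}, {a} \<union> B)) | A B a. (A, B) \<in> generators m K \<and> a \<in> match_up K (A, B)}"

definition critical_gens :: "nat \<Rightarrow> nat set set \<Rightarrow> gen set" where
  "critical_gens m K =
    {g \<in> generators m K. \<not> (\<exists>e \<in> matching m K. g = fst e \<or> g = snd e)}"

definition critical_module ::
    "nat \<Rightarrow> nat set set \<Rightarrow> int \<times> int \<Rightarrow> ('k::comm_ring_1, gen \<Rightarrow> 'k) module" where
  "critical_module m K b = free_module coeff_ring {g \<in> critical_gens m K. bidegree g = b}"

end

theory Submission
  imports Defs "HOL-Library.Function_Algebras"
begin

text \<open>
  The homology of \<open>F \<otimes> k\<close> is compared with that of \<open>k[K] \<otimes> \<Lambda>\<close> through the double complex formed by
  the resolution \<open>F\<close> and the Koszul complex. The complex \<open>k[K] \<otimes> \<Lambda>\<close> has a basis of multigraded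
  cells, and the matching of the generators of \<open>R\<^sup>*(K)\<close> extends to an acyclic matching of these cells,
  the cells of non-squarefree multidegree being matched completely. In matroid terms, a generator
  is critical iff no \<open>b \<in> B\<close> is internally active and no \<open>a \<in> A\<close> extends \<open>B\<close>. The latter makes every
  critical cell a cycle, so that the Morse complex has zero differential. The same statement for the
  full simplex is the exactness of the Koszul complex of the polynomial ring.
\<close>

section \<open>Active elements\<close>

text \<open>The resolution \<open>F\<close> is arbitrary: it may be non-minimal and of infinite
  rank, so no explicit chain map out of it is at hand. The isomorphism is therefore obtained as a
  relation between the two ends of zigzags, and everything reduces to showing that this relation is
  functional, total, surjective and has the boundaries as kernel. Matching all cells of k[K] tensor
  Lambda replaces the proof that passing to the quotient R*(K) preserves homology. The matching is
  used as linear algebra: between matched cells the incidence matrix is triangular with signs on the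
  diagonal, hence invertible without division. The exchange axiom enters through a single fact: once
  the smallest extending \<open>a\<close> is moved into \<open>B\<close>, it is the smallest active
  element there. Activity is the classical notion from the Tutte polynomial. A critical pair amounts
  to a set W, the union of A and B, with a basis B of the restriction of K to W of internal activity
  0. There are T(0,1) such bases, T being the Tutte polynomial of the restriction, which is its top
  reduced Betti number, in accordance with Hochster's formula.\<close>

definition int_active :: "nat set set \<Rightarrow> nat set \<Rightarrow> nat set \<Rightarrow> nat set" where
  "int_active K A B = {b \<in> B. \<forall>x\<in>A. x < b \<longrightarrow> insert x (B - {b}) \<notin> K}"

definition extending :: "nat set set \<Rightarrow> nat set \<Rightarrow> nat set \<Rightarrow> nat set" where
  "extending K A B = {a \<in> A. insert a B \<in> K}"

lemma matroid_on_subset: "matroid_on m K \<Longrightarrow> \<sigma> \<in> K \<Longrightarrow> \<tau> \<subseteq> \<sigma> \<Longrightarrow> \<tau> \<in> K"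
  by (auto simp: matroid_on_def simplicial_complex_on_def)

lemma matroid_on_vertices: "matroid_on m K \<Longrightarrow> \<sigma> \<in> K \<Longrightarrow> \<sigma> \<subseteq> {1..m}"
  by (auto simp: matroid_on_def simplicial_complex_on_def)

lemma matroid_on_finite: "matroid_on m K \<Longrightarrow> \<sigma> \<in> K \<Longrightarrow> finite \<sigma>"
  by (meson finite_atLeastAtMost finite_subset matroid_on_vertices)

text \<open>If \<open>a < y\<close>, then \<open>insert a (B - {y})\<close> is contained in the face
  \<open>insert a B\<close>, against the activity of \<open>y\<close>. Hence the bound
  \<open>y < a\<close> in \<open>match_up\<close> lets no active element escape.\<close>

lemma int_active_less_extending:
  assumes "matroid_on m K" "y \<in> int_active K A B" "a \<in> extending K A B" "A \<inter> B = {}"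
  shows "y < a"
proof (rule ccontr)
  assume "\<not> y < a"
  moreover have "y \<noteq> a"
    using assms by (auto simp: int_active_def extending_def)
  ultimately have "a < y" by simp
  moreover have "insert a (B - {y}) \<in> K"
    by (rule matroid_on_subset[OF assms(1), of "insert a B"]) (use assms in \<open>auto simp: extending_def\<close>)
  ultimately show False
    using assms by (auto simp: int_active_def extending_def)
qed

text \<open>An element of \<open>A\<close> smaller than \<open>a\<close> witnessing that
  \<open>a\<close> is inactive would extend \<open>B\<close>, against minimality. Suppose some
  \<open>z < a\<close> is active after the move. It was inactive before, so B - z + x is a face for
  some \<open>x < z\<close>. This face has one element less than B + a, and the exchange axiom adds
  \<open>a\<close> or \<open>z\<close> to it. Adding \<open>a\<close> contradicts the activity of
  \<open>z\<close>; adding \<open>z\<close> shows that \<open>x < a\<close> extends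
  \<open>B\<close>.\<close>

lemma Min_int_active_insert:
  assumes M: "matroid_on m K" and disj: "A \<inter> B = {}" and fin: "finite A"
    and act: "int_active K A B = {}" and ext: "extending K A B \<noteq> {}"
  defines "a \<equiv> Min (extending K A B)"
  shows "int_active K (A - {a}) (insert a B) \<noteq> {}"
    and "Min (int_active K (A - {a}) (insert a B)) = a"
proof -
  have fe: "finite (extending K A B)"
    using fin by (auto simp: extending_def)
  have a: "a \<in> extending K A B" "\<And>x. x \<in> extending K A B \<Longrightarrow> a \<le> x"
    using fe ext by (auto simp: a_def)
  have aA: "a \<in> A" "a \<notin> B" "insert a B \<in> K"
    using a disj by (auto simp: extending_def)
  have finB: "finite B"
    using matroid_on_finite[OF M aA(3)] by simp
  have a_act: "a \<in> int_active K (A - {a}) (insert a B)"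
    using a(2) aA by (force simp: int_active_def extending_def)
  have min: "a \<le> z" if z: "z \<in> int_active K (A - {a}) (insert a B)" for z
  proof (rule ccontr)
    assume "\<not> a \<le> z"
    then have za: "z < a" by simp
    then have zB: "z \<in> B"
      using z by (auto simp: int_active_def)
    then obtain x where x: "x \<in> A" "x < z" "insert x (B - {z}) \<in> K"
      using act by (auto simp: int_active_def)
    have "x \<notin> B" using x disj by auto
    then have "card (insert x (B - {z})) < card (insert a B)"
      using finB zB aA card_Diff1_less[OF finB zB] by simp
    then obtain v where v: "v \<in> insert a B - insert x (B - {z})" "insert x (B - {z}) \<union> {v} \<in> K"
      using M x(3) aA(3) unfolding matroid_on_def by blast
    then consider "v = a" | "v = z" by auto
    then show False
    proof cases
      case 1
      have "insert x (insert a B - {z}) \<in> K"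
        by (rule matroid_on_subset[OF M v(2)]) (use 1 in auto)
      then show False
        using z x za by (auto simp: int_active_def)
    next
      case 2
      have "insert x B \<in> K"
        by (rule matroid_on_subset[OF M v(2)]) (use 2 in auto)
      then show False
        using a(2)[of x] x za by (auto simp: extending_def)
    qed
  qed
  have "finite (int_active K (A - {a}) (insert a B))"
    using finB by (auto simp: int_active_def)
  then show "Min (int_active K (A - {a}) (insert a B)) = a"
    using a_act min by (intro Min_eqI) auto
  show "int_active K (A - {a}) (insert a B) \<noteq> {}"
    using a_act by auto
qed

text \<open>An element below \<open>b\<close> that extends B - b would contradict the activity of
  \<open>b\<close>. An element \<open>z\<close> active after the removal lies below
  \<open>b\<close>, because \<open>b\<close> now extends; it was active before as well, since B - b
  - z + x is contained in B - z + x. This contradicts the minimality of \<open>b\<close>.\<close>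

lemma Min_extending_remove:
  assumes M: "matroid_on m K" and disj: "A \<inter> B = {}" and fin: "finite A" and B: "B \<in> K"
    and act: "int_active K A B \<noteq> {}"
  defines "b \<equiv> Min (int_active K A B)"
  shows "int_active K (insert b A) (B - {b}) = {}"
    and "b \<in> extending K (insert b A) (B - {b})"
    and "Min (extending K (insert b A) (B - {b})) = b"
proof -
  have "finite (int_active K A B)"
    using matroid_on_finite[OF M B] by (auto simp: int_active_def)
  then have b: "b \<in> int_active K A B" "\<And>y. y \<in> int_active K A B \<Longrightarrow> b \<le> y"
    using act by (auto simp: b_def)
  then have bB: "b \<in> B" by (auto simp: int_active_def)
  then show be: "b \<in> extending K (insert b A) (B - {b})"
    using B by (auto simp: extending_def insert_absorb)
  have "b \<le> x" if "x \<in> extending K (insert b A) (B - {b})" for x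
    using that b(1) by (force simp: extending_def int_active_def)
  then show "Min (extending K (insert b A) (B - {b})) = b"
    using be fin by (intro Min_eqI) (auto simp: extending_def)
  have "z \<notin> int_active K (insert b A) (B - {b})" for z
  proof
    assume z: "z \<in> int_active K (insert b A) (B - {b})"
    have "z < b"
      using int_active_less_extending[OF M z be] disj by auto
    moreover have "z \<in> int_active K A B"
    proof -
      have "insert x (B - {z}) \<notin> K" if "x \<in> A" "x < z" for x
      proof
        assume "insert x (B - {z}) \<in> K"
        then have "insert x (B - {b} - {z}) \<in> K"
          by (rule matroid_on_subset[OF M]) auto
        then show False using z that by (auto simp: int_active_def)
      qed
      then show ?thesis using z by (auto simp: int_active_def)
    qed
    ultimately show False using b(2)[of z] by simp
  qed
  then show "int_active K (insert b A) (B - {b}) = {}" by auto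
qed

text \<open>The last condition of \<open>match_up\<close> says that no element of \<open>B\<close>
  below \<open>a\<close> is active, that is, \<open>a \<le> y\<close> for all active
  \<open>y\<close>. As active elements lie below extending ones, it holds only if there is no active
  element at all.\<close>

lemma match_up_iff:
  assumes M: "matroid_on m K" and g: "(A, B) \<in> generators m K"
  shows "a \<in> match_up K (A, B) \<longleftrightarrow>
    int_active K A B = {} \<and> extending K A B \<noteq> {} \<and> a = Min (extending K A B)"
proof -
  have sub: "A \<subseteq> {1..m}" "B \<subseteq> {1..m}" "A \<inter> B = {}" "B \<in> K"
    using g by (auto simp: generators_def)
  then have fin: "finite A" "finite (extending K A B)"
    by (auto simp: extending_def intro: finite_subset)
  have 1: "A \<inter> {1..<y} = {x \<in> A. x < y}" "B \<inter> {1..<y} = {x \<in> B. x < y}" for y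
    using sub by auto
  have "a \<in> match_up K (A, B) \<longleftrightarrow> a \<in> extending K A B \<and> (\<forall>x \<in> extending K A B. a \<le> x) \<and>
      (\<forall>y \<in> int_active K A B. a \<le> y)"
    (is "?l \<longleftrightarrow> ?r")
  proof
    assume l: ?l
    have "a \<le> y" if "y \<in> int_active K A B" for y
    proof (rule ccontr)
      assume "\<not> a \<le> y"
      then have "y \<in> {x \<in> B. x < a}" using that by (auto simp: int_active_def)
      then show False using l that unfolding match_up_def prod.case 1 by (auto simp: int_active_def)
    qed
    moreover have "a \<le> x" if "x \<in> extending K A B" for x
    proof (rule ccontr)
      assume "\<not> a \<le> x"
      then show False using l that unfolding match_up_def prod.case 1 by (auto simp: extending_def)
    qed
    ultimately show ?r using l by (auto simp: match_up_def extending_def)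
  next
    assume r: ?r
    have "\<exists>x\<in>{x \<in> A. x < y}. {x} \<union> (B - {y}) \<in> K" if y: "y \<in> {x \<in> B. x < a}" for y
    proof -
      have "y \<notin> int_active K A B" using r y by auto
      then show ?thesis using y by (auto simp: int_active_def)
    qed
    moreover have "{x} \<union> B \<notin> K" if "x \<in> {x \<in> A. x < a}" for x
      using r that by (auto simp: extending_def)
    ultimately show ?l using r unfolding match_up_def prod.case 1 by (simp add: extending_def)
  qed
  also have "\<dots> \<longleftrightarrow> a \<in> extending K A B \<and> (\<forall>x \<in> extending K A B. a \<le> x) \<and> int_active K A B = {}"
    using int_active_less_extending[OF M _ _ sub(3)] leD by blast
  also have "\<dots> \<longleftrightarrow> int_active K A B = {} \<and> extending K A B \<noteq> {} \<and> a = Min (extending K A B)"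
    using fin(2) by (cases "extending K A B = {}") (auto intro!: Min_eqI[symmetric] Min_in)
  finally show ?thesis .
qed

text \<open>Sources of edges are the pairs with an extending but no active element. Targets are
  exactly the pairs with an active element: the smallest one, moved back to \<open>A\<close>, gives
  the source. Only pairs with neither remain.\<close>

lemma critical_gens_eq:
  assumes M: "matroid_on m K"
  shows "critical_gens m K =
    {(A, B) \<in> generators m K. int_active K A B = {} \<and> extending K A B = {}}"
proof -
  have "(\<exists>e \<in> matching m K. (A, B) = fst e \<or> (A, B) = snd e) \<longleftrightarrow>
      int_active K A B \<noteq> {} \<or> extending K A B \<noteq> {}" if g: "(A, B) \<in> generators m K" for A B
  proof -
    have sub: "A \<subseteq> {1..m}" "B \<subseteq> {1..m}" "A \<inter> B = {}" "B \<in> K" "finite A"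
      using g by (auto simp: generators_def intro: finite_subset)
    have 1: "(\<exists>e \<in> matching m K. (A, B) = fst e) \<longleftrightarrow> int_active K A B = {} \<and> extending K A B \<noteq> {}"
    proof
      assume "\<exists>e \<in> matching m K. (A, B) = fst e"
      then obtain a where "a \<in> match_up K (A, B)" by (auto simp: matching_def)
      then show "int_active K A B = {} \<and> extending K A B \<noteq> {}"
        using match_up_iff[OF M g] by blast
    next
      assume "int_active K A B = {} \<and> extending K A B \<noteq> {}"
      then obtain a where "a \<in> match_up K (A, B)" using match_up_iff[OF M g] by blast
      then have "((A, B), (A - {a}, {a} \<union> B)) \<in> matching m K"
        using g unfolding matching_def by blast
      then show "\<exists>e \<in> matching m K. (A, B) = fst e" by force
    qed
    have 2: "(\<exists>e \<in> matching m K. (A, B) = snd e) \<longleftrightarrow> int_active K A B \<noteq> {}"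
    proof
      assume "\<exists>e \<in> matching m K. (A, B) = snd e"
      then obtain A' B' a where e: "(A', B') \<in> generators m K" "a \<in> match_up K (A', B')"
        "A = A' - {a}" "B = insert a B'"
        by (auto simp: matching_def)
      then show "int_active K A B \<noteq> {}"
        using match_up_iff[OF M e(1)] Min_int_active_insert(1)[OF M, of A' B']
        by (auto simp: generators_def intro: finite_subset)
    next
      assume act: "int_active K A B \<noteq> {}"
      define b where "b = Min (int_active K A B)"
      note * = Min_extending_remove[OF M sub(3,5,4) act, folded b_def]
      have bB: "b \<in> B"
        using Min_in[OF _ act] matroid_on_finite[OF M sub(4)] by (auto simp: int_active_def b_def)
      have g': "(insert b A, B - {b}) \<in> generators m K"
        using g bB matroid_on_subset[OF M sub(4), of "B - {b}"] by (auto simp: generators_def)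
      have "b \<in> match_up K (insert b A, B - {b})"
        using match_up_iff[OF M g'] * by auto
      moreover have "insert b A - {b} = A" "{b} \<union> (B - {b}) = B"
        using bB sub by auto
      ultimately have "((insert b A, B - {b}), (A, B)) \<in> matching m K"
        using g' unfolding matching_def by (smt (verit, best) mem_Collect_eq)
      then show "\<exists>e \<in> matching m K. (A, B) = snd e" by force
    qed
    show ?thesis using 1 2 by blast
  qed
  note * = this
  have "g \<in> critical_gens m K \<longleftrightarrow>
    g \<in> {(A, B) \<in> generators m K. int_active K A B = {} \<and> extending K A B = {}}" for g
    using *[of "fst g" "snd g"] unfolding critical_gens_def by (cases g) (simp, blast)
  then show ?thesis by blast
qed

section \<open>Triangular systems\<close>

text \<open>The index \<open>x\<close> of largest rank is added last. The unknown \<open>b x\<close>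
  does not occur in the equations of the smaller indices, so the solution found for these can be
  kept, and equation \<open>x\<close> is solved by the inverse of the diagonal entry.\<close>

lemma triangular_solve:
  fixes Q :: "'i \<Rightarrow> 'i \<Rightarrow> 'k::comm_ring_1" and \<rho> :: "'i \<Rightarrow> nat"
  assumes "finite I"
    and "\<And>i. i \<in> I \<Longrightarrow> \<exists>r. Q i i * r = 1"
    and "\<And>i j. i \<in> I \<Longrightarrow> j \<in> I \<Longrightarrow> i \<noteq> j \<Longrightarrow> Q i j \<noteq> 0 \<Longrightarrow> \<rho> i < \<rho> j"
  shows "\<exists>b. \<forall>j\<in>I. (\<Sum>i\<in>I. Q i j * b i) = y j"
  using assms
proof (induction I rule: finite_ranking_induct[where f = \<rho>])
  case empty
  then show ?case by simp
next
  case (insert x S)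
  then obtain b where b: "\<forall>j\<in>S. (\<Sum>i\<in>S. Q i j * b i) = y j"
    by (metis insertCI)
  show ?case
  proof (cases "x \<in> S")
    case True
    then show ?thesis using b by (auto simp: insert_absorb)
  next
    case False
    obtain r where r: "Q x x * r = 1" using insert.prems(1)[of x] by auto
    define b' where "b' = b(x := r * (y x - (\<Sum>i\<in>S. Q i x * b i)))"
    have "(\<Sum>i\<in>S. Q i j * b' i) = (\<Sum>i\<in>S. Q i j * b i)" for j
      using False by (intro sum.cong) (auto simp: b'_def)
    moreover have "Q x j = 0" if "j \<in> S" for j
      using insert.prems(2)[of x j] insert.hyps(2)[OF that] False that by force
    moreover have "Q x x * (r * c) = c" for c
      using r by (metis mult.assoc mult_1)
    ultimately have "\<forall>j\<in>insert x S. (\<Sum>i\<in>insert x S. Q i j * b' i) = y j"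
      using b False insert.hyps(1) by (auto simp: b'_def)
    then show ?thesis by blast
  qed
qed

text \<open>The equations of the indices other than the top one do not involve the top unknown, so
  the remaining unknowns vanish by induction; then the top equation kills the last one.\<close>

lemma triangular_inj:
  fixes Q :: "'i \<Rightarrow> 'i \<Rightarrow> 'k::comm_ring_1" and \<rho> :: "'i \<Rightarrow> nat"
  assumes "finite I"
    and "\<And>i. i \<in> I \<Longrightarrow> \<exists>r. Q i i * r = 1"
    and "\<And>i j. i \<in> I \<Longrightarrow> j \<in> I \<Longrightarrow> i \<noteq> j \<Longrightarrow> Q i j \<noteq> 0 \<Longrightarrow> \<rho> i < \<rho> j"
    and "\<And>j. j \<in> I \<Longrightarrow> (\<Sum>i\<in>I. Q i j * b i) = 0"
  shows "\<forall>i\<in>I. b i = 0"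
  using assms
proof (induction I rule: finite_ranking_induct[where f = \<rho>])
  case empty
  then show ?case by simp
next
  case (insert x S)
  show ?case
  proof (cases "x \<in> S")
    case True
    then show ?thesis using insert by (auto simp: insert_absorb)
  next
    case False
    have "Q x j = 0" if "j \<in> S" for j
      using insert.prems(2)[of x j] insert.hyps(2)[OF that] False that by force
    then have S: "\<forall>i\<in>S. b i = 0"
      using insert.prems False insert.hyps(1) by (intro insert.IH) force+
    obtain r where r: "Q x x * r = 1" using insert.prems(1)[of x] by auto
    have "Q x x * b x = 0"
      using insert.prems(3)[of x] S False insert.hyps(1) by simp
    then have "b x = 0"
      using r by (metis mult.commute mult.left_commute mult_1 mult_zero_right)
    then show ?thesis using S by auto
  qed
qed

section \<open>Double complexes\<close>

text \<open>The two differentials commute. A zigzag is a cycle of the total complex up to signs: the sign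
  is absorbed by using different signs in the conditions for cycles and for boundaries.\<close>

locale double_complex =
  fixes D :: "nat \<Rightarrow> nat \<Rightarrow> 'a::ab_group_add set" and dh dv :: "nat \<Rightarrow> nat \<Rightarrow> 'a \<Rightarrow> 'a"
  assumes D_zero: "0 \<in> D p q"
    and D_diff: "x \<in> D p q \<Longrightarrow> y \<in> D p q \<Longrightarrow> x - y \<in> D p q"
    and dh_closed: "x \<in> D (Suc p) q \<Longrightarrow> dh p q x \<in> D p q"
    and dh_diff: "x \<in> D (Suc p) q \<Longrightarrow> y \<in> D (Suc p) q \<Longrightarrow> dh p q (x - y) = dh p q x - dh p q y"
    and dv_closed: "x \<in> D p (Suc q) \<Longrightarrow> dv p q x \<in> D p q"
    and dv_diff: "x \<in> D p (Suc q) \<Longrightarrow> y \<in> D p (Suc q) \<Longrightarrow> dv p q (x - y) = dv p q x - dv p q y"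
    and dh_dv: "x \<in> D (Suc p) (Suc q) \<Longrightarrow> dh p q (dv (Suc p) q x) = dv p q (dh p (Suc q) x)"
    and dh_dh: "x \<in> D (Suc (Suc p)) q \<Longrightarrow> dh p q (dh (Suc p) q x) = 0"
    and dv_dv: "x \<in> D p (Suc (Suc q)) \<Longrightarrow> dv p q (dv p (Suc q) x) = 0"
begin

definition zigzag :: "nat \<Rightarrow> (nat \<Rightarrow> 'a) \<Rightarrow> bool" where
  "zigzag n w \<longleftrightarrow> (\<forall>i\<le>n. w i \<in> D (n - i) i) \<and>
     (\<forall>i<n. dh (n - Suc i) i (w i) = dv (n - Suc i) i (w (Suc i)))"

lemma zigzag_diff:
  assumes "zigzag n w" "zigzag n w'"
  shows "zigzag n (\<lambda>i. w i - w' i)"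
  unfolding zigzag_def
proof (intro conjI allI impI)
  have wD: "w i \<in> D (n - i) i" "w' i \<in> D (n - i) i" if "i \<le> n" for i
    using assms that by (auto simp: zigzag_def)
  show "w i - w' i \<in> D (n - i) i" if "i \<le> n" for i
    using wD[OF that] by (rule D_diff)
  show "dh (n - Suc i) i (w i - w' i) = dv (n - Suc i) i (w (Suc i) - w' (Suc i))" if i: "i < n" for i
  proof -
    have "n - i = Suc (n - Suc i)" using i by simp
    then have "w i \<in> D (Suc (n - Suc i)) i" "w' i \<in> D (Suc (n - Suc i)) i"
      using wD[of i] i by auto
    moreover have "w (Suc i) \<in> D (n - Suc i) (Suc i)" "w' (Suc i) \<in> D (n - Suc i) (Suc i)"
      using wD[of "Suc i"] i by auto
    ultimately show ?thesis
      using assms i by (simp add: dh_diff dv_diff zigzag_def)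
  qed
qed

definition zigzag_boundary :: "nat \<Rightarrow> (nat \<Rightarrow> 'a) \<Rightarrow> bool" where
  "zigzag_boundary n w \<longleftrightarrow> (\<exists>b. (\<forall>i\<le>Suc n. b i \<in> D (Suc n - i) i) \<and>
     (\<forall>i\<le>n. w i = dh (n - i) i (b i) + dv (n - i) i (b (Suc i))))"

end

lemma double_complex_transpose:
  assumes "double_complex D dh dv"
  shows "double_complex (\<lambda>p q. D q p) (\<lambda>p q. dv q p) (\<lambda>p q. dh q p)"
  using assms unfolding double_complex_def by auto

lemma zigzag_transpose:
  assumes "double_complex D dh dv" and zz: "double_complex.zigzag D dh dv n w"
  shows "double_complex.zigzag (\<lambda>p q. D q p) (\<lambda>p q. dv q p) (\<lambda>p q. dh q p) n (\<lambda>i. w (n - i))"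
proof -
  interpret double_complex D dh dv by fact
  interpret T: double_complex "\<lambda>p q. D q p" "\<lambda>p q. dv q p" "\<lambda>p q. dh q p"
    by (rule double_complex_transpose) fact
  have "w (n - i) \<in> D i (n - i)" if "i \<le> n" for i
    using zz that unfolding zigzag_def by (metis diff_diff_cancel diff_le_self)
  moreover have "dv i (n - Suc i) (w (n - i)) = dh i (n - Suc i) (w (n - Suc i))" if "i < n" for i
  proof -
    have "n - Suc i < n" "n - Suc (n - Suc i) = i" "Suc (n - Suc i) = n - i" using that by auto
    then show ?thesis using zz unfolding zigzag_def by metis
  qed
  ultimately show ?thesis unfolding T.zigzag_def by auto
qed

lemma zigzag_boundary_transpose:
  assumes "double_complex D dh dv" and zz: "double_complex.zigzag_boundary D dh dv n w"
  shows "double_complex.zigzag_boundary (\<lambda>p q. D q p) (\<lambda>p q. dv q p) (\<lambda>p q. dh q p) n (\<lambda>i. w (n - i))"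
proof -
  interpret double_complex D dh dv by fact
  interpret T: double_complex "\<lambda>p q. D q p" "\<lambda>p q. dv q p" "\<lambda>p q. dh q p"
    by (rule double_complex_transpose) fact
  obtain b where b: "\<forall>i\<le>Suc n. b i \<in> D (Suc n - i) i"
    "\<forall>i\<le>n. w i = dh (n - i) i (b i) + dv (n - i) i (b (Suc i))"
    using zz unfolding zigzag_boundary_def by blast
  have "b (Suc n - i) \<in> D i (Suc n - i)" if "i \<le> Suc n" for i
    using b(1) that by (metis diff_diff_cancel diff_le_self)
  moreover have "w (n - i) = dv i (n - i) (b (Suc n - i)) + dh i (n - i) (b (Suc n - Suc i))"
    if "i \<le> n" for i
    using b(2)[rule_format, of "n - i"] that by (simp add: Suc_diff_le add.commute)
  ultimately show ?thesis
    unfolding T.zigzag_boundary_def by (intro exI[of _ "\<lambda>i. b (Suc n - i)"]) auto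
qed

section \<open>Double complexes with exact columns\<close>

locale augmented_double_complex = double_complex D dh dv
  for D :: "nat \<Rightarrow> nat \<Rightarrow> 'a::ab_group_add set" and dh dv :: "nat \<Rightarrow> nat \<Rightarrow> 'a \<Rightarrow> 'a" +
  fixes E :: "nat \<Rightarrow> 'e::ab_group_add set" and e :: "nat \<Rightarrow> 'e \<Rightarrow> 'e" and eps :: "nat \<Rightarrow> 'a \<Rightarrow> 'e"
  assumes eps_image: "eps p ` D p 0 = E p"
    and eps_diff: "x \<in> D p 0 \<Longrightarrow> y \<in> D p 0 \<Longrightarrow> eps p (x - y) = eps p x - eps p y"
    and eps_dh: "x \<in> D (Suc p) 0 \<Longrightarrow> eps p (dh p 0 x) = e p (eps (Suc p) x)"
    and eps_dv: "x \<in> D p 1 \<Longrightarrow> eps p (dv p 0 x) = 0"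
    and eps_exact: "x \<in> D p 0 \<Longrightarrow> eps p x = 0 \<Longrightarrow> x \<in> dv p 0 ` D p 1"
    and dv_exact: "x \<in> D p (Suc q) \<Longrightarrow> dv p q x = 0 \<Longrightarrow> x \<in> dv p (Suc q) ` D p (Suc (Suc q))"
begin

text \<open>Given \<open>w k\<close>, the element dh (w k) is a vertical cycle, because dv dh (w k)
  = dh dv (w k) = dh dh (w (k - 1)) = 0. By exactness of the column it is dv of the next entry. For
  \<open>k = 0\<close> the kernel of \<open>eps\<close> takes the place of that of
  \<open>dv\<close>, and the hypothesis that \<open>z\<close> is a cycle is used.\<close>

lemma zigzag_lift:
  assumes z: "z \<in> E n" "\<And>p. n = Suc p \<Longrightarrow> e p z = 0"
  obtains w where "zigzag n w" "eps n (w 0) = z"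
proof -
  have "\<exists>w. (\<forall>i\<le>k. w i \<in> D (n - i) i) \<and> eps n (w 0) = z \<and>
     (\<forall>i<k. dh (n - Suc i) i (w i) = dv (n - Suc i) i (w (Suc i)))" if "k \<le> n" for k
    using that
  proof (induction k)
    case 0
    obtain x where "x \<in> D n 0" "eps n x = z"
      using z(1) unfolding eps_image[of n, symmetric] by auto
    then show ?case by (intro exI[of _ "\<lambda>_. x"]) auto
  next
    case (Suc k)
    then obtain w where w: "\<forall>i\<le>k. w i \<in> D (n - i) i" "eps n (w 0) = z"
      "\<forall>i<k. dh (n - Suc i) i (w i) = dv (n - Suc i) i (w (Suc i))"
      by auto
    define p where "p = n - Suc k"
    have p: "n - k = Suc p" using Suc.prems by (auto simp: p_def)
    have wk: "w k \<in> D (Suc p) k" using w(1)[rule_format, of k] p by simp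
    have "\<exists>y\<in>D p (Suc k). dh p k (w k) = dv p k y"
    proof (cases k)
      case 0
      have "eps p (dh p 0 (w 0)) = 0"
        using eps_dh[of "w 0" p] wk w(2) z(2)[of p] p 0 by simp
      then have "dh p 0 (w 0) \<in> dv p 0 ` D p 1"
        using eps_exact dh_closed wk 0 by auto
      then show ?thesis using 0 by auto
    next
      case (Suc j)
      have j: "n - j = Suc (Suc p)" "n - Suc j = Suc p" using p Suc by auto
      have "dv p j (dh p k (w k)) = dh p j (dv (Suc p) j (w k))"
        using dh_dv wk Suc by simp
      also have "dv (Suc p) j (w k) = dh (Suc p) j (w j)"
        using w(3)[rule_format, of j] Suc j by simp
      also have "dh p j (dh (Suc p) j (w j)) = 0"
        using dh_dh w(1)[rule_format, of j] j Suc by simp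
      finally have "dh p k (w k) \<in> dv p (Suc j) ` D p (Suc (Suc j))"
        using dv_exact dh_closed wk Suc by simp
      then show ?thesis using Suc by auto
    qed
    then obtain y where y: "y \<in> D p (Suc k)" "dh p k (w k) = dv p k y" by blast
    show ?case
    proof (intro exI[of _ "w(Suc k := y)"] conjI allI impI)
      fix i assume "i \<le> Suc k"
      then show "(w(Suc k := y)) i \<in> D (n - i) i"
        using w(1) y(1) by (cases "i = Suc k") (auto simp: p_def)
    next
      fix i assume "i < Suc k"
      then show "dh (n - Suc i) i ((w(Suc k := y)) i) = dv (n - Suc i) i ((w(Suc k := y)) (Suc i))"
        using w(3) y(2) by (cases "i = k") (auto simp: p_def)
    qed (use w in auto)
  qed
  from this[of n] show ?thesis using that unfolding zigzag_def by auto
qed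

text \<open>The chain \<open>b\<close> is built entry by entry. The defect w (k+1) - dh b (k+1) is a
  vertical cycle, since its image is dh (w k - dv b (k+1)) = dh dh (b k) = 0; exactness of the
  column then yields b (k+2).\<close>

lemma zigzag_boundaryI:
  assumes w: "zigzag n w" and y: "y \<in> E (Suc n)" "eps n (w 0) = e n y"
  shows "zigzag_boundary n w"
proof -
  have wD: "w i \<in> D (n - i) i" if "i \<le> n" for i using w that by (auto simp: zigzag_def)
  have "\<exists>b. (\<forall>i\<le>Suc k. b i \<in> D (Suc n - i) i) \<and>
     (\<forall>i\<le>k. w i = dh (n - i) i (b i) + dv (n - i) i (b (Suc i)))" if "k \<le> n" for k
    using that
  proof (induction k)
    case 0
    obtain x where x: "x \<in> D (Suc n) 0" "eps (Suc n) x = y"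
      using y(1) unfolding eps_image[of "Suc n", symmetric] by auto
    have "eps n (w 0 - dh n 0 x) = 0"
      using eps_diff[of "w 0" n "dh n 0 x"] wD[of 0] dh_closed x eps_dh y by simp
    then obtain x' where "x' \<in> D n 1" "w 0 - dh n 0 x = dv n 0 x'"
      using eps_exact[of "w 0 - dh n 0 x" n] D_diff wD[of 0] dh_closed x by auto
    then show ?case
      using x by (intro exI[of _ "\<lambda>i. if i = 0 then x else x'"]) (auto simp: le_Suc_eq algebra_simps)
  next
    case (Suc k)
    then obtain b where b: "\<forall>i\<le>Suc k. b i \<in> D (Suc n - i) i"
      "\<forall>i\<le>k. w i = dh (n - i) i (b i) + dv (n - i) i (b (Suc i))" by auto
    define p where "p = n - Suc k"
    have p: "n - k = Suc p" "n - Suc k = p" using Suc.prems by (auto simp: p_def)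
    have wS: "w (Suc k) \<in> D p (Suc k)" using wD[of "Suc k"] p Suc.prems by simp
    have bS: "b (Suc k) \<in> D (Suc p) (Suc k)" "b k \<in> D (Suc (Suc p)) k"
      using b(1)[rule_format, of "Suc k"] b(1)[rule_format, of k] p Suc.prems
      by (auto simp: Suc_diff_le)
    have wk: "w k \<in> D (Suc p) k" using wD[of k] p Suc.prems by simp
    have "dv p k (w (Suc k) - dh p (Suc k) (b (Suc k))) =
        dh p k (w k) - dh p k (dv (Suc p) k (b (Suc k)))"
      using dv_diff[OF wS dh_closed[OF bS(1)]] w p Suc.prems dh_dv[OF bS(1)]
      unfolding zigzag_def by (metis Suc_le_eq)
    also have "\<dots> = dh p k (w k - dv (Suc p) k (b (Suc k)))"
      using dh_diff[OF wk dv_closed[OF bS(1)]] by simp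
    also have "w k - dv (Suc p) k (b (Suc k)) = dh (Suc p) k (b k)"
      using b(2) p by simp
    finally have "dv p k (w (Suc k) - dh p (Suc k) (b (Suc k))) = 0"
      using dh_dh[OF bS(2)] by simp
    then obtain x where x: "x \<in> D p (Suc (Suc k))" "w (Suc k) - dh p (Suc k) (b (Suc k)) = dv p (Suc k) x"
      using dv_exact[of "w (Suc k) - dh p (Suc k) (b (Suc k))" p k] D_diff wS dh_closed bS by auto
    show ?case
    proof (intro exI[of _ "b(Suc (Suc k) := x)"] conjI allI impI)
      fix i assume "i \<le> Suc (Suc k)"
      then show "(b(Suc (Suc k) := x)) i \<in> D (Suc n - i) i"
        using b(1) x(1) p by (cases "i = Suc (Suc k)") auto
    next
      fix i assume "i \<le> Suc k"
      then show "w i = dh (n - i) i ((b(Suc (Suc k) := x)) i) + dv (n - i) i ((b(Suc (Suc k) := x)) (Suc i))"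
        using b(2) x(2) p by (cases "i = Suc k") (auto simp: algebra_simps)
    qed
  qed
  from this[of n] show ?thesis unfolding zigzag_boundary_def by auto
qed

lemma eps_zigzag_boundary:
  assumes "zigzag_boundary n w"
  obtains y where "y \<in> E (Suc n)" "eps n (w 0) = e n y"
proof -
  obtain b where b: "\<forall>i\<le>Suc n. b i \<in> D (Suc n - i) i"
    "\<forall>i\<le>n. w i = dh (n - i) i (b i) + dv (n - i) i (b (Suc i))"
    using assms unfolding zigzag_boundary_def by blast
  have b0: "b 0 \<in> D (Suc n) 0" "b 1 \<in> D n 1"
    using b(1)[rule_format, of 0] b(1)[rule_format, of 1] by auto
  have D: "dh n 0 (b 0) \<in> D n 0" "dv n 0 (b 1) \<in> D n 0" "0 \<in> D n 0"
    using b0 dh_closed dv_closed D_zero by auto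
  \<comment> \<open>The locale provides closure and additivity for differences only, so the sum is
    written as a difference.\<close>
  have "w 0 = dh n 0 (b 0) - (0 - dv n 0 (b 1))" using b(2)[rule_format, of 0] by simp
  then have "eps n (w 0) = eps n (dh n 0 (b 0)) - (eps n 0 - eps n (dv n 0 (b 1)))"
    using eps_diff D D_diff by metis
  also have "eps n 0 = 0" using eps_diff[OF D(3) D(3)] by simp
  also have "eps n (dv n 0 (b 1)) = 0" using eps_dv b0 by simp
  also have "eps n (dh n 0 (b 0)) = e n (eps (Suc n) (b 0))" using eps_dh b0 by simp
  finally have "eps n (w 0) = e n (eps (Suc n) (b 0))" by simp
  moreover have "eps (Suc n) (b 0) \<in> E (Suc n)" using eps_image b0 by blast
  ultimately show ?thesis using that by blast
qed

lemma eps_zigzag_cycle: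
  assumes "zigzag (Suc p) w"
  shows "e p (eps (Suc p) (w 0)) = 0"
proof -
  have "w 0 \<in> D (Suc p) 0" "w 1 \<in> D p 1" "dh p 0 (w 0) = dv p 0 (w 1)"
    using assms by (auto simp: zigzag_def)
  then show ?thesis using eps_dh eps_dv by metis
qed

end

section \<open>Double complexes exact in both directions\<close>

locale biaugmented_double_complex =
  L: augmented_double_complex D dh dv E e eps +
  R: augmented_double_complex "\<lambda>p q. D q p" "\<lambda>p q. dv q p" "\<lambda>p q. dh q p" G g eta
  for D :: "nat \<Rightarrow> nat \<Rightarrow> 'a::ab_group_add set" and dh dv :: "nat \<Rightarrow> nat \<Rightarrow> 'a \<Rightarrow> 'a"
    and E :: "nat \<Rightarrow> 'e::ab_group_add set" and e :: "nat \<Rightarrow> 'e \<Rightarrow> 'e" and eps :: "nat \<Rightarrow> 'a \<Rightarrow> 'e"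
    and G :: "nat \<Rightarrow> 'g::ab_group_add set" and g :: "nat \<Rightarrow> 'g \<Rightarrow> 'g" and eta :: "nat \<Rightarrow> 'a \<Rightarrow> 'g"
begin

lemma transpose_iff:
  "R.zigzag n (\<lambda>i. w (n - i)) \<longleftrightarrow> L.zigzag n w"
  "R.zigzag_boundary n (\<lambda>i. w (n - i)) \<longleftrightarrow> L.zigzag_boundary n w"
proof -
  \<comment> \<open>Reversing twice is the identity only for indices up to \<open>n\<close>, but
    these are the only entries that the two predicates inspect.\<close>
  have 1: "L.zigzag n (\<lambda>i. w (n - (n - i))) = L.zigzag n w"
    unfolding L.zigzag_def by (intro conj_cong all_cong) auto
  have 2: "L.zigzag_boundary n (\<lambda>i. w (n - (n - i))) = L.zigzag_boundary n w"
    unfolding L.zigzag_boundary_def by (intro ex_cong1 conj_cong all_cong) auto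
  show "R.zigzag n (\<lambda>i. w (n - i)) \<longleftrightarrow> L.zigzag n w"
    using zigzag_transpose[OF L.double_complex_axioms, of n w]
      zigzag_transpose[OF R.double_complex_axioms, of n "\<lambda>i. w (n - i)"] 1 by auto
  show "R.zigzag_boundary n (\<lambda>i. w (n - i)) \<longleftrightarrow> L.zigzag_boundary n w"
    using zigzag_boundary_transpose[OF L.double_complex_axioms, of n w]
      zigzag_boundary_transpose[OF R.double_complex_axioms, of n "\<lambda>i. w (n - i)"] 2 by auto
qed

lemma zigzag_lift_right:
  assumes "z \<in> G n" "\<And>p. n = Suc p \<Longrightarrow> g p z = 0"
  obtains w where "L.zigzag n w" "eta n (w n) = z"
proof -
  obtain w where w: "R.zigzag n w" "eta n (w 0) = z"
    using R.zigzag_lift assms by blast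
  then have "L.zigzag n (\<lambda>i. w (n - i))"
    using zigzag_transpose[OF R.double_complex_axioms, of n w] by simp
  then show ?thesis using that w(2) by force
qed

text \<open>Being a boundary is a property of the whole zigzag, and exactness in either direction
  allows it to be tested at the corresponding end. This carries the comparison of the two
  homologies.\<close>

lemma zigzag_boundary_iff:
  assumes w: "L.zigzag n w"
  shows "eps n (w 0) \<in> e n ` E (Suc n) \<longleftrightarrow> eta n (w n) \<in> g n ` G (Suc n)"
proof -
  have "eps n (w 0) \<in> e n ` E (Suc n) \<longleftrightarrow> L.zigzag_boundary n w"
    using L.zigzag_boundaryI[OF w] L.eps_zigzag_boundary by blast
  also have "\<dots> \<longleftrightarrow> R.zigzag_boundary n (\<lambda>i. w (n - i))"
    using transpose_iff by simp
  also have "\<dots> \<longleftrightarrow> eta n (w n) \<in> g n ` G (Suc n)"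
  proof
    assume "R.zigzag_boundary n (\<lambda>i. w (n - i))"
    then obtain y where "y \<in> G (Suc n)" "eta n (w (n - 0)) = g n y"
      by (rule R.eps_zigzag_boundary)
    then show "eta n (w n) \<in> g n ` G (Suc n)" by simp
  next
    assume "eta n (w n) \<in> g n ` G (Suc n)"
    then obtain y where "y \<in> G (Suc n)" "eta n (w (n - 0)) = g n y" by auto
    moreover have "R.zigzag n (\<lambda>i. w (n - i))" using transpose_iff(1) w by simp
    ultimately show "R.zigzag_boundary n (\<lambda>i. w (n - i))"
      by (intro R.zigzag_boundaryI)
  qed
  finally show ?thesis .
qed

lemma eta_zigzag_cycle:
  assumes "L.zigzag (Suc p) w"
  shows "g p (eta (Suc p) (w (Suc p))) = 0"
  using R.eps_zigzag_cycle[of p "\<lambda>i. w (Suc p - i)"] transpose_iff(1) assms by simp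

end

section \<open>Polynomials\<close>

abbreviation lookup :: "('a \<Rightarrow>\<^sub>0 'b::zero) \<Rightarrow> 'a \<Rightarrow> 'b" where
  "lookup \<equiv> Poly_Mapping.lookup"

abbreviation keys :: "('a \<Rightarrow>\<^sub>0 'b::zero) \<Rightarrow> 'a set" where
  "keys \<equiv> Poly_Mapping.keys"

text \<open>This truncation serves two purposes: selecting monomials with support in
  \<open>K\<close> gives the normal form modulo the Stanley-Reisner ideal, and selecting monomials
  of one degree gives a homogeneous component.\<close>

definition restr :: "('a \<Rightarrow> bool) \<Rightarrow> ('a \<Rightarrow>\<^sub>0 'b::zero) \<Rightarrow> ('a \<Rightarrow>\<^sub>0 'b)" where
  "restr P p = Abs_poly_mapping (\<lambda>t. if P t then lookup p t else 0)"

lemma lookup_restr: "lookup (restr P p) t = (if P t then lookup p t else 0)"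
proof -
  have "finite {t. (if P t then lookup p t else 0) \<noteq> 0}"
    by (rule finite_subset[OF _ finite_lookup[of p]]) (auto split: if_splits)
  then show ?thesis by (simp add: restr_def)
qed

lemma keys_restr: "keys (restr P p) = {t \<in> keys p. P t}"
  by (auto simp: in_keys_iff lookup_restr split: if_splits)

lemma restr_zero [simp]: "restr P 0 = 0"
  by (rule poly_mapping_eqI) (simp add: lookup_restr)

lemma restr_diff: "restr P (p - q) = restr P p - restr P (q :: 'a \<Rightarrow>\<^sub>0 'b::ab_group_add)"
  by (rule poly_mapping_eqI) (simp add: lookup_restr lookup_minus)

lemma restr_sum: "restr P (sum f A) = (\<Sum>x\<in>A. restr P (f x :: 'a \<Rightarrow>\<^sub>0 'b::comm_monoid_add))"
  by (rule poly_mapping_eqI) (simp add: lookup_restr lookup_sum)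

lemma restr_id: "(\<And>t. t \<in> keys p \<Longrightarrow> P t) \<Longrightarrow> restr P p = p"
  by (rule poly_mapping_eqI) (auto simp: lookup_restr in_keys_iff)

lemma restr_eq_0: "(\<And>t. t \<in> keys p \<Longrightarrow> \<not> P t) \<Longrightarrow> restr P p = 0"
  by (rule poly_mapping_eqI) (auto simp: lookup_restr in_keys_iff)

text \<open>Split \<open>p\<close> into the monomials with and without \<open>P\<close>. Multiplied
  by monomials of \<open>h\<close>, the former all satisfy \<open>Q\<close> and the latter never
  do.\<close>

lemma restr_mult:
  fixes h p :: "'a::monoid_add \<Rightarrow>\<^sub>0 'b::comm_ring_1"
  assumes "\<And>s t. s \<in> keys h \<Longrightarrow> t \<in> keys p \<Longrightarrow> Q (s + t) \<longleftrightarrow> P t"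
  shows "restr Q (h * p) = h * restr P p"
proof -
  have p: "p = restr P p + restr (\<lambda>t. \<not> P t) p"
    by (rule poly_mapping_eqI) (simp add: lookup_restr lookup_add)
  have 1: "restr Q (h * restr P p) = h * restr P p"
    by (rule restr_id) (use keys_mult[of h "restr P p"] assms in \<open>fastforce simp: keys_restr\<close>)
  have 2: "restr Q (h * restr (\<lambda>t. \<not> P t) p) = 0"
    by (rule restr_eq_0)
      (use keys_mult[of h "restr (\<lambda>t. \<not> P t) p"] assms in \<open>fastforce simp: keys_restr\<close>)
  have "restr Q (h * p) = restr Q (h * restr P p - (0 - h * restr (\<lambda>t. \<not> P t) p))"
    by (subst p) (simp add: algebra_simps)
  also have "\<dots> = h * restr P p"
    by (simp only: restr_diff 1 2) simp
  finally show ?thesis .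
qed

lemma keys_add_nat: "keys (s + t :: 'a \<Rightarrow>\<^sub>0 nat) = keys s \<union> keys t"
  by (auto simp: in_keys_iff lookup_add)

definition mdeg :: "('a \<Rightarrow>\<^sub>0 nat) \<Rightarrow> nat" where
  "mdeg t = (\<Sum>i\<in>keys t. lookup t i)"

lemma mdeg_superset: "finite A \<Longrightarrow> keys t \<subseteq> A \<Longrightarrow> mdeg t = (\<Sum>i\<in>A. lookup t i)"
  unfolding mdeg_def by (rule sum.mono_neutral_left) (auto simp: in_keys_iff)

lemma mdeg_add: "mdeg (s + t) = mdeg s + mdeg t"
  by (simp add: mdeg_superset[of "keys s \<union> keys t"] keys_add_nat lookup_add sum.distrib)

lemma mdeg_single [simp]: "mdeg (Poly_Mapping.single i n) = n"
  by (cases "n = 0") (simp_all add: mdeg_def)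

lemma mdeg_zero [simp]: "mdeg 0 = 0"
  by (simp add: mdeg_def)

definition var :: "nat \<Rightarrow> 'k::comm_ring_1 mpoly" where
  "var i = Poly_Mapping.single (Poly_Mapping.single i 1) 1"

lemma add_single_diff:
  assumes "i \<in> keys t"
  shows "Poly_Mapping.single i 1 + (t - Poly_Mapping.single i 1) = (t :: nat \<Rightarrow>\<^sub>0 nat)"
proof (rule poly_mapping_eqI)
  fix j show "lookup (Poly_Mapping.single i 1 + (t - Poly_Mapping.single i 1)) j = lookup t j"
    using assms by (auto simp: lookup_add lookup_minus lookup_single in_keys_iff when_def)
qed

lemma lookup_var_mult:
  "lookup (var i * p) t = (if i \<in> keys t then lookup p (t - Poly_Mapping.single i 1) else 0)"
proof -
  have "lookup (var i * p) t = (\<Sum>q. lookup p q when t = Poly_Mapping.single i 1 + q)"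
    unfolding lookup_mult var_def lookup_single when_mult by simp
  also have "\<dots> = (if i \<in> keys t then lookup p (t - Poly_Mapping.single i 1) else 0)"
  proof (cases "i \<in> keys t")
    case True
    then have "t = Poly_Mapping.single i 1 + q \<longleftrightarrow> q = t - Poly_Mapping.single i 1" for q
      using add_single_diff[OF True] by auto
    then show ?thesis using True by simp
  next
    case False
    then have "t \<noteq> Poly_Mapping.single i 1 + q" for q
      by (auto simp: keys_add_nat)
    then show ?thesis using False by simp
  qed
  finally show ?thesis .
qed

text \<open>Exponents are natural numbers, so the zero exponent vector is a sum only of zero
  vectors.\<close>

lemma lookup_mult_at_zero:
  fixes p q :: "'k::comm_ring_1 mpoly"
  shows "lookup (p * q) 0 = lookup p 0 * lookup q 0"
proof -
  have 0: "(0 = s + t) \<longleftrightarrow> s = 0 \<and> t = 0" for s t :: "nat \<Rightarrow>\<^sub>0 nat"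
    by (metis add.left_neutral keys_add_nat keys_eq_empty sup_eq_bot_iff)
  show ?thesis
    unfolding lookup_mult 0 when_when[symmetric] Sum_any_when_independent mult_when Sum_any_when_equal
    by (simp add: when_when[symmetric] Sum_any_when_independent mult_when del: when_when)
qed

lemma lookup_sign_mult:
  "lookup ((- 1) ^ n * p) t = (- 1) ^ n * lookup (p :: 'k::comm_ring_1 mpoly) t"
  by (cases "even n") simp_all

text \<open>The homogeneous polynomials of degree \<open>e\<close>, every variable having degree 2, all of whose
  monomials have support in \<open>K\<close>; they represent the component of degree \<open>e\<close> of \<open>k[K]\<close>.\<close>

definition face_polys :: "nat set set \<Rightarrow> int \<Rightarrow> 'k::comm_ring_1 mpoly set" where
  "face_polys K e = {p. \<forall>t\<in>keys p. keys t \<in> K \<and> 2 * int (mdeg t) = e}"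

abbreviation face_part :: "nat set set \<Rightarrow> 'k::comm_ring_1 mpoly \<Rightarrow> 'k mpoly" where
  "face_part K \<equiv> restr (\<lambda>t. keys t \<in> K)"

lemma face_polys_zero [simp]: "0 \<in> face_polys K e"
  by (simp add: face_polys_def)

lemma face_polys_diff: "p \<in> face_polys K e \<Longrightarrow> q \<in> face_polys K e \<Longrightarrow> p - q \<in> face_polys K e"
  using keys_diff[of p q] by (auto simp: face_polys_def)

lemma keys_sum_subset: "keys (sum f A) \<subseteq> (\<Union>x\<in>A. keys (f x))"
proof (induction A rule: infinite_finite_induct)
  case (insert x F)
  have "keys (sum f (insert x F)) \<subseteq> keys (f x) \<union> keys (sum f F)"
    using insert.hyps Poly_Mapping.keys_add[of "f x" "sum f F"] by simp
  then show ?case using insert.IH by blast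
qed auto

lemma face_polys_sum: "(\<And>x. x \<in> A \<Longrightarrow> f x \<in> face_polys K e) \<Longrightarrow> sum f A \<in> face_polys K e"
  unfolding face_polys_def using keys_sum_subset[of f A] by (auto 0 3 dest: subsetD)

lemma face_polys_mult:
  assumes "p \<in> face_polys (Pow V) e" "q \<in> face_polys (Pow V) e'"
  shows "p * q \<in> face_polys (Pow V) (e + e')"
  using keys_mult[of p q] assms by (fastforce simp: face_polys_def keys_add_nat mdeg_add)

lemma var_face_polys: "i \<in> V \<Longrightarrow> var i \<in> face_polys (Pow V) 2"
  by (simp add: face_polys_def var_def)

lemma sign_face_polys: "(- 1) ^ n \<in> (face_polys (Pow V) 0 :: 'k::comm_ring_1 mpoly set)"
proof -
  have "keys ((- 1) ^ n :: 'k mpoly) \<subseteq> {0}"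
    by (cases "even n") auto
  then show ?thesis by (auto simp: face_polys_def)
qed

lemma face_part_closed: "p \<in> face_polys (Pow V) e \<Longrightarrow> face_part K p \<in> face_polys K e"
  by (auto simp: face_polys_def keys_restr)

text \<open>Monomials with non-face support stay such after multiplication because \<open>K\<close>
  is closed under subsets. Hence truncated products of normal forms compute products in
  k[K].\<close>

lemma face_part_mult_face_part:
  assumes "\<And>\<sigma> \<tau>. \<sigma> \<in> K \<Longrightarrow> \<tau> \<subseteq> \<sigma> \<Longrightarrow> \<tau> \<in> K"
  shows "face_part K (h * face_part K p) = face_part K (h * p)"
proof -
  have "face_part K (h * p) - face_part K (h * face_part K p) = face_part K (h * (p - face_part K p))"
    by (simp add: restr_diff right_diff_distrib)
  also have "\<dots> = 0"
  proof (rule restr_eq_0)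
    fix t assume "t \<in> keys (h * (p - face_part K p))"
    then obtain s u where "t = s + u" "u \<in> keys (p - face_part K p)"
      using keys_mult by blast
    then show "keys t \<notin> K"
      using assms by (auto simp: in_keys_iff lookup_minus lookup_restr keys_add_nat split: if_splits)
  qed
  finally show ?thesis by simp
qed

section \<open>The Koszul complex\<close>

text \<open>The exponent is the position of \<open>i\<close> in \<open>insert i S\<close>, counted
  from 0; compared with the sign (-1)^k in R*(K) this is one global factor -1.\<close>

definition ksign :: "nat \<Rightarrow> nat set \<Rightarrow> 'a::comm_ring_1" where
  "ksign i S = (- 1) ^ card {s \<in> S. s < i}"

text \<open>The usual Koszul differential, written in coordinates: \<open>g S\<close> is the
  coefficient of u_S, and the image has at u_S one contribution from each u_T with T = S + i, which
  exchanges u_i for v_i.\<close>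

definition koszul :: "nat \<Rightarrow> (nat set \<Rightarrow> 'k::comm_ring_1 mpoly) \<Rightarrow> nat set \<Rightarrow> 'k mpoly" where
  "koszul m g S = (\<Sum>i\<in>{1..m} - S. ksign i S * var i * g (insert i S))"

text \<open>The component of degree \<open>d\<close> of \<open>k[K] \<otimes> \<Lambda>\<^sup>q\<close>.\<close>

definition koszul_chains :: "nat \<Rightarrow> nat set set \<Rightarrow> nat \<Rightarrow> int \<Rightarrow> (nat set \<Rightarrow> 'k::comm_ring_1 mpoly) set" where
  "koszul_chains m K q d = {g. \<forall>S. if S \<subseteq> {1..m} \<and> card S = q then g S \<in> face_polys K (d - 2 * int q)
     else g S = 0}"

text \<open>Elements of k[K] are stored as polynomials without non-face monomials, so multiplication
  by the variables has to be followed by truncation.\<close>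

definition face_koszul :: "nat \<Rightarrow> nat set set \<Rightarrow> (nat set \<Rightarrow> 'k::comm_ring_1 mpoly) \<Rightarrow> nat set \<Rightarrow> 'k mpoly" where
  "face_koszul m K g S = face_part K (koszul m g S)"

lemma koszul_chains_zero: "0 \<in> koszul_chains m K q d"
  by (simp add: koszul_chains_def)

lemma koszul_chains_diff:
  "f \<in> koszul_chains m K q d \<Longrightarrow> g \<in> koszul_chains m K q d \<Longrightarrow> f - g \<in> koszul_chains m K q d"
  by (auto simp: koszul_chains_def intro!: face_polys_diff split: if_splits)

lemma koszul_diff: "koszul m (f - g) = koszul m f - koszul m g"
  by (rule ext) (simp add: koszul_def right_diff_distrib sum_subtractf)

lemma face_koszul_diff: "face_koszul m K (f - g) = face_koszul m K f - face_koszul m K g"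
  by (rule ext) (simp add: face_koszul_def koszul_diff restr_diff)

lemma koszul_closed:
  fixes g :: "nat set \<Rightarrow> 'k::comm_ring_1 mpoly"
  assumes "g \<in> koszul_chains m (Pow {1..m}) (Suc q) d"
  shows "koszul m g \<in> koszul_chains m (Pow {1..m}) q d"
  unfolding koszul_chains_def
proof (intro CollectI allI)
  fix S
  have g: "if S \<subseteq> {1..m} \<and> card S = Suc q then g S \<in> face_polys (Pow {1..m}) (d - 2 * int (Suc q)) else g S = 0" for S
    using assms unfolding koszul_chains_def by blast
  show "if S \<subseteq> {1..m} \<and> card S = q then koszul m g S \<in> face_polys (Pow {1..m}) (d - 2 * int q)
     else koszul m g S = 0"
  proof (cases "S \<subseteq> {1..m} \<and> card S = q")
    case True
    have "ksign i S * var i * g (insert i S) \<in> face_polys (Pow {1..m}) (d - 2 * int q)"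
      if "i \<in> {1..m} - S" for i
    proof -
      have "card (insert i S) = Suc q"
        using that True finite_subset[of S "{1..m}"] by simp
      then have "g (insert i S) \<in> face_polys (Pow {1..m}) (d - 2 * int (Suc q))"
        using g[of "insert i S"] that True by auto
      then have "ksign i S * var i * g (insert i S) \<in> face_polys (Pow {1..m}) (0 + 2 + (d - 2 * int (Suc q)))"
        unfolding ksign_def using that
        by (intro face_polys_mult sign_face_polys var_face_polys) auto
      then show ?thesis by (simp add: algebra_simps)
    qed
    then show ?thesis using True by (auto simp: koszul_def intro!: face_polys_sum)
  next
    case False
    have "g (insert i S) = 0" if "i \<in> {1..m} - S" for i
    proof (cases "S \<subseteq> {1..m}")
      case True
      then have "card (insert i S) \<noteq> Suc q"
        using that False finite_subset[of S "{1..m}"] by simp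
      then show ?thesis using g[of "insert i S"] by auto
    qed (use g[of "insert i S"] in auto)
    then show ?thesis using False by (simp add: koszul_def)
  qed
qed

lemma koszul_chains_mono: "K \<subseteq> L \<Longrightarrow> koszul_chains m K q d \<subseteq> koszul_chains m L q d"
  by (auto simp: koszul_chains_def face_polys_def split: if_splits)

lemma face_koszul_closed:
  assumes "g \<in> koszul_chains m K (Suc q) d" "K \<subseteq> Pow {1..m}"
  shows "face_koszul m K g \<in> koszul_chains m K q d"
proof -
  have "koszul m g \<in> koszul_chains m (Pow {1..m}) q d"
    using assms(1) koszul_chains_mono[OF assms(2)] by (intro koszul_closed) blast
  then have "if S \<subseteq> {1..m} \<and> card S = q then koszul m g S \<in> face_polys (Pow {1..m}) (d - 2 * int q)
      else koszul m g S = 0" for S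
    unfolding koszul_chains_def by blast
  then have "if S \<subseteq> {1..m} \<and> card S = q then face_koszul m K g S \<in> face_polys K (d - 2 * int q)
      else face_koszul m K g S = 0" for S
    using face_part_closed[of "koszul m g S" "{1..m}" "d - 2 * int q" K] unfolding face_koszul_def
    by (metis restr_zero)
  then show ?thesis unfolding koszul_chains_def by blast
qed

lemma face_koszul_Pow:
  assumes "g \<in> koszul_chains m (Pow {1..m}) (Suc q) d"
  shows "face_koszul m (Pow {1..m}) g = koszul m g"
proof
  fix S
  have "koszul m g \<in> koszul_chains m (Pow {1..m}) q d"
    using assms by (rule koszul_closed)
  then have "koszul m g S \<in> face_polys (Pow {1..m}) (d - 2 * int q)"
    by (cases "S \<subseteq> {1..m} \<and> card S = q") (auto simp: koszul_chains_def)
  then show "face_koszul m (Pow {1..m}) g S = koszul m g S"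
    unfolding face_koszul_def by (intro restr_id) (simp add: face_polys_def)
qed

text \<open>For \<open>i < j\<close>, inserting \<open>i\<close> adds one element below
  \<open>j\<close>, whereas inserting \<open>j\<close> adds none below \<open>i\<close>.\<close>

lemma ksign_swap:
  assumes "finite S" "i \<notin> S" "j \<notin> S" "i \<noteq> j"
  shows "ksign i S * ksign j (insert i S) = - (ksign j S * ksign i (insert j S) :: 'a::comm_ring_1)"
  using assms
proof (induction i j rule: linorder_wlog)
  case (le i j)
  have 1: "{s \<in> insert i S. s < j} = insert i {s \<in> S. s < j}" "{s \<in> insert j S. s < i} = {s \<in> S. s < i}"
    using le by auto
  show ?case
    unfolding ksign_def 1 using le by simp
next
  case (sym j i)
  have "ksign i S * ksign j (insert i S) = - (ksign j S * ksign i (insert j S) :: 'a)"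
    using sym by blast
  then show ?case by simp
qed

lemma koszul_koszul:
  fixes g :: "nat set \<Rightarrow> 'k::comm_ring_1 mpoly"
  assumes "\<And>S. \<not> S \<subseteq> {1..m} \<Longrightarrow> g S = 0"
  shows "koszul m (koszul m g) = 0"
proof
  fix S
  show "koszul m (koszul m g) S = 0 S"
  proof (cases "S \<subseteq> {1..m}")
    case True
    then have fin: "finite S" by (rule finite_subset) simp
    define c :: "nat \<Rightarrow> nat \<Rightarrow> 'k mpoly" where "c i j = ksign i S * ksign j (insert i S) *
      (var i * var j * g (insert i (insert j S)))" for i j
    define V where "V = {1..m} - S"
    have V: "finite V" by (simp add: V_def)
    have fV: "finite {(i, j) \<in> V \<times> V. P i j}" for P
      by (rule finite_subset[of _ "V \<times> V"]) (use V in auto)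
    have "koszul m (koszul m g) S = (\<Sum>i\<in>V. \<Sum>j\<in>V - {i}. c i j)"
      unfolding koszul_def sum_distrib_left V_def c_def
      by (intro sum.cong) (auto simp: insert_commute algebra_simps)
    also have "\<dots> = (\<Sum>(i, j)\<in>(SIGMA i:V. V - {i}). c i j)"
      using V by (subst sum.Sigma) auto
    \<comment> \<open>The ordered pairs are split by which index is smaller; swapping the indices
      matches the halves with opposite signs.\<close>
    also have "(SIGMA i:V. V - {i}) = {(i, j) \<in> V \<times> V. i < j} \<union> {(i, j) \<in> V \<times> V. j < i}"
      by auto
    also have "(\<Sum>(i, j)\<in>\<dots>. c i j) =
        (\<Sum>(i, j)\<in>{(i, j) \<in> V \<times> V. i < j}. c i j) + (\<Sum>(i, j)\<in>{(i, j) \<in> V \<times> V. j < i}. c i j)"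
      by (intro sum.union_disjoint fV) auto
    also have "(\<Sum>(i, j)\<in>{(i, j) \<in> V \<times> V. j < i}. c i j) = (\<Sum>(i, j)\<in>{(i, j) \<in> V \<times> V. i < j}. c j i)"
      by (rule sum.reindex_bij_witness[of _ "\<lambda>(i, j). (j, i)" "\<lambda>(i, j). (j, i)"]) auto
    also have "\<dots> = (\<Sum>(i, j)\<in>{(i, j) \<in> V \<times> V. i < j}. - c i j)"
    proof (intro sum.cong refl, clarify)
      fix i j assume "i \<in> V" "j \<in> V" "i < j"
      then have "ksign j S * ksign i (insert j S) = - (ksign i S * ksign j (insert i S) :: 'k mpoly)"
        using ksign_swap[OF fin, of j i] by (auto simp: V_def)
      then show "c j i = - c i j"
        by (simp add: c_def insert_commute mult.commute mult.left_commute)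
    qed
    finally show ?thesis by (simp add: sum_negf case_prod_unfold)
  next
    case False
    then show ?thesis using assms by (auto simp: koszul_def intro!: sum.neutral)
  qed
qed

lemma koszul_face_part:
  assumes K: "\<And>\<sigma> \<tau>. \<sigma> \<in> K \<Longrightarrow> \<tau> \<subseteq> \<sigma> \<Longrightarrow> \<tau> \<in> K"
  shows "face_koszul m K (\<lambda>S. face_part K (g S)) = face_koszul m K g"
  by (simp add: face_koszul_def koszul_def restr_sum face_part_mult_face_part[OF K] fun_eq_iff)

lemma face_koszul_face_koszul:
  assumes K: "\<And>\<sigma> \<tau>. \<sigma> \<in> K \<Longrightarrow> \<tau> \<subseteq> \<sigma> \<Longrightarrow> \<tau> \<in> K" and g: "g \<in> koszul_chains m K q d"
  shows "face_koszul m K (face_koszul m K g) = 0"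
proof -
  have "face_koszul m K (face_koszul m K g) = face_koszul m K (koszul m g)"
    using koszul_face_part[OF K, where g = "koszul m g"] by (simp add: face_koszul_def[abs_def])
  also have "\<dots> = (\<lambda>S. face_part K (koszul m (koszul m g) S))"
    by (simp add: face_koszul_def fun_eq_iff)
  also have "koszul m (koszul m g) = 0"
    using g by (intro koszul_koszul) (auto simp: koszul_chains_def split: if_splits)
  finally show ?thesis by (simp add: restr_eq_0 fun_eq_iff)
qed

lemma lookup_face_koszul:
  assumes "K \<subseteq> Pow {1..m}" "keys t \<in> K"
  shows "lookup (face_koszul m K g S) t =
    (\<Sum>i\<in>keys t - S. ksign i S * lookup (g (insert i S)) (t - Poly_Mapping.single i 1))"
proof -
  have "lookup (face_koszul m K g S) t = (\<Sum>i\<in>{1..m} - S. ksign i S * lookup (var i * g (insert i S)) t)"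
    using assms(2) by (simp add: face_koszul_def koszul_def lookup_restr lookup_sum ksign_def
        lookup_sign_mult mult.assoc)
  also have "\<dots> = (\<Sum>i\<in>keys t - S. ksign i S * lookup (var i * g (insert i S)) t)"
    using assms by (intro sum.mono_neutral_right) (auto simp: lookup_var_mult)
  finally show ?thesis by (simp add: lookup_var_mult)
qed

section \<open>The matching on the cells of the Koszul complex\<close>

text \<open>The pair \<open>(S, t)\<close> stands for the basis element \<open>v\<^sup>t \<otimes> u\<^sub>S\<close> of \<open>k[K] \<otimes> \<Lambda>\<close>. Its multidegree
  is \<open>t\<close> plus the indicator of \<open>S\<close>; if the latter is not squarefree, the cell is matched along the
  smallest index with exponent at least 2, otherwise along the matching of the generators of
  \<open>R\<^sup>*(K)\<close>.\<close>

definition cells :: "nat \<Rightarrow> nat set set \<Rightarrow> nat \<Rightarrow> int \<Rightarrow> (nat set \<times> (nat \<Rightarrow>\<^sub>0 nat)) set" where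
  "cells m K q d = {(S, t). S \<subseteq> {1..m} \<and> card S = q \<and> keys t \<in> K \<and> 2 * int (mdeg t) + 2 * int q = d}"

definition multiple :: "nat set \<Rightarrow> (nat \<Rightarrow>\<^sub>0 nat) \<Rightarrow> nat set" where
  "multiple S t = {i. 2 \<le> lookup t i + (if i \<in> S then 1 else 0)}"

text \<open>The sources of the matching, which give up an element of \<open>S\<close>. In the second
  branch \<open>t\<close> is squarefree with support disjoint from \<open>S\<close>, so the cell is
  the generator \<open>(S, keys t)\<close> and the condition is the one of
  \<open>match_up_iff\<close>.\<close>

definition is_up :: "nat set set \<Rightarrow> nat set \<Rightarrow> (nat \<Rightarrow>\<^sub>0 nat) \<Rightarrow> bool" where
  "is_up K S t \<longleftrightarrow> (if multiple S t \<noteq> {} then Min (multiple S t) \<in> S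
     else int_active K S (keys t) = {} \<and> extending K S (keys t) \<noteq> {})"

definition is_down :: "nat set set \<Rightarrow> nat set \<Rightarrow> (nat \<Rightarrow>\<^sub>0 nat) \<Rightarrow> bool" where
  "is_down K S t \<longleftrightarrow> (if multiple S t \<noteq> {} then Min (multiple S t) \<notin> S
     else int_active K S (keys t) \<noteq> {})"

definition is_crit :: "nat set set \<Rightarrow> nat set \<Rightarrow> (nat \<Rightarrow>\<^sub>0 nat) \<Rightarrow> bool" where
  "is_crit K S t \<longleftrightarrow> multiple S t = {} \<and> int_active K S (keys t) = {} \<and> extending K S (keys t) = {}"

definition up_pivot :: "nat set set \<Rightarrow> nat set \<Rightarrow> (nat \<Rightarrow>\<^sub>0 nat) \<Rightarrow> nat" where
  "up_pivot K S t = (if multiple S t \<noteq> {} then Min (multiple S t) else Min (extending K S (keys t)))"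

definition down_pivot :: "nat set set \<Rightarrow> nat set \<Rightarrow> (nat \<Rightarrow>\<^sub>0 nat) \<Rightarrow> nat" where
  "down_pivot K S t = (if multiple S t \<noteq> {} then Min (multiple S t) else Min (int_active K S (keys t)))"

text \<open>The other end of the matching edge. What is raised is the exponent of the pivot; the
  exterior degree drops by one.\<close>

definition raise :: "nat set set \<Rightarrow> nat set \<times> (nat \<Rightarrow>\<^sub>0 nat) \<Rightarrow> nat set \<times> (nat \<Rightarrow>\<^sub>0 nat)" where
  "raise K = (\<lambda>(S, t). (S - {up_pivot K S t}, t + Poly_Mapping.single (up_pivot K S t) 1))"

lemma is_crit_iff: "is_crit K S t \<longleftrightarrow> \<not> is_up K S t \<and> \<not> is_down K S t"
  by (auto simp: is_crit_def is_up_def is_down_def)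

lemma multiple_subset: "multiple S t \<subseteq> keys t"
  by (auto simp: multiple_def in_keys_iff split: if_splits)

lemma finite_multiple: "finite (multiple S t)"
  using multiple_subset by (rule finite_subset) simp

text \<open>Trading u_i for v_i preserves the multidegree, so matched cells fall under the same
  branch of the definitions and, in the first branch, have the same pivot.\<close>

lemma multiple_shift:
  assumes "i \<in> S"
  shows "multiple (S - {i}) (t + Poly_Mapping.single i 1) = multiple S t"
  using assms by (auto simp: multiple_def lookup_add lookup_single when_def split: if_splits)

lemma keys_add_single:
  "keys (t + Poly_Mapping.single i 1 :: nat \<Rightarrow>\<^sub>0 nat) = insert i (keys t)"
  "keys (t + Poly_Mapping.single i (Suc 0) :: nat \<Rightarrow>\<^sub>0 nat) = insert i (keys t)"
  by (simp_all add: keys_add_nat)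

lemma multiple_empty_disjoint: "multiple S t = {} \<Longrightarrow> S \<inter> keys t = {}"
proof (rule ccontr)
  assume *: "multiple S t = {}" "S \<inter> keys t \<noteq> {}"
  then obtain i where "i \<in> S" "i \<in> keys t" by blast
  then have "i \<in> multiple S t" by (auto simp: multiple_def in_keys_iff)
  then show False using * by simp
qed

lemma multiple_empty_lookup:
  assumes "multiple S t = {}" "i \<in> keys t"
  shows "lookup t i = 1"
proof -
  have "i \<notin> multiple S t" using assms by simp
  then show ?thesis using assms(2) by (auto simp: multiple_def in_keys_iff split: if_splits)
qed

text \<open>In a non-squarefree multidegree the pivot already divides \<open>t\<close>, so the
  support does not change and remains a face. Otherwise the claim is
  \<open>Min_int_active_insert\<close> for the pair \<open>(S, keys t)\<close>.\<close>

lemma raise_up: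
  assumes M: "matroid_on m K" and St: "(S, t) \<in> cells m K (Suc q) d" and up: "is_up K S t"
  defines "c \<equiv> up_pivot K S t"
  shows "c \<in> S" and "(S - {c}, t + Poly_Mapping.single c 1) \<in> cells m K q d"
    and "is_down K (S - {c}) (t + Poly_Mapping.single c 1)"
    and "down_pivot K (S - {c}) (t + Poly_Mapping.single c 1) = c"
proof -
  have S: "S \<subseteq> {1..m}" "card S = Suc q" "keys t \<in> K" "2 * int (mdeg t) + 2 * int (Suc q) = d" "finite S"
    using St by (auto simp: cells_def intro: finite_subset)
  have "c \<in> S \<and> insert c (keys t) \<in> K \<and> is_down K (S - {c}) (t + Poly_Mapping.single c 1) \<and>
    down_pivot K (S - {c}) (t + Poly_Mapping.single c 1) = c"
  proof (cases "multiple S t = {}")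
    case False
    then have c: "c = Min (multiple S t)" "c \<in> S"
      using up by (auto simp: c_def up_pivot_def is_up_def)
    then have "c \<in> keys t"
      using Min_in[OF finite_multiple False] multiple_subset by auto
    then show ?thesis
      using S c False multiple_shift[OF c(2), of t]
      by (simp add: is_down_def down_pivot_def insert_absorb)
  next
    case True
    have ne: "int_active K S (keys t) = {}" "extending K S (keys t) \<noteq> {}"
      and c: "c = Min (extending K S (keys t))"
      using up True by (auto simp: c_def up_pivot_def is_up_def)
    have "c \<in> extending K S (keys t)"
      unfolding c using S ne by (intro Min_in) (auto simp: extending_def)
    then have cS: "c \<in> S" "insert c (keys t) \<in> K" by (auto simp: extending_def)
    note * = Min_int_active_insert[OF M multiple_empty_disjoint[OF True] S(5) ne, folded c]
    show ?thesis
      using cS True multiple_shift[OF cS(1), of t] * unfolding is_down_def down_pivot_def keys_add_single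
      by simp
  qed
  note * = this
  show "c \<in> S" "is_down K (S - {c}) (t + Poly_Mapping.single c 1)"
    "down_pivot K (S - {c}) (t + Poly_Mapping.single c 1) = c"
    using * by auto
  show "(S - {c}, t + Poly_Mapping.single c 1) \<in> cells m K q d"
    using * S by (auto simp: cells_def keys_add_single mdeg_add)
qed

text \<open>The inverse of raising. In a non-squarefree multidegree the pivot is not in
  \<open>S\<close>, hence has exponent at least 2 in \<open>t\<close>; otherwise the claim is
  \<open>Min_extending_remove\<close>.\<close>

lemma lower_down:
  assumes M: "matroid_on m K" and St: "(S, t) \<in> cells m K q d" and down: "is_down K S t"
  defines "c \<equiv> down_pivot K S t"
  shows "c \<notin> S" and "c \<in> keys t" and "(insert c S, t - Poly_Mapping.single c 1) \<in> cells m K (Suc q) d"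
    and "is_up K (insert c S) (t - Poly_Mapping.single c 1)"
    and "up_pivot K (insert c S) (t - Poly_Mapping.single c 1) = c"
proof -
  have S: "S \<subseteq> {1..m}" "card S = q" "keys t \<in> K" "2 * int (mdeg t) + 2 * int q = d" "finite S"
    using St by (auto simp: cells_def intro: finite_subset)
  have c: "c \<in> keys t" "c \<notin> S"
  proof -
    have "c \<in> keys t \<and> c \<notin> S"
    proof (cases "multiple S t = {}")
      case False
      then show ?thesis
        using down Min_in[OF finite_multiple False] multiple_subset[of S t]
        by (auto simp: c_def down_pivot_def is_down_def)
    next
      case True
      then have ne: "int_active K S (keys t) \<noteq> {}" and c: "c = Min (int_active K S (keys t))"
        using down by (auto simp: c_def down_pivot_def is_down_def)
      have "c \<in> int_active K S (keys t)"
        unfolding c using ne by (intro Min_in) (auto simp: int_active_def)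
      then show ?thesis
        using multiple_empty_disjoint[OF True] by (auto simp: int_active_def)
    qed
    then show "c \<in> keys t" "c \<notin> S" by auto
  qed
  define t' where "t' = t - Poly_Mapping.single c 1"
  have t: "t = t' + Poly_Mapping.single c 1"
    using add_single_diff[OF c(1)] by (simp add: t'_def add.commute)
  have mult: "multiple (insert c S) t' = multiple S t"
    using multiple_shift[of c "insert c S" t'] c(2) t by simp
  have keys: "keys t = insert c (keys t')"
    unfolding t by (rule keys_add_single(1))
  have "is_up K (insert c S) t' \<and> up_pivot K (insert c S) t' = c"
  proof (cases "multiple S t = {}")
    case False
    then have "c = Min (multiple S t)" by (simp add: c_def down_pivot_def)
    then show ?thesis
      using False unfolding is_up_def mult up_pivot_def by simp
  next
    case True
    then have ne: "int_active K S (keys t) \<noteq> {}" and c': "c = Min (int_active K S (keys t))"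
      using down by (auto simp: c_def down_pivot_def is_down_def)
    note * = Min_extending_remove[OF M multiple_empty_disjoint[OF True] S(5,3) ne, folded c']
    have "c \<notin> keys t'"
      using multiple_empty_disjoint[of "insert c S" t'] mult True by auto
    then have "keys t' = keys t - {c}" using keys by auto
    then show ?thesis
      using * True by (auto simp: is_up_def mult up_pivot_def)
  qed
  then show "is_up K (insert c S) (t - Poly_Mapping.single c 1)"
    "up_pivot K (insert c S) (t - Poly_Mapping.single c 1) = c"
    by (auto simp: t'_def)
  show "c \<notin> S" "c \<in> keys t" using c by auto
  have "keys t' \<in> K" "c \<in> {1..m}"
    using keys S(3) matroid_on_subset[OF M, of "keys t" "keys t'"] matroid_on_vertices[OF M, of "keys t"]
    by auto
  moreover have "mdeg t = Suc (mdeg t')"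
    unfolding t by (simp add: mdeg_add)
  ultimately show "(insert c S, t - Poly_Mapping.single c 1) \<in> cells m K (Suc q) d"
    using S c unfolding t'_def[symmetric] by (auto simp: cells_def)
qed

definition ups :: "nat \<Rightarrow> nat set set \<Rightarrow> nat \<Rightarrow> int \<Rightarrow> (nat set \<times> (nat \<Rightarrow>\<^sub>0 nat)) set" where
  "ups m K q d = {(S, t) \<in> cells m K q d. is_up K S t}"

text \<open>The pivot can be recovered from the image as its \<open>down_pivot\<close>, and with it
  the original cell.\<close>

lemma raise_inj:
  assumes "matroid_on m K" "u \<in> ups m K (Suc q) d" "u' \<in> ups m K (Suc q) d" "raise K u = raise K u'"
  shows "u = u'"
proof -
  obtain S t S' t' where u: "u = (S, t)" "u' = (S', t')" by (cases u, cases u') auto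
  define c where "c = up_pivot K S t"
  define c' where "c' = up_pivot K S' t'"
  have "(S, t) \<in> cells m K (Suc q) d" "is_up K S t" "(S', t') \<in> cells m K (Suc q) d" "is_up K S' t'"
    using assms u by (auto simp: ups_def)
  note 1 = raise_up[OF assms(1) this(1,2), folded c_def] and 2 = raise_up[OF assms(1) this(3,4), folded c'_def]
  have eq: "S - {c} = S' - {c'}" "t + Poly_Mapping.single c 1 = t' + Poly_Mapping.single c' 1"
    using assms(4) u by (auto simp: raise_def c_def c'_def)
  then have "c = c'" using 1(4) 2(4) by metis
  then show ?thesis using eq 1(1) 2(1) u by auto
qed

lemma raise_surj:
  assumes M: "matroid_on m K" and St: "(S, t) \<in> cells m K q d" "is_down K S t"
  obtains u where "u \<in> ups m K (Suc q) d" "raise K u = (S, t)"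
proof
  define c where "c = down_pivot K S t"
  note * = lower_down[OF M St, folded c_def]
  show "(insert c S, t - Poly_Mapping.single c 1) \<in> ups m K (Suc q) d"
    using * by (simp add: ups_def)
  show "raise K (insert c S, t - Poly_Mapping.single c 1) = (S, t)"
    using * add_single_diff[OF *(2)] by (simp add: raise_def add.commute)
qed

text \<open>Acyclicity of the matching: along a gradient path, the sum of the support of the upper cell
  decreases.\<close>

lemma raise_decreasing:
  assumes M: "matroid_on m K" and u: "(S, t) \<in> ups m K (Suc q) d" and u': "u' \<in> ups m K (Suc q) d"
    and i: "i \<in> S" "raise K u' = (S - {i}, t + Poly_Mapping.single i 1)" and ne: "(S, t) \<noteq> u'"
  shows "\<Sum> (keys (snd (raise K (S, t)))) < \<Sum> (keys (snd (raise K u')))"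
proof -
  define c where "c = up_pivot K S t"
  have St: "(S, t) \<in> cells m K (Suc q) d" "is_up K S t" "finite S"
    using u by (auto simp: ups_def cells_def intro: finite_subset)
  note c = raise_up[OF M St(1,2), folded c_def]
  obtain S' t' where u'_eq: "u' = (S', t')" by (cases u')
  have St': "(S', t') \<in> cells m K (Suc q) d" "is_up K S' t'"
    using u' u'_eq by (auto simp: ups_def)
  note c' = raise_up[OF M St']
  have r': "(S - {i}, t + Poly_Mapping.single i 1) \<in> cells m K q d"
    "is_down K (S - {i}) (t + Poly_Mapping.single i 1)"
    using c'(2,3) i(2) u'_eq by (auto simp: raise_def)
  have ic: "i \<noteq> c"
  proof
    assume "i = c"
    then have "raise K u' = raise K (S, t)"
      using i(2) by (simp add: raise_def c_def)
    then show False using raise_inj[OF M u' u] ne by simp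
  qed
  have mult: "multiple (S - {i}) (t + Poly_Mapping.single i 1) = multiple S t"
    using i(1) by (rule multiple_shift)
  show ?thesis
  proof (cases "multiple S t = {}")
    case False
    then have "c = Min (multiple S t)" by (simp add: c_def up_pivot_def)
    \<comment> \<open>Both cells have the multidegree of \<open>(S, t)\<close> and hence the pivot
      \<open>c\<close>. A lower cell must not contain its pivot, while \<open>c\<close> is in
      \<open>S\<close> and differs from \<open>i\<close>. So no further gradient step exists in such
      a multidegree.\<close>
    then have "c \<notin> S - {i}"
      using r'(2) False mult by (auto simp: is_down_def)
    then show ?thesis using ic c(1) by auto
  next
    case True
    have "insert i (keys t) \<in> K" using r'(1) by (simp add: cells_def keys_add_single)
    \<comment> \<open>Every \<open>i\<close> leading to a cell of \<open>K\<close> extends the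
      support, and \<open>c\<close> is the smallest such element; replacing \<open>c\<close> by
      \<open>i\<close> therefore increases the sum of the support.\<close>
    then have "i \<in> extending K S (keys t)" using i(1) by (simp add: extending_def)
    moreover have "c = Min (extending K S (keys t))" using True by (simp add: c_def up_pivot_def)
    ultimately have "c \<le> i" using St(3) by (simp add: extending_def)
    then have "c < i" using ic by simp
    moreover have "c \<notin> keys t" "i \<notin> keys t"
      using multiple_empty_disjoint[OF True] c(1) i(1) by auto
    moreover have "raise K (S, t) = (S - {c}, t + Poly_Mapping.single c 1)" by (simp add: raise_def c_def)
    ultimately show ?thesis using i(2) by (simp only: snd_conv keys_add_single(1)) simp
  qed
qed

text \<open>The degree bounds every exponent. Finiteness is what allows the boundary to be treated
  as a matrix, even though k[K] may have infinite rank.\<close>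

lemma finite_cells:
  assumes "K \<subseteq> Pow {1..m}"
  shows "finite (cells m K q d)"
proof -
  define N where "N = nat d"
  define T where "T = {f :: nat \<Rightarrow> nat. \<forall>i. (i \<in> {1..m} \<longrightarrow> f i \<in> {..N}) \<and> (i \<notin> {1..m} \<longrightarrow> f i = 0)}"
  have "finite T" unfolding T_def by (rule finite_set_of_finite_funs) auto
  moreover have "(\<lambda>(S, t). (S, lookup t)) ` cells m K q d \<subseteq> Pow {1..m} \<times> T"
  proof (rule image_subsetI)
    fix u assume "u \<in> cells m K q d"
    moreover obtain S t where u: "u = (S, t)" by (cases u)
    ultimately have St: "(S, t) \<in> cells m K q d" by simp
    have "lookup t i \<le> mdeg t" for i
      by (cases "i \<in> keys t") (auto simp: mdeg_def in_keys_iff intro: member_le_sum)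
    moreover have "mdeg t \<le> N" using St by (auto simp: cells_def N_def)
    ultimately have "lookup t i \<le> N" for i using le_trans by blast
    moreover have "lookup t i = 0" if "i \<notin> {1..m}" for i
    proof -
      have "keys t \<subseteq> {1..m}" using St assms by (auto simp: cells_def)
      then have "i \<notin> keys t" using that by blast
      then show ?thesis by (simp add: in_keys_iff)
    qed
    ultimately show "(case u of (S, t) \<Rightarrow> (S, lookup t)) \<in> Pow {1..m} \<times> T"
      using St u by (auto simp: T_def cells_def)
  qed
  ultimately have "finite ((\<lambda>(S, t). (S, lookup t)) ` cells m K q d)"
    by (meson finite_Pow_iff finite_SigmaI finite_atLeastAtMost finite_subset)
  then show ?thesis
    by (rule finite_imageD) (auto simp: inj_on_def poly_mapping_eqI)
qed

section \<open>Chains as coefficient functions on cells, and the incidence matrix\<close>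

definition cell_chain :: "(nat set \<times> (nat \<Rightarrow>\<^sub>0 nat)) set \<Rightarrow> (nat set \<times> (nat \<Rightarrow>\<^sub>0 nat) \<Rightarrow> 'k) \<Rightarrow> nat set \<Rightarrow> 'k::comm_ring_1 mpoly" where
  "cell_chain Y b S = Abs_poly_mapping (\<lambda>t. if (S, t) \<in> Y then b (S, t) else 0)"

lemma lookup_cell_chain:
  assumes "finite Y"
  shows "lookup (cell_chain Y b S) t = (if (S, t) \<in> Y then b (S, t) else 0)"
proof -
  have "finite {t. (if (S, t) \<in> Y then b (S, t) else 0) \<noteq> 0}"
    by (rule finite_subset[of _ "snd ` Y"]) (use assms in \<open>auto split: if_splits intro: rev_image_eqI\<close>)
  then show ?thesis by (simp add: cell_chain_def)
qed

lemma koszul_chains_iff: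
  "g \<in> koszul_chains m K q d \<longleftrightarrow> (\<forall>S t. lookup (g S) t \<noteq> 0 \<longrightarrow> (S, t) \<in> cells m K q d)"
proof
  assume g: "g \<in> koszul_chains m K q d"
  show "\<forall>S t. lookup (g S) t \<noteq> 0 \<longrightarrow> (S, t) \<in> cells m K q d"
  proof (intro allI impI)
    fix S t assume ne: "lookup (g S) t \<noteq> 0"
    have gS: "if S \<subseteq> {1..m} \<and> card S = q then g S \<in> face_polys K (d - 2 * int q) else g S = 0"
      using g unfolding koszul_chains_def by blast
    show "(S, t) \<in> cells m K q d"
    proof (cases "S \<subseteq> {1..m} \<and> card S = q")
      case True
      then have "g S \<in> face_polys K (d - 2 * int q)" using gS by simp
      then show ?thesis using True ne by (auto simp: cells_def face_polys_def in_keys_iff)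
    next
      case False
      then have "g S = 0" using gS by (simp only: if_False)
      then show ?thesis using ne by simp
    qed
  qed
next
  assume g: "\<forall>S t. lookup (g S) t \<noteq> 0 \<longrightarrow> (S, t) \<in> cells m K q d"
  have "g S = 0" if "\<not> (S \<subseteq> {1..m} \<and> card S = q)" for S
  proof (rule poly_mapping_eqI)
    fix t
    have "(S, t) \<notin> cells m K q d" using that by (auto simp: cells_def)
    then show "lookup (g S) t = lookup 0 t" using g by auto
  qed
  moreover have "g S \<in> face_polys K (d - 2 * int q)" for S
    using g by (fastforce simp: face_polys_def cells_def in_keys_iff)
  ultimately show "g \<in> koszul_chains m K q d"
    by (auto simp: koszul_chains_def)
qed

text \<open>At most one summand is nonzero, its index being the single element of
  \<open>fst u\<close> outside \<open>S\<close>. The form as a sum permits an exchange with the sum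
  over cells.\<close>

definition incidence :: "nat set \<times> (nat \<Rightarrow>\<^sub>0 nat) \<Rightarrow> nat set \<times> (nat \<Rightarrow>\<^sub>0 nat) \<Rightarrow> 'k::comm_ring_1" where
  "incidence u = (\<lambda>(S, t). \<Sum>i\<in>keys t - S. ksign i S *
     (if u = (insert i S, t - Poly_Mapping.single i 1) then 1 else 0))"

lemma lookup_face_koszul_incidence:
  assumes "K \<subseteq> Pow {1..m}" "keys t \<in> K" "finite Y"
    and "\<And>S t. lookup (g S) t \<noteq> 0 \<Longrightarrow> (S, t) \<in> Y"
  shows "lookup (face_koszul m K g S) t = (\<Sum>u\<in>Y. incidence u (S, t) * lookup (g (fst u)) (snd u))"
proof -
  have "(\<Sum>u\<in>Y. incidence u (S, t) * lookup (g (fst u)) (snd u)) =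
      (\<Sum>u\<in>Y. \<Sum>i\<in>keys t - S. if u = (insert i S, t - Poly_Mapping.single i 1)
         then ksign i S * lookup (g (fst u)) (snd u) else 0)"
    unfolding incidence_def sum_distrib_right prod.case by (intro sum.cong refl) auto
  also have "\<dots> = (\<Sum>i\<in>keys t - S. \<Sum>u\<in>Y. if u = (insert i S, t - Poly_Mapping.single i 1)
         then ksign i S * lookup (g (fst u)) (snd u) else 0)"
    by (rule sum.swap)
  also have "\<dots> = (\<Sum>i\<in>keys t - S. ksign i S * lookup (g (insert i S)) (t - Poly_Mapping.single i 1))"
  proof (intro sum.cong refl)
    fix i
    let ?u = "(insert i S, t - Poly_Mapping.single i 1)"
    have "lookup (g (fst ?u)) (snd ?u) = 0" if "?u \<notin> Y"
      using assms(4) that by auto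
    then show "(\<Sum>u\<in>Y. if u = ?u then ksign i S * lookup (g (fst u)) (snd u) else 0) =
        ksign i S * lookup (g (insert i S)) (t - Poly_Mapping.single i 1)"
      using assms(3) by (cases "?u \<in> Y") (auto simp: sum.delta)
  qed
  finally show ?thesis
    using lookup_face_koszul[OF assms(1,2)] by simp
qed

lemma incidence_nonzero:
  assumes "incidence (S', t') (S, t) \<noteq> (0 :: 'k::comm_ring_1)"
  obtains i where "i \<in> S'" "S = S' - {i}" "t = t' + Poly_Mapping.single i 1"
proof -
  obtain i where i: "i \<in> keys t - S" "(S', t') = (insert i S, t - Poly_Mapping.single i 1)"
    using assms unfolding incidence_def prod.case by (auto elim!: sum.not_neutral_contains_not_neutral split: if_splits)
  have "t = t' + Poly_Mapping.single i 1"
    using i add_single_diff[of i t] by (metis DiffD1 add.commute prod.inject)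
  then show ?thesis
    using i by (intro that[of i]) auto
qed

lemma incidence_shift:
  assumes "c \<in> S"
  shows "incidence (S, t) (S - {c}, t + Poly_Mapping.single c 1) = (ksign c (S - {c}) :: 'k::comm_ring_1)"
proof -
  have "incidence (S, t) (S - {c}, t + Poly_Mapping.single c 1) =
     (\<Sum>i\<in>keys (t + Poly_Mapping.single c 1) - (S - {c}). if i = c then ksign c (S - {c}) else (0 :: 'k))"
    unfolding incidence_def prod.case
  proof (intro sum.cong refl)
    fix i assume "i \<in> keys (t + Poly_Mapping.single c 1) - (S - {c})"
    then have "i = c" if "S = insert i (S - {c})" using that assms by auto
    then show "ksign i (S - {c}) * (if (S, t) = (insert i (S - {c}), t + Poly_Mapping.single c 1 -
        Poly_Mapping.single i 1) then 1 else 0) = (if i = c then ksign c (S - {c}) else (0 :: 'k))"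
      using assms by (auto simp: insert_absorb)
  qed
  also have "\<dots> = ksign c (S - {c})"
    by (simp add: keys_add_single)
  finally show ?thesis .
qed

lemma ksign_square: "ksign i S * ksign i S = 1"
  unfolding ksign_def by (simp add: power_add[symmetric])

section \<open>Critical chains as unique representatives of homology classes\<close>

locale matroid_koszul =
  fixes m :: nat and K :: "nat set set"
  assumes M: "matroid_on m K"
begin

lemma K_Pow: "K \<subseteq> Pow {1..m}"
  using matroid_on_vertices[OF M] by blast

lemma K_subset: "\<sigma> \<in> K \<Longrightarrow> \<tau> \<subseteq> \<sigma> \<Longrightarrow> \<tau> \<in> K"
  by (rule matroid_on_subset[OF M])

lemma finite_ups: "finite (ups m K q d)"
  by (rule finite_subset[OF _ finite_cells[OF K_Pow]]) (auto simp: ups_def)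

lemma raise_diagonal:
  assumes "u \<in> ups m K (Suc q) d"
  shows "\<exists>r. incidence u (raise K u) * r = (1 :: 'k::comm_ring_1)"
proof -
  obtain S t where u: "u = (S, t)" by (cases u)
  have "up_pivot K S t \<in> S"
    using raise_up(1)[OF M] assms u by (auto simp: ups_def)
  then show ?thesis
    using incidence_shift[of "up_pivot K S t" S t, where 'k = 'k] ksign_square u
    unfolding raise_def by auto
qed

lemma raise_triangular:
  assumes "u \<in> ups m K (Suc q) d" "u' \<in> ups m K (Suc q) d" "u \<noteq> u'"
    and "incidence u (raise K u') \<noteq> (0 :: 'k::comm_ring_1)"
  shows "\<Sum> (keys (snd (raise K u))) < \<Sum> (keys (snd (raise K u')))"
proof -
  obtain S t where u: "u = (S, t)" by (cases u)
  obtain S' t' where r: "raise K u' = (S', t')" by (cases "raise K u'")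
  obtain i where "i \<in> S" "raise K u' = (S - {i}, t + Poly_Mapping.single i 1)"
    using assms(4) unfolding u r by (auto elim: incidence_nonzero)
  then show ?thesis
    using raise_decreasing[OF M _ assms(2)] assms u by blast
qed

lemma raise_mem:
  assumes "u \<in> ups m K (Suc q) d"
  shows "raise K u \<in> cells m K q d" "is_down K (fst (raise K u)) (snd (raise K u))"
  using raise_up(2,3)[OF M] assms by (auto simp: ups_def raise_def)

text \<open>Raising is a bijection from upper cells to lower cells one exterior degree below, so
  prescribing the coefficients of a boundary on lower cells is a square system; acyclicity makes it
  triangular and its diagonal consists of signs.\<close>

lemma kill_downs:
  fixes z :: "nat set \<Rightarrow> 'k::comm_ring_1 mpoly"
  shows "\<exists>y\<in>koszul_chains m K (Suc q) d. \<forall>S t. (S, t) \<in> cells m K q d \<longrightarrow> is_down K S t \<longrightarrow>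
    lookup (face_koszul m K y S) t = lookup (z S) t"
proof -
  let ?U = "ups m K (Suc q) d"
  obtain b where b: "\<forall>u'\<in>?U. (\<Sum>u\<in>?U. incidence u (raise K u') * b u) =
      lookup (z (fst (raise K u'))) (snd (raise K u'))"
    using triangular_solve[of ?U "\<lambda>u u'. incidence u (raise K u') :: 'k"
        "\<lambda>u. \<Sum> (keys (snd (raise K u)))" "\<lambda>u'. lookup (z (fst (raise K u'))) (snd (raise K u'))"]
      finite_ups raise_diagonal raise_triangular by blast
  define y where "y = cell_chain ?U b"
  have y: "lookup (y S) t = (if (S, t) \<in> ?U then b (S, t) else 0)" for S t
    unfolding y_def by (rule lookup_cell_chain) (rule finite_ups)
  have yU: "(S, t) \<in> ?U" if "lookup (y S) t \<noteq> 0" for S t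
    using that by (auto simp: y split: if_splits)
  show ?thesis
  proof (intro bexI allI impI)
    show "y \<in> koszul_chains m K (Suc q) d"
      unfolding koszul_chains_iff by (auto simp: y ups_def)
    fix S t assume St: "(S, t) \<in> cells m K q d" "is_down K S t"
    obtain u' where u': "u' \<in> ?U" "raise K u' = (S, t)"
      using raise_surj[OF M St] by blast
    have "lookup (face_koszul m K y S) t = (\<Sum>u\<in>?U. incidence u (S, t) * lookup (y (fst u)) (snd u))"
      by (rule lookup_face_koszul_incidence[OF K_Pow _ finite_ups yU]) (use St in \<open>auto simp: cells_def\<close>)
    also have "\<dots> = (\<Sum>u\<in>?U. incidence u (raise K u') * b u)"
      using u'(2) by (intro sum.cong refl) (auto simp: y)
    finally show "lookup (face_koszul m K y S) t = lookup (z S) t"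
      using b[rule_format, OF u'(1)] u'(2) by simp
  qed
qed

text \<open>Injectivity of the same triangular system: the boundary of a chain on upper cells is
  detected on the lower cells.\<close>

lemma ups_chain_zero:
  fixes z :: "nat set \<Rightarrow> 'k::comm_ring_1 mpoly"
  assumes z: "\<And>S t. lookup (z S) t \<noteq> 0 \<Longrightarrow> (S, t) \<in> ups m K (Suc q) d"
    and dz: "\<And>S t. (S, t) \<in> cells m K q d \<Longrightarrow> is_down K S t \<Longrightarrow> lookup (face_koszul m K z S) t = 0"
  shows "z = 0"
proof -
  let ?U = "ups m K (Suc q) d"
  have "(\<Sum>u\<in>?U. incidence u (raise K u') * lookup (z (fst u)) (snd u)) = 0" if "u' \<in> ?U" for u'
  proof -
    obtain S t where r: "raise K u' = (S, t)" by (cases "raise K u'")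
    then have "(S, t) \<in> cells m K q d" "is_down K S t"
      using raise_mem[OF that] by auto
    moreover from this have "lookup (face_koszul m K z S) t = (\<Sum>u\<in>?U. incidence u (S, t) * lookup (z (fst u)) (snd u))"
      by (intro lookup_face_koszul_incidence[OF K_Pow _ finite_ups z]) (auto simp: cells_def)
    ultimately show ?thesis using dz r by simp
  qed
  then have "\<forall>u\<in>?U. lookup (z (fst u)) (snd u) = 0"
    using triangular_inj[of ?U "\<lambda>u u'. incidence u (raise K u') :: 'k"
        "\<lambda>u. \<Sum> (keys (snd (raise K u)))" "\<lambda>u. lookup (z (fst u)) (snd u)"]
      finite_ups raise_diagonal raise_triangular by blast
  then show ?thesis
    using z by (intro ext poly_mapping_eqI) force
qed

definition crit_chain :: "(nat set \<Rightarrow> 'k::comm_ring_1 mpoly) \<Rightarrow> bool" where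
  "crit_chain z \<longleftrightarrow> (\<forall>S t. lookup (z S) t \<noteq> 0 \<longrightarrow> is_crit K S t)"

lemma face_koszul_crit_chain:
  assumes z: "z \<in> koszul_chains m K q d" "crit_chain z"
  shows "face_koszul m K z = 0"
proof (intro ext poly_mapping_eqI)
  fix S t
  show "lookup (face_koszul m K z S) t = lookup (0 S) t"
  proof (cases "keys t \<in> K")
    case True
    have "lookup (z (insert i S)) (t - Poly_Mapping.single i 1) = 0" if "i \<in> keys t - S" for i
    proof (rule ccontr)
      let ?t = "t - Poly_Mapping.single i 1"
      assume "lookup (z (insert i S)) ?t \<noteq> 0"
      then have "extending K (insert i S) (keys ?t) = {}"
        using z(2) by (auto simp: crit_chain_def is_crit_def)
      \<comment> \<open>A face \<open>t\<close> occurring in the boundary shows that the removed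
        index \<open>i\<close> extends the support of the critical cell, which is
        impossible.\<close>
      moreover have "insert i (keys ?t) = keys t"
        using keys_add_single(1)[of ?t i] add_single_diff[of i t] that by (simp add: add.commute)
      ultimately show False using True by (auto simp: extending_def)
    qed
    then show ?thesis by (simp add: lookup_face_koszul[OF K_Pow True])
  next
    case False
    then show ?thesis by (simp add: face_koszul_def lookup_restr)
  qed
qed

lemma no_ups_zero: "ups m K 0 d = {}"
proof -
  have "\<not> is_up K S t" if "(S, t) \<in> cells m K 0 d" for S t
  proof -
    have "S = {}" using that by (auto simp: cells_def dest: finite_subset)
    then show ?thesis by (auto simp: is_up_def extending_def)
  qed
  then show ?thesis by (auto simp: ups_def)
qed

lemma crit_up_split:
  fixes z :: "nat set \<Rightarrow> 'k::comm_ring_1 mpoly"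
  assumes z: "z \<in> koszul_chains m K q d"
    and down: "\<And>S t. (S, t) \<in> cells m K q d \<Longrightarrow> is_down K S t \<Longrightarrow> lookup (z S) t = 0"
  obtains u c where "z = u + c" "u \<in> koszul_chains m K q d" "c \<in> koszul_chains m K q d"
    "crit_chain c" "\<And>S t. lookup (u S) t \<noteq> 0 \<Longrightarrow> (S, t) \<in> ups m K q d"
proof
  have zc: "(S, t) \<in> cells m K q d" if "lookup (z S) t \<noteq> 0" for S t
    using z that by (auto simp: koszul_chains_iff)
  let ?u = "\<lambda>S. restr (\<lambda>t. is_up K S t) (z S)"
  let ?c = "\<lambda>S. restr (\<lambda>t. \<not> is_up K S t) (z S)"
  show "z = ?u + ?c"
    by (intro ext poly_mapping_eqI) (simp add: lookup_restr lookup_add)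
  show "?u \<in> koszul_chains m K q d" "?c \<in> koszul_chains m K q d"
    using z by (auto simp: koszul_chains_iff lookup_restr split: if_splits)
  show "crit_chain ?c"
    unfolding crit_chain_def is_crit_iff using down zc by (fastforce simp: lookup_restr split: if_splits)
  show "(S, t) \<in> ups m K q d" if "lookup (?u S) t \<noteq> 0" for S t
    using that zc by (auto simp: ups_def lookup_restr split: if_splits)
qed

lemma face_koszul_add: "face_koszul m K (f + g) = face_koszul m K f + face_koszul m K g"
proof -
  have "face_koszul m K (f + g - g) = face_koszul m K (f + g) - face_koszul m K g"
    by (rule face_koszul_diff)
  then show ?thesis by simp
qed

text \<open>After subtracting a boundary the cycle has no coefficients on lower cells. Its critical
  part is a cycle by itself, hence so is its part on upper cells, which is then zero.\<close>

lemma cycle_homologous_crit_chain: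
  fixes z :: "nat set \<Rightarrow> 'k::comm_ring_1 mpoly"
  assumes z: "z \<in> koszul_chains m K q d" "face_koszul m K z = 0"
  obtains y where "y \<in> koszul_chains m K (Suc q) d" "crit_chain (z - face_koszul m K y)"
proof -
  obtain y where y: "y \<in> koszul_chains m K (Suc q) d"
    "\<forall>S t. (S, t) \<in> cells m K q d \<longrightarrow> is_down K S t \<longrightarrow> lookup (face_koszul m K y S) t = lookup (z S) t"
    using kill_downs[of q d z] by blast
  have dy: "face_koszul m K y \<in> koszul_chains m K q d"
    using y(1) K_Pow by (rule face_koszul_closed)
  have "z - face_koszul m K y \<in> koszul_chains m K q d"
    using z(1) dy by (rule koszul_chains_diff)
  then obtain u c where uc: "z - face_koszul m K y = u + c" "u \<in> koszul_chains m K q d"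
    "c \<in> koszul_chains m K q d" "crit_chain c" "\<And>S t. lookup (u S) t \<noteq> 0 \<Longrightarrow> (S, t) \<in> ups m K q d"
    by (rule crit_up_split) (auto simp: y(2) lookup_minus)
  have "face_koszul m K (u + c) = 0"
    using z(2) face_koszul_face_koszul[OF K_subset y(1)] unfolding uc(1)[symmetric]
    by (simp add: face_koszul_diff)
  then have du: "face_koszul m K u = 0"
    using face_koszul_crit_chain[OF uc(3,4)] by (simp add: face_koszul_add)
  have "u = 0"
  proof (cases q)
    case 0
    then show ?thesis
      using uc(5) no_ups_zero by (intro ext poly_mapping_eqI) auto
  next
    case (Suc q')
    then show ?thesis
      using uc(5) du by (intro ups_chain_zero[of u q' d]) auto
  qed
  then show ?thesis using that y(1) uc by simp
qed

text \<open>Changing \<open>y\<close> by a boundary removes its lower cells, and its critical part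
  contributes nothing. So \<open>z\<close> is the boundary of a chain on upper cells; being
  critical, it vanishes on lower cells, and that chain is zero. Critical representatives are thus
  unique.\<close>

lemma crit_chain_boundary_zero:
  fixes z :: "nat set \<Rightarrow> 'k::comm_ring_1 mpoly"
  assumes z: "crit_chain z" and y: "y \<in> koszul_chains m K (Suc q) d" "z = face_koszul m K y"
  shows "z = 0"
proof -
  obtain b where b: "b \<in> koszul_chains m K (Suc (Suc q)) d"
    "\<forall>S t. (S, t) \<in> cells m K (Suc q) d \<longrightarrow> is_down K S t \<longrightarrow> lookup (face_koszul m K b S) t = lookup (y S) t"
    using kill_downs[of "Suc q" d y] by blast
  have "y - face_koszul m K b \<in> koszul_chains m K (Suc q) d"
    using y(1) face_koszul_closed[OF b(1) K_Pow] by (rule koszul_chains_diff)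
  then obtain u c where uc: "y - face_koszul m K b = u + c" "u \<in> koszul_chains m K (Suc q) d"
    "c \<in> koszul_chains m K (Suc q) d" "crit_chain c" "\<And>S t. lookup (u S) t \<noteq> 0 \<Longrightarrow> (S, t) \<in> ups m K (Suc q) d"
    by (rule crit_up_split) (auto simp: b(2) lookup_minus)
  have "z = face_koszul m K (u + c)"
    unfolding uc(1)[symmetric] y(2) using face_koszul_face_koszul[OF K_subset b(1)]
    by (simp add: face_koszul_diff)
  then have zu: "z = face_koszul m K u"
    using face_koszul_crit_chain[OF uc(3,4)] by (simp add: face_koszul_add)
  have "lookup (z S) t = 0" if "is_down K S t" for S t
    using z that by (auto simp: crit_chain_def is_crit_iff)
  then have "u = 0"
    using uc(5) zu by (intro ups_chain_zero[of u q d]) auto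
  then show ?thesis
    using zu face_koszul_diff[of m K 0 0] by simp
qed

end

section \<open>Exactness of the Koszul complex of the polynomial ring\<close>

lemma matroid_on_Pow: "matroid_on m (Pow {1..m})"
proof -
  have "\<exists>v\<in>\<sigma> - \<tau>. \<tau> \<union> {v} \<in> Pow {1..m}"
    if "\<sigma> \<subseteq> {1..m}" "\<tau> \<subseteq> {1..m}" "card \<tau> < card \<sigma>" for \<sigma> \<tau>
  proof -
    have "\<not> \<sigma> \<subseteq> \<tau>"
      using that card_mono[of \<tau> \<sigma>] finite_subset[of \<tau> "{1..m}"] by auto
    then obtain v where "v \<in> \<sigma> - \<tau>" by blast
    then show ?thesis using that by blast
  qed
  then show ?thesis
    by (auto simp: matroid_on_def simplicial_complex_on_def)
qed

text \<open>In the full simplex every element of \<open>S\<close> extends, and for empty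
  \<open>S\<close> every element of the support is active. The only critical cell is therefore the
  pair of the empty set and 0, which the condition on the constant term removes.\<close>

lemma koszul_exact:
  fixes g :: "nat set \<Rightarrow> 'k::comm_ring_1 mpoly"
  assumes g: "g \<in> koszul_chains m (Pow {1..m}) q d" "koszul m g = 0"
    and const: "q = 0 \<Longrightarrow> lookup (g {}) 0 = 0"
  obtains y where "y \<in> koszul_chains m (Pow {1..m}) (Suc q) d" "g = koszul m y"
proof -
  interpret matroid_koszul m "Pow {1..m}"
    by unfold_locales (rule matroid_on_Pow)
  have "face_koszul m (Pow {1..m}) g = 0"
    using g(2) by (simp add: face_koszul_def fun_eq_iff)
  then obtain y where y: "y \<in> koszul_chains m (Pow {1..m}) (Suc q) d"
    "crit_chain (g - face_koszul m (Pow {1..m}) y)"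
    using cycle_homologous_crit_chain g(1) by blast
  let ?c = "g - face_koszul m (Pow {1..m}) y"
  have c: "?c \<in> koszul_chains m (Pow {1..m}) q d"
    using g(1) face_koszul_closed[OF y(1) K_Pow] by (rule koszul_chains_diff)
  have "?c = 0"
  proof (intro ext poly_mapping_eqI, rule ccontr)
    fix S t assume "lookup (?c S) t \<noteq> lookup (0 S) t"
    then have ne: "lookup (?c S) t \<noteq> 0" by simp
    then have St: "(S, t) \<in> cells m (Pow {1..m}) q d" "is_crit (Pow {1..m}) S t"
      using c y(2) unfolding koszul_chains_iff crit_chain_def by blast+
    then have "x \<in> extending (Pow {1..m}) S (keys t)" if "x \<in> S" for x
      using that by (auto simp: extending_def cells_def)
    then have "S = {}"
      using St(2) by (auto simp: is_crit_def)
    moreover from this have "keys t = {}"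
      using St(2) by (auto simp: is_crit_def int_active_def)
    ultimately have "S = {}" "t = 0" "q = 0"
      using St(1) by (auto simp: cells_def)
    \<comment> \<open>A boundary has no constant term: its coefficient at \<open>t = 0\<close> is an
      empty sum.\<close>
    then show False
      using ne const lookup_face_koszul[OF K_Pow, of t y S] by (simp add: lookup_minus)
  qed
  then show ?thesis
    using that y(1) face_koszul_Pow[OF y(1)] by simp
qed

section \<open>The Stanley--Reisner ideal\<close>

lemma mpoly_ring_simps [simp]:
  "carrier (mpoly_ring m) = {p. \<forall>t\<in>keys p. keys t \<subseteq> {1..m}}"
  "monoid.mult (mpoly_ring m) = (*)" "\<one>\<^bsub>mpoly_ring m\<^esub> = 1"
  "\<zero>\<^bsub>mpoly_ring m\<^esub> = 0" "add (mpoly_ring m) = (+)"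
  by (simp_all add: mpoly_ring_def ring_of_type_algebra_def)

lemma mpoly_carrier_add:
  fixes p q :: "'k::comm_ring_1 mpoly"
  assumes "p \<in> carrier (mpoly_ring m)" "q \<in> carrier (mpoly_ring m)"
  shows "p + q \<in> carrier (mpoly_ring m)"
proof -
  have "keys t \<subseteq> {1..m}" if "t \<in> keys (p + q)" for t
    using that Poly_Mapping.keys_add[of p q] assms unfolding mpoly_ring_simps by blast
  then show ?thesis by simp
qed

lemma mpoly_carrier_mult:
  fixes p q :: "'k::comm_ring_1 mpoly"
  assumes "p \<in> carrier (mpoly_ring m)" "q \<in> carrier (mpoly_ring m)"
  shows "p * q \<in> carrier (mpoly_ring m)"
proof -
  have "keys t \<subseteq> {1..m}" if t: "t \<in> keys (p * q)" for t
  proof -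
    obtain s u where "t = s + u" "s \<in> keys p" "u \<in> keys q"
      using t keys_mult[of p q] by blast
    then show ?thesis using assms unfolding mpoly_ring_simps by (simp add: keys_add_nat)
  qed
  then show ?thesis by simp
qed

lemma mpoly_carrier_uminus:
  "p \<in> carrier (mpoly_ring m) \<Longrightarrow> - p \<in> carrier (mpoly_ring m)" for p :: "'k::comm_ring_1 mpoly"
  by (simp add: in_keys_iff)

lemma mpoly_carrier_zero_one:
  "(0 :: 'k::comm_ring_1 mpoly) \<in> carrier (mpoly_ring m)" "(1 :: 'k mpoly) \<in> carrier (mpoly_ring m)"
  by simp_all

lemma cring_mpoly_ring: "cring (mpoly_ring m :: 'k::comm_ring_1 mpoly ring)"
proof (rule cringI)
  show "abelian_group (mpoly_ring m :: 'k mpoly ring)"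
  proof (rule abelian_groupI)
    fix x :: "'k mpoly" assume "x \<in> carrier (mpoly_ring m)"
    then show "\<exists>y\<in>carrier (mpoly_ring m). y \<oplus>\<^bsub>mpoly_ring m\<^esub> x = \<zero>\<^bsub>mpoly_ring m\<^esub>"
      using mpoly_carrier_uminus[of x m] by (intro bexI[of _ "- x"]) simp_all
  next
    fix x y :: "'k mpoly" assume "x \<in> carrier (mpoly_ring m)" "y \<in> carrier (mpoly_ring m)"
    then show "x \<oplus>\<^bsub>mpoly_ring m\<^esub> y \<in> carrier (mpoly_ring m)"
      using mpoly_carrier_add[of x m y] by simp
  qed (simp_all add: ac_simps)
  show "comm_monoid (mpoly_ring m :: 'k mpoly ring)"
  proof (rule comm_monoidI)
    fix x y :: "'k mpoly" assume "x \<in> carrier (mpoly_ring m)" "y \<in> carrier (mpoly_ring m)"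
    then show "x \<otimes>\<^bsub>mpoly_ring m\<^esub> y \<in> carrier (mpoly_ring m)"
      using mpoly_carrier_mult[of x m y] by simp
  qed (simp_all add: ac_simps)
qed (simp add: distrib_right)

section \<open>Finite sums in records sharing carrier, addition and zero\<close>

lemma abelian_monoid_transfer:
  assumes "abelian_monoid N" "carrier N' = carrier N" "add N' = add N" "\<zero>\<^bsub>N'\<^esub> = \<zero>\<^bsub>N\<^esub>"
  shows "abelian_monoid N'"
proof -
  interpret abelian_monoid N by fact
  show ?thesis using assms(2-4) by (intro abelian_monoidI) (simp_all add: a_ac)
qed

lemma finsum_transfer:
  assumes N: "abelian_monoid N" "carrier N' = carrier N" "add N' = add N" "\<zero>\<^bsub>N'\<^esub> = \<zero>\<^bsub>N\<^esub>"
    and f: "f \<in> A \<rightarrow> carrier N"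
  shows "finsum N' f A = finsum N f A"
proof -
  interpret abelian_monoid N by fact
  interpret N': abelian_monoid N' by (rule abelian_monoid_transfer[OF N])
  show ?thesis
    using f
  proof (induction A rule: infinite_finite_induct)
    case (infinite A)
    then show ?case using N(4) finsum_infinite N'.finsum_infinite by simp
  next
    case empty
    then show ?case using N(4) by simp
  next
    case (insert x F)
    then show ?case using N by (simp add: finsum_insert N'.finsum_insert Pi_iff)
  qed
qed

lemma finsum_eq_sum:
  fixes N :: "('a::comm_monoid_add, 'b) ring_scheme"
  assumes N: "abelian_monoid N" "add N = (+)" "\<zero>\<^bsub>N\<^esub> = 0" and f: "f \<in> A \<rightarrow> carrier N"
  shows "finsum N f A = sum f A"
proof -
  interpret abelian_monoid N by fact
  show ?thesis
    using f
  proof (induction A rule: infinite_finite_induct)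
    case (infinite A)
    then show ?case using N(3) finsum_infinite by simp
  next
    case empty
    then show ?case using N(3) by simp
  next
    case (insert x F)
    then show ?case using N(2) by (simp add: finsum_insert Pi_iff)
  qed
qed

lemma mpoly_finsum:
  fixes f :: "'i \<Rightarrow> 'k::comm_ring_1 mpoly"
  assumes "f \<in> A \<rightarrow> carrier (mpoly_ring m)"
  shows "finsum (mpoly_ring m) f A = sum f A"
proof -
  interpret cring "mpoly_ring m :: 'k mpoly ring" by (rule cring_mpoly_ring)
  show ?thesis using assms by (intro finsum_eq_sum abelian_monoid_axioms) simp_all
qed

lemma mpoly_carrier_sum:
  fixes f :: "'i \<Rightarrow> 'k::comm_ring_1 mpoly"
  assumes "f \<in> A \<rightarrow> carrier (mpoly_ring m)"
  shows "sum f A \<in> carrier (mpoly_ring m)"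
proof -
  interpret cring "mpoly_ring m :: 'k mpoly ring" by (rule cring_mpoly_ring)
  show ?thesis using finsum_closed[OF assms] mpoly_finsum[OF assms] by simp
qed

lemma var_prod_eq: "finite \<sigma> \<Longrightarrow> var_prod \<sigma> = Poly_Mapping.single (\<Sum>i\<in>\<sigma>. Poly_Mapping.single i 1) 1"
  unfolding var_prod_def by (induction \<sigma> rule: finite_induct) (simp_all add: mult_single)

lemma lookup_indicator:
  assumes "finite \<sigma>"
  shows "lookup (\<Sum>i\<in>\<sigma>. Poly_Mapping.single i (1 :: nat)) j = (if j \<in> \<sigma> then 1 else 0)"
    and "lookup (\<Sum>i\<in>\<sigma>. Poly_Mapping.single i (Suc 0)) j = (if j \<in> \<sigma> then 1 else 0)"
  using assms by (simp_all add: lookup_sum lookup_single when_def)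

lemma keys_indicator:
  assumes "finite \<sigma>"
  shows "keys (\<Sum>i\<in>\<sigma>. Poly_Mapping.single i (1 :: nat)) = \<sigma>"
    and "keys (\<Sum>i\<in>\<sigma>. Poly_Mapping.single i (Suc 0)) = \<sigma>"
  unfolding set_eq_iff in_keys_iff using assms by (simp_all add: lookup_indicator)

lemma poly_eq_sum_single: "p = (\<Sum>t\<in>keys p. Poly_Mapping.single t (lookup p t))"
  by (rule poly_mapping_eqI) (simp add: lookup_sum lookup_single when_def in_keys_iff)

lemma ideal_nonfaces:
  assumes K: "simplicial_complex_on m K"
  shows "ideal {p \<in> carrier (mpoly_ring m). face_part K p = 0} (mpoly_ring m :: 'k::comm_ring_1 mpoly ring)"
    (is "ideal ?I _")
proof -
  interpret cring "mpoly_ring m :: 'k mpoly ring" by (rule cring_mpoly_ring)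
  have down: "\<sigma> \<in> K \<Longrightarrow> \<tau> \<subseteq> \<sigma> \<Longrightarrow> \<tau> \<in> K" for \<sigma> \<tau>
    using K by (auto simp: simplicial_complex_on_def)
  have mult: "x * a \<in> ?I" if "a \<in> ?I" "x \<in> carrier (mpoly_ring m)" for a x :: "'k mpoly"
  proof -
    have "face_part K (x * a) = face_part K (x * face_part K a)"
      by (rule face_part_mult_face_part[OF down, symmetric])
    also have "\<dots> = 0" using that by simp
    finally show ?thesis using that mpoly_carrier_mult[of x m a] by blast
  qed
  show ?thesis
  proof (rule idealI)
    show "ring (mpoly_ring m :: 'k mpoly ring)" by (rule ring_axioms)
    show "subgroup ?I (add_monoid (mpoly_ring m))"
    proof (rule group.subgroupI)
      show "group (add_monoid (mpoly_ring m :: 'k mpoly ring))" by (rule a_group)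
      have "0 \<in> ?I" by simp
      then show "?I \<noteq> {}" by blast
      fix a :: "'k mpoly" assume a: "a \<in> ?I"
      then have "inv\<^bsub>add_monoid (mpoly_ring m)\<^esub> a = - a"
        using mpoly_carrier_uminus[of a m]
        by (intro comm_monoid.comm_inv_char[OF a_comm_monoid]) auto
      moreover have "face_part K (0 - a) = 0" using a by (simp only: restr_diff) simp
      ultimately show "inv\<^bsub>add_monoid (mpoly_ring m)\<^esub> a \<in> ?I"
        using a mpoly_carrier_uminus[of a m] by simp
      fix b :: "'k mpoly" assume b: "b \<in> ?I"
      have "face_part K (a - (0 - b)) = 0" using a b by (simp only: restr_diff) simp
      then show "a \<otimes>\<^bsub>add_monoid (mpoly_ring m)\<^esub> b \<in> ?I"
        using a b mpoly_carrier_add[of a m b] by simp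
    qed auto
    show "x \<otimes>\<^bsub>mpoly_ring m\<^esub> a \<in> ?I" "a \<otimes>\<^bsub>mpoly_ring m\<^esub> x \<in> ?I"
      if "a \<in> ?I" "x \<in> carrier (mpoly_ring m)" for a x :: "'k mpoly"
      using mult[OF that] by (simp_all add: mult.commute)
  qed
qed

text \<open>The ideal is monomial. Conversely, a monomial whose support is a non-face is a multiple
  of the squarefree monomial of that support, which is a generator.\<close>

lemma SR_ideal_eq:
  assumes K: "simplicial_complex_on m K"
  shows "SR_ideal m K = {p \<in> carrier (mpoly_ring m). face_part K p = (0 :: 'k::comm_ring_1 mpoly)}"
    (is "_ = ?I")
proof
  interpret cring "mpoly_ring m :: 'k mpoly ring" by (rule cring_mpoly_ring)
  let ?G = "var_prod ` {\<sigma>. \<sigma> \<subseteq> {1..m} \<and> \<sigma> \<notin> K} :: 'k mpoly set"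
  have gen: "var_prod \<sigma> \<in> ?I" if "\<sigma> \<subseteq> {1..m}" "\<sigma> \<notin> K" for \<sigma>
  proof -
    have "finite \<sigma>" using that(1) by (rule finite_subset) simp
    then show ?thesis
      using that by (auto simp: var_prod_eq keys_indicator intro!: restr_eq_0)
  qed
  show "SR_ideal m K \<subseteq> ?I"
    unfolding SR_ideal_def using gen by (intro genideal_minimal ideal_nonfaces K) auto
  have G: "?G \<subseteq> carrier (mpoly_ring m)" using gen by auto
  interpret I: ideal "SR_ideal m K" "mpoly_ring m :: 'k mpoly ring"
    unfolding SR_ideal_def by (rule genideal_ideal[OF G])
  show "?I \<subseteq> SR_ideal m K"
  proof
    fix p assume p: "p \<in> ?I"
    have "Poly_Mapping.single t (lookup p t) \<in> SR_ideal m K" if t: "t \<in> keys p" for t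
    proof -
      let ?\<sigma> = "keys t"
      have "lookup (face_part K p) t = 0" using p by simp
      then have \<sigma>: "?\<sigma> \<subseteq> {1..m}" "?\<sigma> \<notin> K"
        using p t by (auto simp: lookup_restr in_keys_iff)
      \<comment> \<open>Truncated subtraction is harmless here, as every index in the support has
        exponent at least 1.\<close>
      define s where "s = t - (\<Sum>i\<in>?\<sigma>. Poly_Mapping.single i 1)"
      have ts: "s + (\<Sum>i\<in>?\<sigma>. Poly_Mapping.single i 1) = t"
      proof (rule poly_mapping_eqI)
        fix j show "lookup (s + (\<Sum>i\<in>?\<sigma>. Poly_Mapping.single i 1)) j = lookup t j"
          by (cases "lookup t j = 0") (simp_all add: s_def lookup_add lookup_minus lookup_indicator in_keys_iff)
      qed
      have "var_prod ?\<sigma> \<in> (SR_ideal m K :: 'k mpoly set)"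
        unfolding SR_ideal_def by (rule subsetD[OF genideal_self[OF G]]) (use \<sigma> in simp)
      moreover have "Poly_Mapping.single s (lookup p t) \<in> carrier (mpoly_ring m)"
      proof -
        have "keys s \<subseteq> keys (s + (\<Sum>i\<in>?\<sigma>. Poly_Mapping.single i 1))"
          unfolding keys_add_nat by blast
        then have "keys s \<subseteq> keys t" by (simp only: ts)
        then show ?thesis using \<sigma>(1) by auto
      qed
      ultimately have "Poly_Mapping.single s (lookup p t) * var_prod ?\<sigma> \<in> SR_ideal m K"
        using I.I_l_closed[of "var_prod ?\<sigma>" "Poly_Mapping.single s (lookup p t)"] by simp
      then show ?thesis by (simp add: var_prod_eq mult_single ts ts[unfolded One_nat_def])
    qed
    moreover have "sum f A \<in> SR_ideal m K"
      if "finite A" "\<And>t. t \<in> A \<Longrightarrow> f t \<in> SR_ideal m K" for f :: "(nat \<Rightarrow>\<^sub>0 nat) \<Rightarrow> 'k mpoly" and A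
      using that
    proof (induction A rule: finite_induct)
      case empty
      then show ?case using I.zero_closed by simp
    next
      case (insert x A)
      then show ?case using I.a_closed[of "f x" "sum f A"] by simp
    qed
    ultimately have "(\<Sum>t\<in>keys p. Poly_Mapping.single t (lookup p t)) \<in> SR_ideal m K" by simp
    then show "p \<in> SR_ideal m K" by (simp only: poly_eq_sum_single[symmetric])
  qed
qed

section \<open>Resolutions of the Stanley--Reisner ring in terms of polynomials\<close>

text \<open>Here \<open>a x\<close> is a polynomial representing the value of the augmentation at
  \<open>x\<close> in k[K]. With this choice the resolution can be handled by polynomials and
  truncation, without cosets.\<close>

locale face_resolution = matroid_koszul m K for m K +
  fixes bs :: "nat \<Rightarrow> 'x set" and dg :: "nat \<Rightarrow> 'x \<Rightarrow> int"
    and dm :: "nat \<Rightarrow> 'x \<Rightarrow> 'x \<Rightarrow> 'k::comm_ring_1 mpoly" and a :: "'x \<Rightarrow> 'k mpoly"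
  assumes dm_finite: "x \<in> bs (Suc i) \<Longrightarrow> finite {y \<in> bs i. dm i x y \<noteq> 0}"
    and dm_degree: "x \<in> bs (Suc i) \<Longrightarrow> y \<in> bs i \<Longrightarrow>
      dm i x y \<in> face_polys (Pow {1..m}) (dg (Suc i) x - dg i y)"
    and a_degree: "x \<in> bs 0 \<Longrightarrow> a x \<in> face_polys (Pow {1..m}) (dg 0 x)"
begin

definition free :: "nat \<Rightarrow> ('x \<Rightarrow> 'k mpoly) set" where
  "free i = {f. (\<forall>x. f x \<in> carrier (mpoly_ring m)) \<and> (\<forall>x. x \<notin> bs i \<longrightarrow> f x = 0) \<and> finite {x. f x \<noteq> 0}}"

definition diff :: "nat \<Rightarrow> ('x \<Rightarrow> 'k mpoly) \<Rightarrow> 'x \<Rightarrow> 'k mpoly" where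
  "diff i f y = (if y \<in> bs i then \<Sum>x | f x \<noteq> 0. dm i x y * f x else 0)"

definition augment :: "('x \<Rightarrow> 'k mpoly) \<Rightarrow> 'k mpoly" where
  "augment f = face_part K (\<Sum>x | f x \<noteq> 0. f x * a x)"

end

locale exact_face_resolution = face_resolution m K bs dg dm a
  for m K and bs :: "nat \<Rightarrow> 'x set" and dg :: "nat \<Rightarrow> 'x \<Rightarrow> int"
    and dm :: "nat \<Rightarrow> 'x \<Rightarrow> 'x \<Rightarrow> 'k::comm_ring_1 mpoly" and a :: "'x \<Rightarrow> 'k mpoly" +
  assumes augment_surj: "p \<in> carrier (mpoly_ring m) \<Longrightarrow> \<exists>f\<in>free 0. augment f = face_part K p"
    and augment_exact: "diff 0 ` free 1 = {f \<in> free 0. augment f = 0}"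
    and diff_exact: "diff (Suc i) ` free (Suc (Suc i)) = {f \<in> free (Suc i). diff i f = 0}"

section \<open>Translation of the given resolution into polynomials\<close>

lemma mpoly_grading_eq: "mpoly_grading m e = face_polys (Pow {1..m}) e"
  by (auto simp: mpoly_grading_def face_polys_def mdeg_def)

lemma (in face_resolution) carrier_free_module: "carrier (free_module (mpoly_ring m) (bs i)) = free i"
proof -
  have "f \<in> carrier (free_module (mpoly_ring m) (bs i)) \<longleftrightarrow> f \<in> free i" for f
  proof -
    have 1: "f \<in> carrier (free_module (mpoly_ring m) (bs i)) \<longleftrightarrow> (\<forall>x\<in>bs i. f x \<in> carrier (mpoly_ring m)) \<and>
        (\<forall>x. x \<notin> bs i \<longrightarrow> f x = 0) \<and> finite {x \<in> bs i. f x \<noteq> 0}"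
      by (simp add: free_module_def copower_def regular_module_def)
    show ?thesis
    proof (cases "\<forall>x. x \<notin> bs i \<longrightarrow> f x = 0")
      case True
      then have "{x \<in> bs i. f x \<noteq> 0} = {x. f x \<noteq> 0}" by auto
      moreover have "f x \<in> carrier (mpoly_ring m)" if "x \<notin> bs i" for x
        using True that by simp
      ultimately have "(\<forall>x\<in>bs i. f x \<in> carrier (mpoly_ring m)) \<longleftrightarrow> (\<forall>x. f x \<in> carrier (mpoly_ring m))"
        "{x \<in> bs i. f x \<noteq> 0} = {x. f x \<noteq> 0}" by blast+
      then show ?thesis
        unfolding 1 free_def mem_Collect_eq using True by (simp only:)
    next
      case False
      then show ?thesis unfolding 1 free_def by blast
    qed
  qed
  then show ?thesis by blast
qed

lemma abelian_monoid_regular_mpoly: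
  "abelian_monoid (regular_module (mpoly_ring m :: 'k::comm_ring_1 mpoly ring))"
proof -
  interpret cring "mpoly_ring m :: 'k mpoly ring" by (rule cring_mpoly_ring)
  show ?thesis
    by (rule abelian_monoid_transfer[OF abelian_monoid_axioms]) (simp_all add: regular_module_def)
qed

lemma face_polys_carrier: "face_polys (Pow {1..m}) e \<subseteq> carrier (mpoly_ring m)"
  by (auto simp: face_polys_def)

lemma (in face_resolution) tensor_diff_regular:
  assumes F: "basis F = bs" "dmat F = dm" and f: "f \<in> free (Suc i)"
  shows "tensor_diff F (regular_module (mpoly_ring m)) i f = diff i f"
proof
  fix y
  have supp: "{x \<in> bs (Suc i). f x \<noteq> 0} = {x. f x \<noteq> 0}" using f by (auto simp: free_def)
  have car: "dm i x y * f x \<in> carrier (mpoly_ring m)" if "f x \<noteq> 0" "y \<in> bs i" for x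
    using that f dm_degree[of x i y] face_polys_carrier[of m] unfolding free_def
    by (intro mpoly_carrier_mult) blast+
  have "finsum (regular_module (mpoly_ring m)) (\<lambda>x. dm i x y * f x) {x. f x \<noteq> 0} = (\<Sum>x | f x \<noteq> 0. dm i x y * f x)"
    if "y \<in> bs i"
    using car that by (intro finsum_eq_sum abelian_monoid_regular_mpoly) (auto simp: regular_module_def)
  then show "tensor_diff F (regular_module (mpoly_ring m)) i f y = diff i f y"
    by (simp add: tensor_diff_def diff_def F supp regular_module_def)
qed

lemma SR_resolution_imp:
  fixes F :: "('x, 'k::comm_ring_1 mpoly, 'k mpoly set) free_cx"
  assumes M: "matroid_on m K" and F: "SR_resolution m K F"
  obtains a where "exact_face_resolution m K (basis F) (bdeg F) (dmat F) a"
proof -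
  have K: "simplicial_complex_on m K" using M by (simp add: matroid_on_def)
  let ?I = "SR_ideal m K :: 'k mpoly set"
  let ?R = "mpoly_ring m :: 'k mpoly ring"
  interpret R: cring ?R by (rule cring_mpoly_ring)
  interpret I: ideal ?I ?R unfolding SR_ideal_eq[OF K] by (rule ideal_nonfaces[OF K])
  interpret Q: ring_hom_cring ?R "?R Quot ?I" "(+>\<^bsub>?R\<^esub>) ?I"
    by (rule I.rcos_ring_hom_cring) (rule cring_mpoly_ring)
  note F = F[unfolded SR_resolution_def graded_free_resolution_def mpoly_grading_eq mpoly_ring_simps(4)]
  note F1 = F[THEN conjunct1] and F2 = F[THEN conjunct2, THEN conjunct1]
    and F3 = F[THEN conjunct2, THEN conjunct2, THEN conjunct1]
    and F4 = F[THEN conjunct2, THEN conjunct2, THEN conjunct2, THEN conjunct1]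
    and F5 = F[THEN conjunct2, THEN conjunct2, THEN conjunct2, THEN conjunct2]
  \<comment> \<open>The representatives must be homogeneous of the right degree; the grading of k[K]
    as the image of that of polynomials provides them.\<close>
  have "\<exists>p. p \<in> face_polys (Pow {1..m}) (bdeg F 0 x) \<and> aug F x = ?I +>\<^bsub>?R\<^esub> p" if "x \<in> basis F 0" for x
    using F2[rule_format, OF that] unfolding SR_grading_def mpoly_grading_eq by auto
  then obtain a where a: "\<And>x. x \<in> basis F 0 \<Longrightarrow> a x \<in> face_polys (Pow {1..m}) (bdeg F 0 x)"
    "\<And>x. x \<in> basis F 0 \<Longrightarrow> aug F x = ?I +>\<^bsub>?R\<^esub> a x" by metis
  interpret fr: face_resolution m K "basis F" "bdeg F" "dmat F" a
  proof unfold_locales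
    show "matroid_on m K" by fact
    show "finite {y \<in> basis F i. dmat F i x y \<noteq> 0}" if "x \<in> basis F (Suc i)" for x i
      using F1[rule_format, OF that] by (rule conjunct1)
    show "dmat F i x y \<in> face_polys (Pow {1..m}) (bdeg F (Suc i) x - bdeg F i y)"
      if "x \<in> basis F (Suc i)" "y \<in> basis F i" for x i y
      using F1[rule_format, OF that(1)] that(2) by (elim conjE) (drule (1) bspec)
  qed (rule a(1))
  have SR_fields: "carrier (SR_module m K) = carrier (?R Quot ?I)" "add (SR_module m K) = add (?R Quot ?I)"
    "\<zero>\<^bsub>SR_module m K\<^esub> = \<zero>\<^bsub>?R Quot ?I\<^esub>"
    by (simp_all add: SR_module_def SR_ring_def)
  interpret SR: abelian_monoid "SR_module m K :: ('k mpoly, 'k mpoly set) module"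
    by (rule abelian_monoid_transfer[OF Q.S.abelian_monoid_axioms SR_fields])
  have Q0: "?I +>\<^bsub>?R\<^esub> p = \<zero>\<^bsub>SR_module m K\<^esub> \<longleftrightarrow> face_part K p = 0" if "p \<in> carrier ?R" for p
  proof -
    have "?I +>\<^bsub>?R\<^esub> p = \<zero>\<^bsub>?R Quot ?I\<^esub> \<longleftrightarrow> p \<in> ?I"
      using that I.rcos_const_imp_mem[of p] I.a_rcos_const[of p] by (auto simp: FactRing_def)
    then show ?thesis
      using that unfolding SR_ideal_eq[OF K] by (simp add: SR_module_def SR_ring_def SR_ideal_eq[OF K])
  qed
  have sum_car: "f x * a x \<in> carrier ?R" if "f \<in> fr.free 0" "f x \<noteq> 0" for f x
    using that a(1)[of x] face_polys_carrier[of m] unfolding fr.free_def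
    by (intro mpoly_carrier_mult) blast+
  \<comment> \<open>The sum in the module is a sum of cosets; the quotient map is a ring
    homomorphism, so it equals the coset of the polynomial sum.\<close>
  have aug: "aug_map ?R (SR_module m K) F f = ?I +>\<^bsub>?R\<^esub> (\<Sum>x | f x \<noteq> 0. f x * a x)"
    if f: "f \<in> fr.free 0" for f
  proof -
    have supp: "{x \<in> basis F 0. f x \<noteq> 0} = {x. f x \<noteq> 0}" using f by (auto simp: fr.free_def)
    have SR_car: "(+>\<^bsub>?R\<^esub>) ?I \<circ> (\<lambda>x. f x * a x) \<in> {x. f x \<noteq> 0} \<rightarrow> carrier (?R Quot ?I)"
      using sum_car[OF f] Q.hom_closed by auto
    have "aug_map ?R (SR_module m K) F f =
        finsum (SR_module m K) (\<lambda>x. f x \<odot>\<^bsub>SR_module m K\<^esub> aug F x) {x. f x \<noteq> 0}"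
      by (simp add: aug_map_def supp)
    also have "\<dots> = finsum (SR_module m K) ((+>\<^bsub>?R\<^esub>) ?I \<circ> (\<lambda>x. f x * a x)) {x. f x \<noteq> 0}"
    proof (rule SR.finsum_cong')
      show "(+>\<^bsub>?R\<^esub>) ?I \<circ> (\<lambda>x. f x * a x) \<in> {x. f x \<noteq> 0} \<rightarrow> carrier (SR_module m K)"
        using SR_car by (simp add: SR_fields)
      fix x assume x: "x \<in> {x. f x \<noteq> 0}"
      then have "x \<in> basis F 0" "f x \<in> carrier ?R" "a x \<in> carrier ?R"
        using f a(1)[of x] face_polys_carrier[of m] unfolding fr.free_def by blast+
      then show "f x \<odot>\<^bsub>SR_module m K\<^esub> aug F x = ((+>\<^bsub>?R\<^esub>) ?I \<circ> (\<lambda>x. f x * a x)) x"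
        using Q.hom_mult[of "f x" "a x"] a(2)[of x] by (simp add: SR_module_def SR_ring_def)
    qed simp
    also have "\<dots> = finsum (?R Quot ?I) ((+>\<^bsub>?R\<^esub>) ?I \<circ> (\<lambda>x. f x * a x)) {x. f x \<noteq> 0}"
      by (rule finsum_transfer[OF Q.S.abelian_monoid_axioms SR_fields SR_car])
    also have "\<dots> = ?I +>\<^bsub>?R\<^esub> finsum ?R (\<lambda>x. f x * a x) {x. f x \<noteq> 0}"
      using sum_car[OF f] by (intro Q.hom_finsum[symmetric]) auto
    also have "finsum ?R (\<lambda>x. f x * a x) {x. f x \<noteq> 0} = (\<Sum>x | f x \<noteq> 0. f x * a x)"
      using sum_car[OF f] by (intro mpoly_finsum) auto
    finally show ?thesis .
  qed
  have sum_closed: "(\<Sum>x | f x \<noteq> 0. f x * a x) \<in> carrier ?R" if "f \<in> fr.free 0" for f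
    using sum_car[OF that] by (intro mpoly_carrier_sum) auto
  have augment_0: "aug_map ?R (SR_module m K) F f = \<zero>\<^bsub>SR_module m K\<^esub> \<longleftrightarrow> fr.augment f = 0"
    if "f \<in> fr.free 0" for f
    using aug[OF that] Q0[OF sum_closed[OF that]] by (simp add: fr.augment_def)
  have zero: "\<zero>\<^bsub>free_module ?R (basis F i)\<^esub> = 0" for i
    by (simp add: free_module_def copower_def regular_module_def zero_fun_def)
  have td: "tensor_diff F (regular_module ?R) i ` fr.free (Suc i) = fr.diff i ` fr.free (Suc i)" for i
    by (intro image_cong refl fr.tensor_diff_regular)
  have "exact_face_resolution m K (basis F) (bdeg F) (dmat F) a"
  proof unfold_locales
    fix p assume p: "p \<in> carrier ?R"
    then have "?I +>\<^bsub>?R\<^esub> p \<in> carrier (SR_module m K)"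
      using Q.hom_closed[of p] by (simp add: SR_module_def SR_ring_def)
    then have "?I +>\<^bsub>?R\<^esub> p \<in> aug_map ?R (SR_module m K) F ` fr.free 0"
      using F3 unfolding fr.carrier_free_module by simp
    then obtain f where f: "f \<in> fr.free 0" "?I +>\<^bsub>?R\<^esub> p = ?I +>\<^bsub>?R\<^esub> (\<Sum>x | f x \<noteq> 0. f x * a x)"
      using aug by auto
    let ?s = "\<Sum>x | f x \<noteq> 0. f x * a x"
    have neg: "- ?s \<in> carrier ?R" using sum_closed[OF f(1)] by (rule mpoly_carrier_uminus)
    \<comment> \<open>The criterion \<open>Q0\<close> recognises only the zero coset, so the
      equality of two cosets is first shifted by \<open>- ?s\<close>.\<close>
    have "?I +>\<^bsub>?R\<^esub> (p + - ?s) = ?I +>\<^bsub>?R\<^esub> (?s + - ?s)"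
      using Q.hom_add[OF p neg] Q.hom_add[OF sum_closed[OF f(1)] neg] f(2) by simp
    also have "\<dots> = \<zero>\<^bsub>SR_module m K\<^esub>"
      using Q0[OF mpoly_carrier_zero_one(1)] by simp
    finally have "face_part K (p - ?s) = 0"
      using Q0[OF mpoly_carrier_add[OF p neg]] by simp
    then have "fr.augment f = face_part K p"
      by (simp add: fr.augment_def restr_diff)
    then show "\<exists>f\<in>fr.free 0. fr.augment f = face_part K p" using f(1) by blast
  next
    have "tensor_diff F (regular_module ?R) 0 ` fr.free (Suc 0) =
        {f \<in> fr.free 0. aug_map ?R (SR_module m K) F f = \<zero>\<^bsub>SR_module m K\<^esub>}"
      using F4 unfolding fr.carrier_free_module One_nat_def .
    then show "fr.diff 0 ` fr.free 1 = {f \<in> fr.free 0. fr.augment f = 0}"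
      unfolding td One_nat_def using augment_0 by blast
  next
    fix i
    have "tensor_diff F (regular_module ?R) (Suc i) ` fr.free (Suc (Suc i)) =
        {f \<in> fr.free (Suc i). tensor_diff F (regular_module ?R) i f = 0}"
      using F5[rule_format, of i] unfolding fr.carrier_free_module zero add_2_eq_Suc' .
    then show "fr.diff (Suc i) ` fr.free (Suc (Suc i)) = {f \<in> fr.free (Suc i). fr.diff i f = 0}"
      unfolding td using fr.tensor_diff_regular[OF refl refl] by force
  qed
  then show ?thesis by (rule that)
qed

section \<open>The double complex of a resolution and the Koszul complex\<close>

context exact_face_resolution
begin

text \<open>The homogeneous elements of degree \<open>e\<close> of the p-th free module; the name
  abbreviates homogeneous, not homomorphism.\<close>

definition hom :: "nat \<Rightarrow> int \<Rightarrow> ('x \<Rightarrow> 'k mpoly) set" where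
  "hom p e = {f. (\<forall>x. x \<notin> bs p \<longrightarrow> f x = 0) \<and> finite {x. f x \<noteq> 0} \<and>
     (\<forall>x. f x \<in> face_polys (Pow {1..m}) (e - dg p x))}"

definition component :: "nat \<Rightarrow> int \<Rightarrow> ('x \<Rightarrow> 'k mpoly) \<Rightarrow> 'x \<Rightarrow> 'k mpoly" where
  "component p e f x = restr (\<lambda>t. 2 * int (mdeg t) = e - dg p x) (f x)"

lemma hom_free: "f \<in> hom p e \<Longrightarrow> f \<in> free p"
  using face_polys_carrier[of m] unfolding hom_def free_def by blast

lemma component_hom: "f \<in> free p \<Longrightarrow> component p e f \<in> hom p e"
proof -
  assume f: "f \<in> free p"
  then have "finite {x. component p e f x \<noteq> 0}"
    unfolding free_def component_def by (auto elim!: rev_finite_subset)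
  moreover have "component p e f x \<in> face_polys (Pow {1..m}) (e - dg p x)" for x
  proof -
    have "f x \<in> carrier (mpoly_ring m)" using f by (simp only: free_def mem_Collect_eq)
    then show ?thesis by (auto simp: face_polys_def component_def keys_restr)
  qed
  moreover have "component p e f x = 0" if "x \<notin> bs p" for x
    using f that by (simp add: free_def component_def)
  ultimately show ?thesis by (simp add: hom_def)
qed

lemma component_id: "f \<in> hom p e \<Longrightarrow> component p e f = f"
  by (rule ext) (auto simp: hom_def component_def face_polys_def intro!: restr_id)

lemma hom_zero: "0 \<in> hom p e"
  by (simp add: hom_def)

lemma hom_diff: "f \<in> hom p e \<Longrightarrow> g \<in> hom p e \<Longrightarrow> f - g \<in> hom p e"
proof -
  assume fg: "f \<in> hom p e" "g \<in> hom p e"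
  then have "finite ({x. f x \<noteq> 0} \<union> {x. g x \<noteq> 0})" by (simp add: hom_def)
  then have "finite {x. (f - g) x \<noteq> 0}" by (rule rev_finite_subset) auto
  then show ?thesis using fg by (auto simp: hom_def intro!: face_polys_diff)
qed

text \<open>The support over which the sum runs varies with \<open>f\<close>; a common finite
  superset makes different elements comparable.\<close>

lemma diff_superset:
  assumes "finite A" "{x. f x \<noteq> 0} \<subseteq> A"
  shows "diff i f y = (if y \<in> bs i then \<Sum>x\<in>A. dm i x y * f x else 0)"
  unfolding diff_def using assms by (auto intro!: sum.mono_neutral_left)

lemma augment_superset:
  assumes "finite A" "{x. f x \<noteq> 0} \<subseteq> A"
  shows "augment f = face_part K (\<Sum>x\<in>A. f x * a x)"
  unfolding augment_def using assms by (auto intro!: arg_cong[of _ _ "face_part K"] sum.mono_neutral_left)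

lemma diff_hom:
  assumes f: "f \<in> hom (Suc p) e"
  shows "diff p f \<in> hom p e"
proof -
  have fin: "finite {x. f x \<noteq> 0}" and bs: "x \<in> bs (Suc p)" if "f x \<noteq> 0" for x
    using f that by (auto simp: hom_def)
  have "finite (\<Union>x\<in>{x. f x \<noteq> 0}. {y \<in> bs p. dm p x y \<noteq> 0})"
    using f bs dm_finite by (auto simp: hom_def)
  moreover have "{y. diff p f y \<noteq> 0} \<subseteq> (\<Union>x\<in>{x. f x \<noteq> 0}. {y \<in> bs p. dm p x y \<noteq> 0})"
  proof
    fix y assume "y \<in> {y. diff p f y \<noteq> 0}"
    then have y: "y \<in> bs p" "(\<Sum>x | f x \<noteq> 0. dm p x y * f x) \<noteq> 0"
      by (auto simp: diff_def split: if_splits)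
    then obtain x where "f x \<noteq> 0" "dm p x y * f x \<noteq> 0"
      by (auto elim: sum.not_neutral_contains_not_neutral)
    then show "y \<in> (\<Union>x\<in>{x. f x \<noteq> 0}. {y \<in> bs p. dm p x y \<noteq> 0})" using y by auto
  qed
  ultimately have "finite {y. diff p f y \<noteq> 0}" by (rule rev_finite_subset)
  moreover have "diff p f y \<in> face_polys (Pow {1..m}) (e - dg p y)" for y
  proof (cases "y \<in> bs p")
    case True
    have "dm p x y * f x \<in> face_polys (Pow {1..m}) (e - dg p y)" if "f x \<noteq> 0" for x
    proof -
      have "f x \<in> face_polys (Pow {1..m}) (e - dg (Suc p) x)" using f by (simp add: hom_def)
      then have "dm p x y * f x \<in> face_polys (Pow {1..m}) ((dg (Suc p) x - dg p y) + (e - dg (Suc p) x))"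
        by (intro face_polys_mult dm_degree bs that True)
      then show ?thesis by simp
    qed
    then show ?thesis using True by (auto simp: diff_def intro!: face_polys_sum)
  qed (simp add: diff_def)
  ultimately show ?thesis by (simp add: hom_def diff_def)
qed

lemma augment_hom:
  assumes f: "f \<in> hom 0 e"
  shows "augment f \<in> face_polys K e"
proof -
  have "f x * a x \<in> face_polys (Pow {1..m}) e" if "f x \<noteq> 0" for x
  proof -
    have "x \<in> bs 0" "f x \<in> face_polys (Pow {1..m}) (e - dg 0 x)" using f that by (auto simp: hom_def)
    then have "f x * a x \<in> face_polys (Pow {1..m}) ((e - dg 0 x) + dg 0 x)"
      by (intro face_polys_mult a_degree)
    then show ?thesis by simp
  qed
  then show ?thesis
    unfolding augment_def by (intro face_part_closed face_polys_sum) auto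
qed

text \<open>The matrix entries are homogeneous, so the differential commutes with taking components.
  Exactness of the resolution is given without degrees, and this is how it passes to each
  degree.\<close>

lemma diff_component:
  assumes f: "f \<in> free (Suc p)"
  shows "diff p (component (Suc p) e f) = component p e (diff p f)"
proof
  fix y
  have fin: "finite {x. f x \<noteq> 0}" using f by (simp add: free_def)
  have sub: "{x. component (Suc p) e f x \<noteq> 0} \<subseteq> {x. f x \<noteq> 0}"
    by (auto simp: component_def)
  have "dm p x y * component (Suc p) e f x = restr (\<lambda>t. 2 * int (mdeg t) = e - dg p y) (dm p x y * f x)"
    if "y \<in> bs p" "f x \<noteq> 0" for x
  proof -
    have "x \<in> bs (Suc p)" using f that by (auto simp: free_def)
    from dm_degree[OF this that(1)] show ?thesis
      unfolding component_def
      by (intro restr_mult[symmetric]) (auto simp: face_polys_def mdeg_add)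
  qed
  then show "diff p (component (Suc p) e f) y = component p e (diff p f) y"
    unfolding diff_superset[OF fin sub] by (simp add: diff_def component_def[of p] restr_sum)
qed

lemma restr_restr_commute: "restr P (restr Q p) = restr Q (restr P p)"
  by (rule poly_mapping_eqI) (simp add: lookup_restr)

lemma augment_component:
  assumes f: "f \<in> free 0"
  shows "augment (component 0 e f) = restr (\<lambda>t. 2 * int (mdeg t) = e) (augment f)"
proof -
  have fin: "finite {x. f x \<noteq> 0}" using f by (simp add: free_def)
  have sub: "{x. component 0 e f x \<noteq> 0} \<subseteq> {x. f x \<noteq> 0}"
    by (auto simp: component_def)
  have "component 0 e f x * a x = restr (\<lambda>t. 2 * int (mdeg t) = e) (f x * a x)" if "f x \<noteq> 0" for x
  proof -
    have "x \<in> bs 0" using f that by (auto simp: free_def)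
    from a_degree[OF this] have "restr (\<lambda>t. 2 * int (mdeg t) = e) (a x * f x) = a x * component 0 e f x"
      unfolding component_def by (intro restr_mult) (auto simp: face_polys_def mdeg_add)
    then show ?thesis by (simp add: mult.commute)
  qed
  then show ?thesis
    unfolding augment_superset[OF fin sub] unfolding augment_def
    by (simp add: restr_restr_commute[of "\<lambda>t. 2 * int (mdeg t) = e"] restr_sum)
qed

lemma hom_augment_surj:
  assumes p: "p \<in> face_polys K e"
  shows "\<exists>f\<in>hom 0 e. augment f = p"
proof -
  have "p \<in> carrier (mpoly_ring m)"
    using p K_Pow by (auto simp: face_polys_def)
  then obtain f where f: "f \<in> free 0" "augment f = face_part K p" using augment_surj by blast
  moreover have "face_part K p = p" "restr (\<lambda>t. 2 * int (mdeg t) = e) p = p"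
    using p by (auto simp: face_polys_def intro!: restr_id)
  ultimately have "augment (component 0 e f) = p"
    by (simp add: augment_component)
  then show ?thesis using component_hom[OF f(1)] by blast
qed

lemma hom_augment_exact:
  assumes f: "f \<in> hom 0 e" "augment f = 0"
  shows "\<exists>h\<in>hom (Suc 0) e. diff 0 h = f"
proof -
  have "f \<in> diff 0 ` free 1" using augment_exact f hom_free by blast
  then obtain h where h: "h \<in> free (Suc 0)" "f = diff 0 h" by auto
  then have "diff 0 (component (Suc 0) e h) = f"
    using diff_component component_id f by simp
  then show ?thesis using component_hom h(1) by blast
qed

lemma hom_diff_exact:
  assumes f: "f \<in> hom (Suc i) e" "diff i f = 0"
  shows "\<exists>h\<in>hom (Suc (Suc i)) e. diff (Suc i) h = f"
proof -
  have "f \<in> diff (Suc i) ` free (Suc (Suc i))" using diff_exact f hom_free by blast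
  then obtain h where h: "h \<in> free (Suc (Suc i))" "f = diff (Suc i) h" by auto
  then have "diff (Suc i) (component (Suc (Suc i)) e h) = f"
    using diff_component component_id f by simp
  then show ?thesis using component_hom h(1) by blast
qed

lemma diff_diff: "f \<in> hom (Suc (Suc i)) e \<Longrightarrow> diff i (diff (Suc i) f) = 0"
  using diff_exact[of i] hom_free by blast

lemma augment_diff: "f \<in> hom (Suc 0) e \<Longrightarrow> augment (diff 0 f) = 0"
  using augment_exact hom_free unfolding One_nat_def by blast

text \<open>The components of internal degree \<open>d\<close> of \<open>F\<^sub>p \<otimes> \<Lambda>\<^sup>q\<close> and of \<open>F\<^sub>p \<otimes> k\<close>.\<close>

definition dbl :: "int \<Rightarrow> nat \<Rightarrow> nat \<Rightarrow> ('x \<Rightarrow> nat set \<Rightarrow> 'k mpoly) set" where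
  "dbl d p q = {f. \<forall>S. if S \<subseteq> {1..m} \<and> card S = q then (\<lambda>x. f x S) \<in> hom p (d - 2 * int q)
     else (\<lambda>x. f x S) = 0}"

definition dbl_h :: "nat \<Rightarrow> nat \<Rightarrow> ('x \<Rightarrow> nat set \<Rightarrow> 'k mpoly) \<Rightarrow> 'x \<Rightarrow> nat set \<Rightarrow> 'k mpoly" where
  "dbl_h p q f y S = diff p (\<lambda>x. f x S) y"

definition dbl_v :: "nat \<Rightarrow> nat \<Rightarrow> ('x \<Rightarrow> nat set \<Rightarrow> 'k mpoly) \<Rightarrow> 'x \<Rightarrow> nat set \<Rightarrow> 'k mpoly" where
  "dbl_v p q f x = koszul m (f x)"

definition fib :: "int \<Rightarrow> nat \<Rightarrow> ('x \<Rightarrow> 'k) set" where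
  "fib d p = {f. (\<forall>x. f x \<noteq> 0 \<longrightarrow> x \<in> bs p \<and> dg p x = d) \<and> finite {x. f x \<noteq> 0}}"

definition fib_diff :: "nat \<Rightarrow> ('x \<Rightarrow> 'k) \<Rightarrow> 'x \<Rightarrow> 'k" where
  "fib_diff p f y = (if y \<in> bs p then \<Sum>x | f x \<noteq> 0. lookup (dm p x y) 0 * f x else 0)"

definition to_fib :: "nat \<Rightarrow> ('x \<Rightarrow> nat set \<Rightarrow> 'k mpoly) \<Rightarrow> 'x \<Rightarrow> 'k" where
  "to_fib p f x = lookup (f x {}) 0"

definition to_face :: "nat \<Rightarrow> ('x \<Rightarrow> nat set \<Rightarrow> 'k mpoly) \<Rightarrow> nat set \<Rightarrow> 'k mpoly" where
  "to_face q f S = augment (\<lambda>x. f x S)"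

lemma dblD:
  assumes "f \<in> dbl d p q"
  shows "S \<subseteq> {1..m} \<Longrightarrow> card S = q \<Longrightarrow> (\<lambda>x. f x S) \<in> hom p (d - 2 * int q)"
    and "\<not> (S \<subseteq> {1..m} \<and> card S = q) \<Longrightarrow> (\<lambda>x. f x S) = 0"
proof -
  have "if S \<subseteq> {1..m} \<and> card S = q then (\<lambda>x. f x S) \<in> hom p (d - 2 * int q) else (\<lambda>x. f x S) = 0"
    using assms unfolding dbl_def by blast
  then show "S \<subseteq> {1..m} \<Longrightarrow> card S = q \<Longrightarrow> (\<lambda>x. f x S) \<in> hom p (d - 2 * int q)"
    "\<not> (S \<subseteq> {1..m} \<and> card S = q) \<Longrightarrow> (\<lambda>x. f x S) = 0"
    by (simp_all only: if_True if_False simp_thms)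
qed

lemma dblI:
  assumes "\<And>S. S \<subseteq> {1..m} \<Longrightarrow> card S = q \<Longrightarrow> (\<lambda>x. f x S) \<in> hom p (d - 2 * int q)"
    and "\<And>S. \<not> (S \<subseteq> {1..m} \<and> card S = q) \<Longrightarrow> (\<lambda>x. f x S) = 0"
  shows "f \<in> dbl d p q"
  unfolding dbl_def
proof (intro CollectI allI)
  fix S
  show "if S \<subseteq> {1..m} \<and> card S = q then (\<lambda>x. f x S) \<in> hom p (d - 2 * int q) else (\<lambda>x. f x S) = 0"
    using assms[of S] by (cases "S \<subseteq> {1..m} \<and> card S = q") (simp_all only: if_True if_False simp_thms)
qed

lemma dbl_hom:
  assumes "f \<in> dbl d p q"
  shows "(\<lambda>x. f x S) \<in> hom p (d - 2 * int q)"
  using dblD[OF assms, of S] hom_zero by (cases "S \<subseteq> {1..m} \<and> card S = q") auto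

lemma dbl_finite:
  assumes f: "f \<in> dbl d p q"
  shows "finite {x. f x \<noteq> 0}"
proof -
  have "finite (\<Union>S\<in>Pow {1..m}. {x. f x S \<noteq> 0})"
    using dbl_hom[OF f] by (auto simp: hom_def)
  moreover have "{x. f x \<noteq> 0} \<subseteq> (\<Union>S\<in>Pow {1..m}. {x. f x S \<noteq> 0})"
  proof
    fix x assume "x \<in> {x. f x \<noteq> 0}"
    then obtain S where S: "f x S \<noteq> 0" by (auto simp: fun_eq_iff)
    have "S \<subseteq> {1..m}"
    proof (rule ccontr)
      assume "\<not> S \<subseteq> {1..m}"
      then have "(\<lambda>x. f x S) = 0" using dblD(2)[OF f, of S] by blast
      then show False using S by (simp add: fun_eq_iff)
    qed
    then show "x \<in> (\<Union>S\<in>Pow {1..m}. {x. f x S \<noteq> 0})" using S by auto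
  qed
  ultimately show ?thesis by (rule rev_finite_subset)
qed

text \<open>An element of the double complex is read in two ways: for fixed \<open>S\<close> as a
  homogeneous element of the free module, for fixed \<open>x\<close> as a Koszul chain of degree
  \<open>d - dg p x\<close>. The horizontal differential acts in the first reading, the vertical one
  in the second.\<close>

lemma dbl_koszul_chains:
  assumes f: "f \<in> dbl d p q"
  shows "f x \<in> koszul_chains m (Pow {1..m}) q (d - dg p x)" and "x \<notin> bs p \<Longrightarrow> f x = 0"
proof -
  show "x \<notin> bs p \<Longrightarrow> f x = 0"
    using dbl_hom[OF f] by (auto simp: hom_def fun_eq_iff)
  have "if S \<subseteq> {1..m} \<and> card S = q then f x S \<in> face_polys (Pow {1..m}) (d - dg p x - 2 * int q)
      else f x S = 0" for S
  proof (cases "S \<subseteq> {1..m} \<and> card S = q")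
    case True
    have "f x S \<in> face_polys (Pow {1..m}) (d - 2 * int q - dg p x)"
      using dbl_hom[OF f, of S] by (simp add: hom_def)
    then show ?thesis using True by (simp add: algebra_simps)
  next
    case False
    then show ?thesis using dblD(2)[OF f False] by (simp add: fun_eq_iff)
  qed
  then show "f x \<in> koszul_chains m (Pow {1..m}) q (d - dg p x)"
    unfolding koszul_chains_def by blast
qed

lemma dbl_koszul_chainsI:
  assumes "\<And>x. x \<in> bs p \<Longrightarrow> f x \<in> koszul_chains m (Pow {1..m}) q (d - dg p x)"
    and "\<And>x. x \<notin> bs p \<Longrightarrow> f x = 0" and fin: "finite {x. f x \<noteq> 0}"
  shows "f \<in> dbl d p q"
proof -
  have f: "if S \<subseteq> {1..m} \<and> card S = q then f x S \<in> face_polys (Pow {1..m}) (d - dg p x - 2 * int q)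
      else f x S = 0" for x S
  proof -
    have "f x \<in> koszul_chains m (Pow {1..m}) q (d - dg p x)"
      using assms(1,2)[of x] koszul_chains_zero by metis
    then show ?thesis unfolding koszul_chains_def by blast
  qed
  show ?thesis
  proof (rule dblI)
    fix S assume S: "S \<subseteq> {1..m}" "card S = q"
    have "finite {x. f x S \<noteq> 0}" using fin by (rule rev_finite_subset) auto
    moreover have "f x S \<in> face_polys (Pow {1..m}) (d - 2 * int q - dg p x)" for x
      using f[of S x] S by (simp add: algebra_simps)
    ultimately show "(\<lambda>x. f x S) \<in> hom p (d - 2 * int q)"
      using assms(2) by (simp add: hom_def)
  next
    fix S assume "\<not> (S \<subseteq> {1..m} \<and> card S = q)"
    then show "(\<lambda>x. f x S) = 0"
      using f[of S] by (simp only: if_False) (simp add: fun_eq_iff)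
  qed
qed

lemma dbl_diff: "f \<in> dbl d p q \<Longrightarrow> g \<in> dbl d p q \<Longrightarrow> f - g \<in> dbl d p q"
proof (rule dblI)
  fix S assume fg: "f \<in> dbl d p q" "g \<in> dbl d p q"
  have eq: "(\<lambda>x. (f - g) x S) = (\<lambda>x. f x S) - (\<lambda>x. g x S)" by (simp add: fun_eq_iff)
  show "(\<lambda>x. (f - g) x S) \<in> hom p (d - 2 * int q)"
    unfolding eq using fg by (intro hom_diff dbl_hom)
  show "(\<lambda>x. (f - g) x S) = 0" if "\<not> (S \<subseteq> {1..m} \<and> card S = q)"
    unfolding eq using dblD(2)[OF _ that] fg by simp
qed

lemma diff_subtract:
  assumes "finite {x. f x \<noteq> 0}" "finite {x. g x \<noteq> 0}"
  shows "diff p (f - g) = diff p f - diff p g"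
proof
  fix y
  let ?A = "{x. f x \<noteq> 0} \<union> {x. g x \<noteq> 0}"
  have A: "finite ?A" using assms by simp
  have "diff p (f - g) y = (if y \<in> bs p then \<Sum>x\<in>?A. dm p x y * (f - g) x else 0)"
    by (rule diff_superset[OF A]) auto
  moreover have "diff p f y = (if y \<in> bs p then \<Sum>x\<in>?A. dm p x y * f x else 0)"
    "diff p g y = (if y \<in> bs p then \<Sum>x\<in>?A. dm p x y * g x else 0)"
    by (rule diff_superset[OF A], blast)+
  ultimately show "diff p (f - g) y = (diff p f - diff p g) y"
    by (simp add: right_diff_distrib sum_subtractf)
qed

lemma augment_subtract:
  assumes "finite {x. f x \<noteq> 0}" "finite {x. g x \<noteq> 0}"
  shows "augment (f - g) = augment f - augment g"
proof -
  let ?A = "{x. f x \<noteq> 0} \<union> {x. g x \<noteq> 0}"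
  have A: "finite ?A" using assms by simp
  have "augment (f - g) = face_part K (\<Sum>x\<in>?A. (f - g) x * a x)"
    by (rule augment_superset[OF A]) auto
  moreover have "augment f = face_part K (\<Sum>x\<in>?A. f x * a x)" "augment g = face_part K (\<Sum>x\<in>?A. g x * a x)"
    by (rule augment_superset[OF A], blast)+
  ultimately show ?thesis
    by (simp add: left_diff_distrib sum_subtractf restr_diff)
qed

lemma hom_finite: "f \<in> hom p e \<Longrightarrow> finite {x. f x \<noteq> 0}"
  by (simp add: hom_def)

lemma koszul_zero [simp]: "koszul m 0 = 0"
  by (simp add: koszul_def fun_eq_iff)

lemma diff_koszul:
  assumes "finite {x. f x \<noteq> 0}"
  shows "diff p (\<lambda>x. koszul m (f x) S) y = koszul m (\<lambda>S. diff p (\<lambda>x. f x S) y) S"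
proof -
  let ?A = "{x. f x \<noteq> 0}"
  have 1: "diff p (\<lambda>x. koszul m (f x) S) y = (if y \<in> bs p then \<Sum>x\<in>?A. dm p x y * koszul m (f x) S else 0)"
    by (rule diff_superset[OF assms]) auto
  have 2: "diff p (\<lambda>x. f x T) y = (if y \<in> bs p then \<Sum>x\<in>?A. dm p x y * f x T else 0)" for T
    by (rule diff_superset[OF assms]) auto
  show ?thesis
  proof (cases "y \<in> bs p")
    case True
    have "(\<Sum>x\<in>?A. dm p x y * koszul m (f x) S) =
        (\<Sum>x\<in>?A. \<Sum>i\<in>{1..m} - S. ksign i S * var i * (dm p x y * f x (insert i S)))"
      by (simp add: koszul_def sum_distrib_left mult.left_commute)
    also have "\<dots> = (\<Sum>i\<in>{1..m} - S. \<Sum>x\<in>?A. ksign i S * var i * (dm p x y * f x (insert i S)))"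
      by (rule sum.swap)
    also have "\<dots> = koszul m (\<lambda>T. \<Sum>x\<in>?A. dm p x y * f x T) S"
      by (simp add: koszul_def sum_distrib_left)
    finally show ?thesis using 1 2 True by simp
  next
    case False
    then show ?thesis by (simp add: diff_def koszul_def)
  qed
qed

lemma augment_koszul:
  assumes "finite {x. f x \<noteq> 0}"
  shows "augment (\<lambda>x. koszul m (f x) S) = face_koszul m K (\<lambda>S. augment (\<lambda>x. f x S)) S"
proof -
  let ?A = "{x. f x \<noteq> 0}"
  have 1: "augment (\<lambda>x. koszul m (f x) S) = face_part K (\<Sum>x\<in>?A. koszul m (f x) S * a x)"
    by (rule augment_superset[OF assms]) auto
  have 2: "augment (\<lambda>x. f x T) = face_part K (\<Sum>x\<in>?A. f x T * a x)" for T
    by (rule augment_superset[OF assms]) auto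
  have "(\<Sum>x\<in>?A. koszul m (f x) S * a x) =
      (\<Sum>x\<in>?A. \<Sum>i\<in>{1..m} - S. ksign i S * var i * (f x (insert i S) * a x))"
    by (simp add: koszul_def sum_distrib_right mult.assoc)
  also have "\<dots> = (\<Sum>i\<in>{1..m} - S. \<Sum>x\<in>?A. ksign i S * var i * (f x (insert i S) * a x))"
    by (rule sum.swap)
  also have "\<dots> = koszul m (\<lambda>T. \<Sum>x\<in>?A. f x T * a x) S"
    by (simp add: koszul_def sum_distrib_left)
  finally have "augment (\<lambda>x. koszul m (f x) S) = face_koszul m K (\<lambda>T. \<Sum>x\<in>?A. f x T * a x) S"
    using 1 by (simp add: face_koszul_def)
  also have "\<dots> = face_koszul m K (\<lambda>S. augment (\<lambda>x. f x S)) S"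
    unfolding 2 by (subst koszul_face_part[OF K_subset]) simp_all
  finally show ?thesis .
qed

lemma dbl_v_closed:
  assumes f: "f \<in> dbl d p (Suc q)"
  shows "dbl_v p q f \<in> dbl d p q"
proof (rule dbl_koszul_chainsI)
  show "dbl_v p q f x \<in> koszul_chains m (Pow {1..m}) q (d - dg p x)" for x
    unfolding dbl_v_def by (rule koszul_closed) (rule dbl_koszul_chains(1)[OF f])
  show "dbl_v p q f x = 0" if "x \<notin> bs p" for x
    using dbl_koszul_chains(2)[OF f that] by (simp add: dbl_v_def)
  show "finite {x. dbl_v p q f x \<noteq> 0}"
    using dbl_finite[OF f] by (rule rev_finite_subset) (auto simp: dbl_v_def)
qed

lemma dbl_h_closed:
  assumes f: "f \<in> dbl d (Suc p) q"
  shows "dbl_h p q f \<in> dbl d p q"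
proof (rule dblI)
  fix S
  show "(\<lambda>y. dbl_h p q f y S) \<in> hom p (d - 2 * int q)"
    unfolding dbl_h_def using dbl_hom[OF f] by (rule diff_hom)
  show "(\<lambda>y. dbl_h p q f y S) = 0" if "\<not> (S \<subseteq> {1..m} \<and> card S = q)"
    unfolding dbl_h_def dblD(2)[OF f that] by (simp add: diff_def fun_eq_iff)
qed

lemma double_complex_dbl: "double_complex (dbl d) dbl_h dbl_v"
proof
  fix p q
  show "0 \<in> dbl d p q"
    by (rule dblI) (simp_all add: hom_def fun_eq_iff)
  fix f :: "'x \<Rightarrow> nat set \<Rightarrow> 'k mpoly" and g
  show "f - g \<in> dbl d p q" if "f \<in> dbl d p q" "g \<in> dbl d p q" using that by (rule dbl_diff)
  show "dbl_h p q f \<in> dbl d p q" if "f \<in> dbl d (Suc p) q" using that by (rule dbl_h_closed)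
  show "dbl_v p q f \<in> dbl d p q" if "f \<in> dbl d p (Suc q)" using that by (rule dbl_v_closed)
  show "dbl_v p q (f - g) = dbl_v p q f - dbl_v p q g"
    by (rule ext) (simp add: dbl_v_def koszul_diff)
  show "dbl_h p q (f - g) = dbl_h p q f - dbl_h p q g" if "f \<in> dbl d (Suc p) q" "g \<in> dbl d (Suc p) q"
  proof (intro ext)
    fix y S
    have "diff p ((\<lambda>x. f x S) - (\<lambda>x. g x S)) = diff p (\<lambda>x. f x S) - diff p (\<lambda>x. g x S)"
      by (intro diff_subtract hom_finite[OF dbl_hom[OF that(1)]] hom_finite[OF dbl_hom[OF that(2)]])
    then show "dbl_h p q (f - g) y S = (dbl_h p q f - dbl_h p q g) y S"
      by (simp add: dbl_h_def fun_diff_def)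
  qed
  show "dbl_h p q (dbl_v (Suc p) q f) = dbl_v p q (dbl_h p (Suc q) f)" if "f \<in> dbl d (Suc p) (Suc q)"
    using diff_koszul[OF dbl_finite[OF that]]
    by (intro ext) (simp add: dbl_h_def[abs_def] dbl_v_def)
  show "dbl_h p q (dbl_h (Suc p) q f) = 0" if "f \<in> dbl d (Suc (Suc p)) q"
    using diff_diff[OF dbl_hom[OF that]]
    by (intro ext) (simp add: dbl_h_def)
  show "dbl_v p q (dbl_v p (Suc q) f) = 0" if "f \<in> dbl d p (Suc (Suc q))"
  proof
    fix x
    have "koszul m (koszul m (f x)) = 0"
      by (rule koszul_koszul) (metis dblD(2)[OF that] zero_fun_apply)
    then show "dbl_v p q (dbl_v p (Suc q) f) x = 0 x" by (simp add: dbl_v_def)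
  qed
qed

text \<open>The free module splits the vertical complex into shifted Koszul complexes of the
  polynomial ring, one for each basis element, and these are exact.\<close>

lemma dbl_v_exact:
  assumes f: "f \<in> dbl d p q" "\<And>x. koszul m (f x) = 0" "q = 0 \<Longrightarrow> to_fib p f = 0"
  shows "f \<in> dbl_v p q ` dbl d p (Suc q)"
proof -
  have "\<exists>y. y \<in> koszul_chains m (Pow {1..m}) (Suc q) (d - dg p x) \<and> f x = koszul m y" for x
  proof -
    have "q = 0 \<Longrightarrow> lookup (f x {}) 0 = 0"
      using fun_cong[OF f(3), of x] by (simp add: to_fib_def)
    from koszul_exact[OF dbl_koszul_chains(1)[OF f(1)] f(2) this] show ?thesis by metis
  qed
  then obtain h where h: "\<And>x. h x \<in> koszul_chains m (Pow {1..m}) (Suc q) (d - dg p x)"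
    "\<And>x. f x = koszul m (h x)" by metis
  \<comment> \<open>Preimages are chosen for all \<open>x\<close>; setting them to 0 where
    \<open>f x\<close> is 0 restores finite support.\<close>
  define h' where "h' x = (if f x = 0 then 0 else h x)" for x
  have "h' \<in> dbl d p (Suc q)"
  proof (rule dbl_koszul_chainsI)
    show "h' x \<in> koszul_chains m (Pow {1..m}) (Suc q) (d - dg p x)" for x
      unfolding h'_def by (metis h(1) koszul_chains_zero)
    show "h' x = 0" if "x \<notin> bs p" for x
      using dbl_koszul_chains(2)[OF f(1) that] by (simp add: h'_def)
    show "finite {x. h' x \<noteq> 0}"
      using dbl_finite[OF f(1)] by (rule rev_finite_subset) (auto simp: h'_def)
  qed
  moreover have "dbl_v p q h' = f"
    using h(2) by (intro ext) (simp add: dbl_v_def h'_def)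
  ultimately show ?thesis by blast
qed

text \<open>For fixed \<open>p\<close> the Koszul complex resolves k, and tensoring with a free
  module preserves this; the augmentation takes the constant term at the empty set.\<close>

lemma augmented_fib: "augmented_double_complex (dbl d) dbl_h dbl_v (fib d) fib_diff to_fib"
proof (intro augmented_double_complex.intro double_complex_dbl augmented_double_complex_axioms.intro)
  fix p q
  show "to_fib p ` dbl d p 0 = fib d p"
  proof (intro equalityI subsetI)
    fix z assume "z \<in> to_fib p ` dbl d p 0"
    then obtain f where f: "f \<in> dbl d p 0" "z = to_fib p f" by blast
    have F: "(\<lambda>x. f x {}) \<in> hom p d" using dbl_hom[OF f(1), of "{}"] by simp
    have "finite {x. z x \<noteq> 0}"
      using hom_finite[OF F] by (rule rev_finite_subset) (auto simp: f(2) to_fib_def)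
    moreover have "x \<in> bs p \<and> dg p x = d" if "z x \<noteq> 0" for x
    proof -
      have ne: "lookup (f x {}) 0 \<noteq> 0" using that by (simp add: f(2) to_fib_def)
      then have "f x {} \<noteq> 0" by auto
      then have "x \<in> bs p" using F by (auto simp: hom_def)
      moreover have "f x {} \<in> face_polys (Pow {1..m}) (d - dg p x)" "0 \<in> keys (f x {})"
        using F ne by (simp_all add: hom_def in_keys_iff)
      \<comment> \<open>A homogeneous polynomial has a constant term only in degree 0, which forces
        the degree of \<open>x\<close> to be \<open>d\<close>.\<close>
      then have "2 * int (mdeg (0 :: nat \<Rightarrow>\<^sub>0 nat)) = d - dg p x"
        unfolding face_polys_def by blast
      ultimately show ?thesis by simp
    qed
    ultimately show "z \<in> fib d p" by (simp add: fib_def)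
  next
    fix z assume z: "z \<in> fib d p"
    define f :: "'x \<Rightarrow> nat set \<Rightarrow> 'k mpoly" where
      "f = (\<lambda>x S. if S = {} then Poly_Mapping.single 0 (z x) else 0)"
    have "f \<in> dbl d p 0"
    proof (rule dblI)
      fix S :: "nat set" assume "S \<subseteq> {1..m}" "card S = 0"
      then have S: "S = {}" using finite_subset[of S "{1..m}"] by auto
      have "finite {x. z x \<noteq> 0}" using z by (simp add: fib_def)
      then have "finite {x. f x S \<noteq> 0}"
        by (rule rev_finite_subset) (auto simp: f_def)
      moreover have "f x S = 0" if "x \<notin> bs p" for x
      proof -
        have "z x = 0" using z that unfolding fib_def by blast
        then show ?thesis by (simp add: f_def)
      qed
      moreover have "f x S \<in> face_polys (Pow {1..m}) (d - 2 * int 0 - dg p x)" for x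
        using z by (auto simp: fib_def f_def face_polys_def)
      ultimately show "(\<lambda>x. f x S) \<in> hom p (d - 2 * int 0)"
        by (simp add: hom_def)
    next
      fix S :: "nat set" assume "\<not> (S \<subseteq> {1..m} \<and> card S = 0)"
      then have "S \<noteq> {}" by auto
      then show "(\<lambda>x. f x S) = 0" by (simp add: f_def fun_eq_iff)
    qed
    moreover have "to_fib p f = z" by (simp add: to_fib_def f_def fun_eq_iff)
    ultimately show "z \<in> to_fib p ` dbl d p 0" by blast
  qed
  fix f :: "'x \<Rightarrow> nat set \<Rightarrow> 'k mpoly" and g
  show "to_fib p (f - g) = to_fib p f - to_fib p g"
    by (simp add: to_fib_def fun_eq_iff lookup_minus)
  show "to_fib p (dbl_h p 0 f) = fib_diff p (to_fib (Suc p) f)" if f: "f \<in> dbl d (Suc p) 0"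
  proof
    fix y
    have fin: "finite {x. f x {} \<noteq> 0}" using hom_finite[OF dbl_hom[OF f]] .
    have "{x. to_fib (Suc p) f x \<noteq> 0} \<subseteq> {x. f x {} \<noteq> 0}" by (auto simp: to_fib_def)
    then have "fib_diff p (to_fib (Suc p) f) y =
        (if y \<in> bs p then \<Sum>x | f x {} \<noteq> 0. lookup (dm p x y) 0 * to_fib (Suc p) f x else 0)"
      unfolding fib_diff_def using fin by (auto intro!: sum.mono_neutral_left)
    then show "to_fib p (dbl_h p 0 f) y = fib_diff p (to_fib (Suc p) f) y"
      by (simp add: to_fib_def dbl_h_def diff_def lookup_sum lookup_mult_at_zero)
  qed
  show dv0: "to_fib p (dbl_v p 0 f) = 0" for f
    by (simp add: to_fib_def dbl_v_def koszul_def lookup_sum ksign_def lookup_sign_mult lookup_var_mult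
        mult.assoc fun_eq_iff)
  show "f \<in> dbl_v p 0 ` dbl d p 1" if f: "f \<in> dbl d p 0" "to_fib p f = 0"
  proof -
    have "koszul m (f x) = 0" for x
    proof
      fix S
      have "f x (insert i S) = 0" if "i \<in> {1..m} - S" for i
      proof -
        have "\<not> (insert i S \<subseteq> {1..m} \<and> card (insert i S) = 0)"
          using finite_subset[of "insert i S" "{1..m}"] by (auto simp: card_gt_0_iff)
        from dblD(2)[OF f(1) this] show ?thesis by (simp add: fun_eq_iff)
      qed
      then show "koszul m (f x) S = 0 S" by (simp add: koszul_def)
    qed
    then show ?thesis using dbl_v_exact[OF f(1)] f(2) by simp
  qed
  show "f \<in> dbl_v p (Suc q) ` dbl d p (Suc (Suc q))" if f: "f \<in> dbl d p (Suc q)" "dbl_v p q f = 0"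
  proof (rule dbl_v_exact[OF f(1)])
    show "koszul m (f x) = 0" for x using fun_cong[OF f(2), of x] by (simp add: dbl_v_def)
  qed simp
qed

text \<open>For fixed \<open>q\<close> the rows are copies of the resolution \<open>F\<close>, one
  for each \<open>S\<close> of size \<open>q\<close>, and \<open>F\<close> resolves k[K].\<close>

lemma augmented_face:
  "augmented_double_complex (\<lambda>p q. dbl d q p) (\<lambda>p q. dbl_v q p) (\<lambda>p q. dbl_h q p)
     (\<lambda>q. koszul_chains m K q d) (\<lambda>q. face_koszul m K) to_face"
proof (intro augmented_double_complex.intro[OF double_complex_transpose[OF double_complex_dbl]]
    augmented_double_complex_axioms.intro)
  fix q p
  show "to_face q ` dbl d 0 q = koszul_chains m K q d"
  proof (intro equalityI subsetI)
    fix z assume "z \<in> to_face q ` dbl d 0 q"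
    then obtain f where f: "f \<in> dbl d 0 q" "z = to_face q f" by blast
    have "if S \<subseteq> {1..m} \<and> card S = q then z S \<in> face_polys K (d - 2 * int q) else z S = 0" for S
    proof (cases "S \<subseteq> {1..m} \<and> card S = q")
      case True
      then show ?thesis
        using augment_hom[OF dbl_hom[OF f(1), of S]] by (simp add: f(2) to_face_def)
    next
      case False
      then show ?thesis
        using dblD(2)[OF f(1) False] by (simp add: f(2) to_face_def augment_def)
    qed
    then show "z \<in> koszul_chains m K q d" unfolding koszul_chains_def by blast
  next
    fix z :: "nat set \<Rightarrow> 'k mpoly" assume "z \<in> koszul_chains m K q d"
    then have z: "if S \<subseteq> {1..m} \<and> card S = q then z S \<in> face_polys K (d - 2 * int q) else z S = 0" for S
      unfolding koszul_chains_def by blast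
    have "\<exists>f. f \<in> hom 0 (d - 2 * int q) \<and> augment f = z S" if "S \<subseteq> {1..m} \<and> card S = q" for S
    proof -
      have "z S \<in> face_polys K (d - 2 * int q)" using z[of S] that by (simp only: if_True)
      then show ?thesis using hom_augment_surj by blast
    qed
    then obtain f where f: "\<And>S. S \<subseteq> {1..m} \<and> card S = q \<Longrightarrow> f S \<in> hom 0 (d - 2 * int q) \<and> augment (f S) = z S"
      by metis
    define h where "h x S = (if S \<subseteq> {1..m} \<and> card S = q then f S x else 0)" for x S
    have "h \<in> dbl d 0 q"
    proof (rule dblI)
      fix S assume "S \<subseteq> {1..m}" "card S = q"
      then show "(\<lambda>x. h x S) \<in> hom 0 (d - 2 * int q)"
        using f[of S] by (simp add: h_def)
    next
      fix S assume "\<not> (S \<subseteq> {1..m} \<and> card S = q)"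
      then show "(\<lambda>x. h x S) = 0" unfolding h_def by (simp only: if_False) (simp add: fun_eq_iff)
    qed
    moreover have "to_face q h = z"
    proof
      fix S
      show "to_face q h S = z S"
      proof (cases "S \<subseteq> {1..m} \<and> card S = q")
        case True
        then show ?thesis using f[OF True] by (simp add: to_face_def h_def)
      next
        case False
        then have "z S = 0" "to_face q h S = augment (\<lambda>x. 0)"
          using z[of S] unfolding to_face_def h_def by (simp_all only: if_False)
        then show ?thesis by (simp add: augment_def)
      qed
    qed
    ultimately show "z \<in> to_face q ` dbl d 0 q" by blast
  qed
  fix f :: "'x \<Rightarrow> nat set \<Rightarrow> 'k mpoly" and g
  show "to_face q (f - g) = to_face q f - to_face q g" if "f \<in> dbl d 0 q" "g \<in> dbl d 0 q"
  proof
    fix S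
    have "augment ((\<lambda>x. f x S) - (\<lambda>x. g x S)) = augment (\<lambda>x. f x S) - augment (\<lambda>x. g x S)"
      by (intro augment_subtract hom_finite[OF dbl_hom[OF that(1)]] hom_finite[OF dbl_hom[OF that(2)]])
    then show "to_face q (f - g) S = (to_face q f - to_face q g) S"
      by (simp add: to_face_def fun_diff_def)
  qed
  show "to_face q (dbl_v 0 q f) = face_koszul m K (to_face (Suc q) f)" if "f \<in> dbl d 0 (Suc q)"
    using augment_koszul[OF dbl_finite[OF that]]
    by (intro ext) (simp add: to_face_def[abs_def] dbl_v_def)
  show "to_face q (dbl_h 0 q f) = 0" if "f \<in> dbl d 1 q"
  proof
    fix S
    have "(\<lambda>x. f x S) \<in> hom (Suc 0) (d - 2 * int q)" using dbl_hom[OF that] by simp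
    then show "to_face q (dbl_h 0 q f) S = 0 S"
      using augment_diff by (simp add: to_face_def dbl_h_def)
  qed
  \<comment> \<open>The horizontal equation is solved for each \<open>S\<close> separately; there
    are no finiteness constraints across different \<open>S\<close>, apart from being zero off the
    sets of size \<open>q\<close>.\<close>
  have lift: "f \<in> dbl_h p q ` dbl d (Suc p) q"
    if f: "f \<in> dbl d p q" and ex: "\<And>S. \<exists>h\<in>hom (Suc p) (d - 2 * int q). diff p h = (\<lambda>x. f x S)" for p f
  proof -
    obtain h where h: "\<And>S. h S \<in> hom (Suc p) (d - 2 * int q)" "\<And>S. diff p (h S) = (\<lambda>x. f x S)"
      using ex by metis
    define h' where "h' x S = (if S \<subseteq> {1..m} \<and> card S = q then h S x else 0)" for x S
    have "h' \<in> dbl d (Suc p) q"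
    proof (rule dblI)
      fix S assume "S \<subseteq> {1..m}" "card S = q"
      then show "(\<lambda>x. h' x S) \<in> hom (Suc p) (d - 2 * int q)"
        using h(1)[of S] by (simp add: h'_def)
    next
      fix S assume "\<not> (S \<subseteq> {1..m} \<and> card S = q)"
      then show "(\<lambda>x. h' x S) = 0" unfolding h'_def by (simp only: if_False) (simp add: fun_eq_iff)
    qed
    moreover have "dbl_h p q h' = f"
    proof (intro ext)
      fix y S
      show "dbl_h p q h' y S = f y S"
      proof (cases "S \<subseteq> {1..m} \<and> card S = q")
        case True
        then show ?thesis using fun_cong[OF h(2)[of S], of y] by (simp add: dbl_h_def h'_def)
      next
        case False
        then have "dbl_h p q h' y S = diff p (\<lambda>x. 0) y"
          unfolding dbl_h_def h'_def by (simp only: if_False)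
        then show ?thesis
          using fun_cong[OF dblD(2)[OF f False], of y] by (simp add: diff_def)
      qed
    qed
    ultimately show ?thesis by blast
  qed
  show "f \<in> dbl_h 0 q ` dbl d 1 q" if f: "f \<in> dbl d 0 q" "to_face q f = 0"
  proof -
    have "augment (\<lambda>x. f x S) = 0" for S
      using fun_cong[OF f(2), of S] by (simp add: to_face_def)
    then show ?thesis
      using lift[OF f(1)] hom_augment_exact[OF dbl_hom[OF f(1)]] by simp
  qed
  show "f \<in> dbl_h (Suc p) q ` dbl d (Suc (Suc p)) q" if f: "f \<in> dbl d (Suc p) q" "dbl_h p q f = 0"
  proof (rule lift[OF f(1)])
    fix S
    have "diff p (\<lambda>x. f x S) = 0"
      using f(2) by (simp add: dbl_h_def fun_eq_iff)
    then show "\<exists>h\<in>hom (Suc (Suc p)) (d - 2 * int q). diff (Suc p) h = (\<lambda>x. f x S)"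
      using hom_diff_exact[OF dbl_hom[OF f(1)]] by simp
  qed
qed

lemma biaugmented:
  "biaugmented_double_complex (dbl d) dbl_h dbl_v (fib d) fib_diff to_fib
     (\<lambda>q. koszul_chains m K q d) (\<lambda>q. face_koszul m K) to_face"
  by (intro biaugmented_double_complex.intro augmented_fib augmented_face)

end

section \<open>Scalar multiplication\<close>

lemma lookup_scale:
  fixes r :: "'k::comm_ring_1"
  shows "lookup (Poly_Mapping.single 0 r * p) t = r * lookup (p :: 'k mpoly) t"
  by (simp add: mult_map_scale_conv_mult[symmetric] Poly_Mapping.map.rep_eq when_def)

lemma keys_scale: "keys (Poly_Mapping.single 0 r * p) \<subseteq> keys (p :: 'k::comm_ring_1 mpoly)"
  by (auto simp: in_keys_iff lookup_scale)

lemma restr_scale: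
  "restr P (Poly_Mapping.single 0 r * p) = Poly_Mapping.single 0 r * restr P (p :: 'k::comm_ring_1 mpoly)"
  by (rule poly_mapping_eqI) (simp add: lookup_restr lookup_scale)

lemma koszul_scale:
  "koszul m (\<lambda>S. Poly_Mapping.single 0 r * g S) S = Poly_Mapping.single 0 r * koszul m g S"
  by (simp add: koszul_def sum_distrib_left mult.left_commute)

lemma face_koszul_scale:
  "face_koszul m K (\<lambda>S. Poly_Mapping.single 0 r * g S) S = Poly_Mapping.single 0 r * face_koszul m K g S"
  by (simp add: face_koszul_def koszul_scale restr_scale)

lemma koszul_chains_scale:
  "g \<in> koszul_chains m K q d \<Longrightarrow> (\<lambda>S. Poly_Mapping.single 0 r * g S) \<in> koszul_chains m K q d"
  unfolding koszul_chains_iff lookup_scale by (metis mult_zero_right)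

context exact_face_resolution
begin

definition scale :: "'k \<Rightarrow> ('x \<Rightarrow> nat set \<Rightarrow> 'k mpoly) \<Rightarrow> 'x \<Rightarrow> nat set \<Rightarrow> 'k mpoly" where
  "scale r f x S = Poly_Mapping.single 0 r * f x S"

lemma face_polys_scale:
  "p \<in> face_polys L e \<Longrightarrow> Poly_Mapping.single 0 r * p \<in> face_polys L e"
  using keys_scale[of r p] unfolding face_polys_def by blast

lemma hom_scale: "f \<in> hom p e \<Longrightarrow> (\<lambda>x. Poly_Mapping.single 0 r * f x) \<in> hom p e"
proof -
  assume f: "f \<in> hom p e"
  have "finite {x. Poly_Mapping.single 0 r * f x \<noteq> 0}"
    using hom_finite[OF f] by (rule rev_finite_subset) auto
  then show ?thesis using f by (simp add: hom_def face_polys_scale)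
qed

lemma dbl_scale: "f \<in> dbl d p q \<Longrightarrow> scale r f \<in> dbl d p q"
proof (rule dblI)
  assume f: "f \<in> dbl d p q"
  fix S
  show "(\<lambda>x. scale r f x S) \<in> hom p (d - 2 * int q)"
    unfolding scale_def using dbl_hom[OF f] by (rule hom_scale)
  show "(\<lambda>x. scale r f x S) = 0" if "\<not> (S \<subseteq> {1..m} \<and> card S = q)"
    using dblD(2)[OF f that] by (simp add: scale_def fun_eq_iff)
qed

lemma dbl_v_scale: "dbl_v p q (scale r f) = scale r (dbl_v p q f)"
  by (intro ext) (simp add: dbl_v_def scale_def[abs_def] koszul_scale)

lemma dbl_h_scale: "f \<in> dbl d (Suc p) q \<Longrightarrow> dbl_h p q (scale r f) = scale r (dbl_h p q f)"
proof (intro ext)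
  assume f: "f \<in> dbl d (Suc p) q"
  fix y S
  have "diff p (\<lambda>x. scale r f x S) y =
      (if y \<in> bs p then \<Sum>x | f x S \<noteq> 0. dm p x y * scale r f x S else 0)"
    by (rule diff_superset[OF hom_finite[OF dbl_hom[OF f]]]) (auto simp: scale_def)
  then show "dbl_h p q (scale r f) y S = scale r (dbl_h p q f) y S"
    by (simp add: dbl_h_def scale_def diff_def sum_distrib_left mult.left_commute)
qed

lemma to_fib_scale: "to_fib p (scale r f) = (\<lambda>x. r * to_fib p f x)"
  by (simp add: to_fib_def scale_def lookup_scale fun_eq_iff)

lemma to_face_scale:
  assumes f: "f \<in> dbl d 0 q"
  shows "to_face q (scale r f) = (\<lambda>S. Poly_Mapping.single 0 r * to_face q f S)"
proof
  fix S
  have "augment (\<lambda>x. scale r f x S) = face_part K (\<Sum>x | f x S \<noteq> 0. scale r f x S * a x)"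
    by (rule augment_superset[OF hom_finite[OF dbl_hom[OF f]]]) (auto simp: scale_def)
  then show "to_face q (scale r f) S = Poly_Mapping.single 0 r * to_face q f S"
    by (simp add: to_face_def augment_def scale_def restr_scale[symmetric] sum_distrib_left mult.assoc)
qed

end

section \<open>Critical cells and critical generators\<close>

definition indicator_mon :: "nat set \<Rightarrow> (nat \<Rightarrow>\<^sub>0 nat)" where
  "indicator_mon B = (\<Sum>i\<in>B. Poly_Mapping.single i 1)"

lemma lookup_indicator_mon: "finite B \<Longrightarrow> lookup (indicator_mon B) i = (if i \<in> B then 1 else 0)"
  unfolding indicator_mon_def by (rule lookup_indicator)

lemma keys_indicator_mon: "finite B \<Longrightarrow> keys (indicator_mon B) = B"
  unfolding indicator_mon_def by (rule keys_indicator)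

lemma mdeg_indicator_mon: "finite B \<Longrightarrow> mdeg (indicator_mon B) = card B"
  by (simp add: mdeg_def keys_indicator_mon lookup_indicator_mon)

context matroid_koszul
begin

definition crit_gens :: "nat \<Rightarrow> int \<Rightarrow> gen set" where
  "crit_gens q d = {g \<in> critical_gens m K. bidegree g = (- int q, d)}"

text \<open>For a squarefree monomial the repeated indices form the intersection of \<open>A\<close>
  and \<open>B\<close>, so disjointness becomes emptiness of \<open>multiple\<close>.\<close>

lemma crit_gens_iff:
  assumes B: "finite B"
  shows "(A, B) \<in> crit_gens q d \<longleftrightarrow> (A, indicator_mon B) \<in> cells m K q d \<and> is_crit K A (indicator_mon B)"
proof -
  have "multiple A (indicator_mon B) = A \<inter> B"
    using B by (auto simp: multiple_def lookup_indicator_mon split: if_splits)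
  moreover have "B \<subseteq> {1..m}" if "B \<in> K" using K_Pow that by blast
  ultimately show ?thesis
    using B by (auto simp: crit_gens_def critical_gens_eq[OF M] generators_def bidegree_def cells_def
        is_crit_def keys_indicator_mon mdeg_indicator_mon)
qed

lemma crit_gens_finite_snd: "(A, B) \<in> crit_gens q d \<Longrightarrow> finite B"
  by (auto simp: crit_gens_def critical_gens_def generators_def intro: finite_subset)

lemma is_crit_indicator: "is_crit K S t \<Longrightarrow> t = indicator_mon (keys t)"
  using multiple_empty_lookup[of S t]
  by (intro poly_mapping_eqI) (auto simp: lookup_indicator_mon is_crit_def in_keys_iff)

text \<open>The coordinates of a chain at the critical generators of one bidegree, extended by 0 so
  as to lie in \<open>critical_module\<close>.\<close>

definition readout :: "nat \<Rightarrow> int \<Rightarrow> (nat set \<Rightarrow> 'k::comm_ring_1 mpoly) \<Rightarrow> gen \<Rightarrow> 'k" where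
  "readout q d z = (\<lambda>(A, B). if (A, B) \<in> crit_gens q d then lookup (z A) (indicator_mon B) else 0)"

lemma readout_zero:
  assumes "z \<in> koszul_chains m K q d" "crit_chain z" "readout q d z = 0"
  shows "z = 0"
proof (intro ext poly_mapping_eqI, rule ccontr)
  fix S t assume "lookup (z S) t \<noteq> lookup (0 S) t"
  then have ne: "lookup (z S) t \<noteq> 0" by simp
  then have "(S, t) \<in> cells m K q d" and crit: "is_crit K S t"
    using assms(1,2) by (auto simp: koszul_chains_iff crit_chain_def)
  then have "(S, keys t) \<in> crit_gens q d"
    using is_crit_indicator[OF crit] by (simp add: crit_gens_iff)
  then have "lookup (z S) (indicator_mon (keys t)) = 0"
    using fun_cong[OF assms(3), of "(S, keys t)"] by (simp add: readout_def)
  then show False using ne is_crit_indicator[OF crit] by simp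
qed

lemma readout_surj:
  fixes c :: "gen \<Rightarrow> 'k::comm_ring_1"
  assumes c: "\<And>g. g \<notin> crit_gens q d \<Longrightarrow> c g = 0"
  obtains z where "z \<in> koszul_chains m K q d" "crit_chain z" "readout q d z = c"
proof
  define Y where "Y = {(S, t) \<in> cells m K q d. is_crit K S t}"
  have "finite Y"
    by (rule finite_subset[OF _ finite_cells[OF K_Pow]]) (auto simp: Y_def)
  define z where "z = cell_chain Y (\<lambda>(S, t). c (S, keys t))"
  have z: "lookup (z S) t = (if (S, t) \<in> Y then c (S, keys t) else 0)" for S t
    unfolding z_def by (simp add: lookup_cell_chain[OF \<open>finite Y\<close>])
  show "z \<in> koszul_chains m K q d"
    by (auto simp: koszul_chains_iff z Y_def)
  show "crit_chain z"
    by (auto simp: crit_chain_def z Y_def)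
  show "readout q d z = c"
  proof
    fix g :: gen obtain A B where g: "g = (A, B)" by (cases g)
    show "readout q d z g = c g"
    proof (cases "g \<in> crit_gens q d")
      case True
      then have "finite B" using g crit_gens_finite_snd by blast
      then show ?thesis
        using True g crit_gens_iff[of B A q d] by (simp add: readout_def z Y_def keys_indicator_mon)
    next
      case False
      then show ?thesis using c g by (simp add: readout_def)
    qed
  qed
qed

lemma readout_diff: "readout q d (f - g) = readout q d f - readout q d g"
  by (rule ext) (auto simp: readout_def lookup_minus split: prod.splits)

lemma readout_scale: "readout q d (\<lambda>S. Poly_Mapping.single 0 r * f S) = (\<lambda>g. r * readout q d f g)"
  by (rule ext) (auto simp: readout_def lookup_scale split: prod.splits)

lemma crit_chain_diff: "crit_chain f \<Longrightarrow> crit_chain g \<Longrightarrow> crit_chain (f - g)"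
  unfolding crit_chain_def
proof (intro allI impI)
  fix S t
  assume fg: "\<forall>S t. lookup (f S) t \<noteq> 0 \<longrightarrow> is_crit K S t" "\<forall>S t. lookup (g S) t \<noteq> 0 \<longrightarrow> is_crit K S t"
    and "lookup ((f - g) S) t \<noteq> 0"
  then have "lookup (f S) t \<noteq> 0 \<or> lookup (g S) t \<noteq> 0" by (auto simp: lookup_minus)
  then show "is_crit K S t" using fg by blast
qed

lemma crit_chain_scale: "crit_chain f \<Longrightarrow> crit_chain (\<lambda>S. Poly_Mapping.single 0 r * f S)"
  unfolding crit_chain_def lookup_scale by (metis mult_zero_right)

end

section \<open>The isomorphism\<close>

context exact_face_resolution
begin

context
  fixes d :: int and n :: nat
begin

interpretation B: biaugmented_double_complex "dbl d" dbl_h dbl_v "fib d" fib_diff to_fib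
  "\<lambda>q. koszul_chains m K q d" "\<lambda>q. face_koszul m K" to_face
  by (rule biaugmented)

definition cycles :: "('x \<Rightarrow> 'k) set" where
  "cycles = {z \<in> fib d n. \<forall>p. n = Suc p \<longrightarrow> fib_diff p z = 0}"

text \<open>The cycle \<open>z\<close> and the combination \<open>c\<close> are read off from the two ends of a zigzag in \<open>F \<otimes> \<Lambda>\<close>.\<close>

definition corresp :: "('x \<Rightarrow> 'k) \<Rightarrow> (gen \<Rightarrow> 'k) \<Rightarrow> bool" where
  "corresp z c \<longleftrightarrow> (\<exists>w y. B.L.zigzag n w \<and> to_fib n (w 0) = z \<and> y \<in> koszul_chains m K (Suc n) d \<and>
     crit_chain (to_face n (w n) - face_koszul m K y) \<and>
     readout n d (to_face n (w n) - face_koszul m K y) = c)"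

lemma zigzag_ends: "B.L.zigzag n w \<Longrightarrow> w 0 \<in> dbl d n 0" "B.L.zigzag n w \<Longrightarrow> w n \<in> dbl d 0 n"
  by (auto simp: B.L.zigzag_def)

lemma corresp_cycle:
  assumes "corresp z c"
  shows "z \<in> cycles" and "g \<notin> crit_gens n d \<Longrightarrow> c g = 0"
proof -
  obtain w where w: "B.L.zigzag n w" "to_fib n (w 0) = z"
    using assms unfolding corresp_def by blast
  have "to_fib n (w 0) \<in> fib d n"
    using zigzag_ends(1)[OF w(1)] B.L.eps_image[of n] by blast
  then show "z \<in> cycles"
    using w B.L.eps_zigzag_cycle[of _ w] by (auto simp: cycles_def)
  show "c g = 0" if "g \<notin> crit_gens n d"
    using assms that by (cases g) (auto simp: corresp_def readout_def)
qed

text \<open>The cycle is lifted to a zigzag; the other end is a cycle of k[K] tensor Lambda and is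
  homologous to a critical chain.\<close>

lemma corresp_total:
  assumes z: "z \<in> cycles"
  obtains c where "corresp z c"
proof -
  obtain w where w: "B.L.zigzag n w" "to_fib n (w 0) = z"
    using B.L.zigzag_lift[of z n] z unfolding cycles_def by blast
  have v: "to_face n (w n) \<in> koszul_chains m K n d"
    using zigzag_ends(2)[OF w(1)] B.R.eps_image[of n] by blast
  have "face_koszul m K (to_face n (w n)) = 0"
  proof (cases n)
    \<comment> \<open>No zigzag condition is available for \<open>n = 0\<close>. The boundary
      vanishes since cells of exterior degree 0 have empty first component.\<close>
    case 0
    have "lookup (face_koszul m K (to_face n (w n)) S) t = 0" for S t
    proof (cases "keys t \<in> K")
      case True
      have "to_face n (w n) (insert i S) = 0" for i
      proof (intro poly_mapping_eqI, rule ccontr)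
        fix t assume "lookup (to_face n (w n) (insert i S)) t \<noteq> lookup 0 t"
        then have "(insert i S, t) \<in> cells m K n d"
          using v unfolding koszul_chains_iff lookup_zero by blast
        then show False using 0 by (auto simp: cells_def dest: finite_subset)
      qed
      then show ?thesis by (simp add: lookup_face_koszul[OF K_Pow True])
    qed (simp add: face_koszul_def lookup_restr)
    then show ?thesis by (intro ext poly_mapping_eqI) simp
  next
    case (Suc p)
    then show ?thesis using B.eta_zigzag_cycle[of p w] w(1) by simp
  qed
  then obtain y where "y \<in> koszul_chains m K (Suc n) d" "crit_chain (to_face n (w n) - face_koszul m K y)"
    using cycle_homologous_crit_chain[OF v] by blast
  then show ?thesis using that w unfolding corresp_def by blast
qed

lemma corresp_surj:
  assumes c: "\<And>g. g \<notin> crit_gens n d \<Longrightarrow> c g = 0"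
  obtains z where "corresp z c"
proof -
  obtain v where v: "v \<in> koszul_chains m K n d" "crit_chain v" "readout n d v = c"
    using readout_surj[of n d c, OF c] by blast
  have "face_koszul m K v = 0" using v(1,2) by (rule face_koszul_crit_chain)
  then obtain w where w: "B.L.zigzag n w" "to_face n (w n) = v"
    using B.zigzag_lift_right[OF v(1)] by blast
  have "face_koszul m K 0 = (0 :: nat set \<Rightarrow> 'k mpoly)"
    using face_koszul_diff[of m K 0 0] by simp
  then have "corresp (to_fib n (w 0)) c"
    unfolding corresp_def using w v koszul_chains_zero by (intro exI[of _ w] exI[of _ 0]) simp
  then show ?thesis by (rule that)
qed

lemma corresp_diff:
  assumes "corresp z c" "corresp z' c'"
  shows "corresp (z - z') (c - c')"
proof -
  obtain w y where w: "B.L.zigzag n w" "to_fib n (w 0) = z" "y \<in> koszul_chains m K (Suc n) d"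
     "crit_chain (to_face n (w n) - face_koszul m K y)"
     "readout n d (to_face n (w n) - face_koszul m K y) = c"
    using assms(1) unfolding corresp_def by blast
  obtain w' y' where w': "B.L.zigzag n w'" "to_fib n (w' 0) = z'" "y' \<in> koszul_chains m K (Suc n) d"
     "crit_chain (to_face n (w' n) - face_koszul m K y')"
     "readout n d (to_face n (w' n) - face_koszul m K y') = c'"
    using assms(2) unfolding corresp_def by blast
  have eq: "to_face n (w n - w' n) - face_koszul m K (y - y') =
      (to_face n (w n) - face_koszul m K y) - (to_face n (w' n) - face_koszul m K y')"
    using B.R.eps_diff[OF zigzag_ends(2)[OF w(1)] zigzag_ends(2)[OF w'(1)]]
    by (simp add: face_koszul_diff)
  show ?thesis
    unfolding corresp_def
  proof (intro exI conjI)
    show "B.L.zigzag n (\<lambda>i. w i - w' i)" using w(1) w'(1) by (rule B.L.zigzag_diff)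
    show "to_fib n (w 0 - w' 0) = z - z'"
      using B.L.eps_diff[OF zigzag_ends(1)[OF w(1)] zigzag_ends(1)[OF w'(1)]] w(2) w'(2) by simp
    show "y - y' \<in> koszul_chains m K (Suc n) d" using w(3) w'(3) by (rule koszul_chains_diff)
    show "crit_chain (to_face n (w n - w' n) - face_koszul m K (y - y'))"
      unfolding eq using w(4) w'(4) by (rule crit_chain_diff)
    show "readout n d (to_face n (w n - w' n) - face_koszul m K (y - y')) = c - c'"
      unfolding eq readout_diff[of n d "to_face n (w n) - face_koszul m K y"] w(5) w'(5) ..
  qed
qed

lemma corresp_scale:
  assumes "corresp z c"
  shows "corresp (\<lambda>x. r * z x) (\<lambda>g. r * c g)"
proof -
  obtain w y where w: "B.L.zigzag n w" "to_fib n (w 0) = z" "y \<in> koszul_chains m K (Suc n) d"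
     "crit_chain (to_face n (w n) - face_koszul m K y)"
     "readout n d (to_face n (w n) - face_koszul m K y) = c"
    using assms(1) unfolding corresp_def by blast
  let ?y = "\<lambda>S. Poly_Mapping.single 0 r * y S"
  have eq: "to_face n (scale r (w n)) - face_koszul m K ?y =
      (\<lambda>S. Poly_Mapping.single 0 r * (to_face n (w n) - face_koszul m K y) S)"
    by (rule ext) (simp add: to_face_scale[OF zigzag_ends(2)[OF w(1)]] face_koszul_scale right_diff_distrib)
  show ?thesis
    unfolding corresp_def
  proof (intro exI conjI)
    show "B.L.zigzag n (\<lambda>i. scale r (w i))"
      unfolding B.L.zigzag_def
    proof (intro conjI allI impI)
      show "scale r (w i) \<in> dbl d (n - i) i" if "i \<le> n" for i
        using w(1) that by (auto simp: B.L.zigzag_def intro: dbl_scale)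
      fix i assume i: "i < n"
      have "w i \<in> dbl d (n - i) i" using w(1) i by (simp add: B.L.zigzag_def)
      moreover have "n - i = Suc (n - Suc i)" using i by simp
      ultimately have "w i \<in> dbl d (Suc (n - Suc i)) i" by simp
      then show "dbl_h (n - Suc i) i (scale r (w i)) = dbl_v (n - Suc i) i (scale r (w (Suc i)))"
        using w(1) i by (simp add: B.L.zigzag_def dbl_h_scale dbl_v_scale)
    qed
    show "to_fib n (scale r (w 0)) = (\<lambda>x. r * z x)" using w(2) by (simp add: to_fib_scale)
    show "?y \<in> koszul_chains m K (Suc n) d" using w(3) by (rule koszul_chains_scale)
    show "crit_chain (to_face n (scale r (w n)) - face_koszul m K ?y)"
      unfolding eq using w(4) by (rule crit_chain_scale)
    show "readout n d (to_face n (scale r (w n)) - face_koszul m K ?y) = (\<lambda>g. r * c g)"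
      unfolding eq readout_scale w(5) ..
  qed
qed

text \<open>The critical chain is zero iff the right end of the zigzag is a boundary, by uniqueness
  of critical representatives; and the two ends are boundaries simultaneously.\<close>

lemma corresp_zero_iff:
  assumes "corresp z c"
  shows "c = 0 \<longleftrightarrow> z \<in> fib_diff n ` fib d (Suc n)"
proof -
  obtain w y where w: "B.L.zigzag n w" "to_fib n (w 0) = z" "y \<in> koszul_chains m K (Suc n) d"
     "crit_chain (to_face n (w n) - face_koszul m K y)"
     "readout n d (to_face n (w n) - face_koszul m K y) = c"
    using assms(1) unfolding corresp_def by blast
  let ?v = "to_face n (w n) - face_koszul m K y"
  have "to_face n (w n) \<in> koszul_chains m K n d"
    using zigzag_ends(2)[OF w(1)] B.R.eps_image[of n] by blast
  then have v: "?v \<in> koszul_chains m K n d"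
    using face_koszul_closed[OF w(3) K_Pow] by (rule koszul_chains_diff)
  have "c = 0 \<longleftrightarrow> ?v = 0"
    using readout_zero[OF v w(4)] w(5) readout_diff[of n d 0 0] by auto
  also have "\<dots> \<longleftrightarrow> to_face n (w n) \<in> face_koszul m K ` koszul_chains m K (Suc n) d"
  proof
    assume "?v = 0"
    then show "to_face n (w n) \<in> face_koszul m K ` koszul_chains m K (Suc n) d"
      using w(3) by auto
  next
    assume "to_face n (w n) \<in> face_koszul m K ` koszul_chains m K (Suc n) d"
    then obtain y' where y': "y' \<in> koszul_chains m K (Suc n) d" "to_face n (w n) = face_koszul m K y'"
      by blast
    have "?v = face_koszul m K (y' - y)" by (simp add: y'(2) face_koszul_diff)
    then show "?v = 0"
      using w(4) koszul_chains_diff[OF y'(1) w(3)] by (rule crit_chain_boundary_zero[rotated 2])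
  qed
  also have "\<dots> \<longleftrightarrow> z \<in> fib_diff n ` fib d (Suc n)"
    using B.zigzag_boundary_iff[OF w(1)] w(2) by simp
  finally show ?thesis .
qed

lemma corresp_functional:
  assumes "corresp z c" "corresp z c'"
  shows "c = c'"
proof -
  \<comment> \<open>The pair of zeros shows that 0 is a boundary; hence everything corresponding to
    0, in particular \<open>c - c'\<close>, is zero.\<close>
  have "corresp 0 0" using corresp_diff[OF assms(1,1)] by simp
  then have "0 \<in> fib_diff n ` fib d (Suc n)" using corresp_zero_iff by blast
  moreover have "corresp 0 (c - c')" using corresp_diff[OF assms] by simp
  ultimately show ?thesis using corresp_zero_iff by fastforce
qed

text \<open>A boundary lifts to a horizontal boundary in the double complex, where the square of the
  differential is already known to vanish.\<close>

lemma boundaries_subset_cycles: "fib_diff n ` fib d (Suc n) \<subseteq> cycles"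
proof
  fix z assume "z \<in> fib_diff n ` fib d (Suc n)"
  then obtain f where f: "f \<in> dbl d (Suc n) 0" "z = fib_diff n (to_fib (Suc n) f)"
    unfolding B.L.eps_image[of "Suc n", symmetric] by auto
  have z: "z = to_fib n (dbl_h n 0 f)" using B.L.eps_dh f by simp
  then have "z \<in> fib d n"
    using B.L.dh_closed[OF f(1)] B.L.eps_image[of n] by blast
  moreover have "fib_diff p z = 0" if "n = Suc p" for p
  proof -
    have "fib_diff p z = to_fib p (dbl_h p 0 (dbl_h n 0 f))"
      unfolding z using B.L.eps_dh[of "dbl_h n 0 f" p] B.L.dh_closed[OF f(1)] that by simp
    also have "dbl_h p 0 (dbl_h n 0 f) = 0"
      using B.L.dh_dh[of f p 0] f(1) that by simp
    finally show ?thesis by (simp add: to_fib_def fun_eq_iff)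
  qed
  ultimately show "z \<in> cycles" by (simp add: cycles_def)
qed

definition corresp_map :: "('x \<Rightarrow> 'k) \<Rightarrow> gen \<Rightarrow> 'k" where
  "corresp_map z = (SOME c. corresp z c)"

lemma corresp_map: "z \<in> cycles \<Longrightarrow> corresp z (corresp_map z)"
  unfolding corresp_map_def by (rule someI_ex[of "corresp z"]) (metis corresp_total)

lemma corresp_map_eq: "corresp z c \<Longrightarrow> corresp_map z = c"
  using corresp_functional corresp_map corresp_cycle(1) by blast

lemma corresp_map_image: "corresp_map ` cycles = {c. \<forall>g. g \<notin> crit_gens n d \<longrightarrow> c g = 0}"
proof (intro equalityI subsetI)
  fix c assume "c \<in> corresp_map ` cycles"
  then show "c \<in> {c. \<forall>g. g \<notin> crit_gens n d \<longrightarrow> c g = 0}"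
    using corresp_map corresp_cycle(2) by blast
next
  fix c :: "gen \<Rightarrow> 'k" assume "c \<in> {c. \<forall>g. g \<notin> crit_gens n d \<longrightarrow> c g = 0}"
  then obtain z where "corresp z c" using corresp_surj[of c] by blast
  then show "c \<in> corresp_map ` cycles"
    using corresp_map_eq corresp_cycle(1) by (metis imageI)
qed

lemma corresp_map_diff:
  assumes "x \<in> cycles" "y \<in> cycles"
  shows "x - y \<in> cycles \<and> corresp_map (x - y) = corresp_map x - corresp_map y"
  using corresp_diff[OF corresp_map corresp_map, OF assms] corresp_cycle(1) corresp_map_eq by blast

lemma corresp_map_scale:
  assumes "x \<in> cycles"
  shows "(\<lambda>t. r * x t) \<in> cycles \<and> corresp_map (\<lambda>t. r * x t) = (\<lambda>g. r * corresp_map x g)"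
  using corresp_scale[OF corresp_map, OF assms] corresp_cycle(1) corresp_map_eq by blast

lemma corresp_map_zero_iff: "z \<in> cycles \<Longrightarrow> corresp_map z = 0 \<longleftrightarrow> z \<in> fib_diff n ` fib d (Suc n)"
  using corresp_zero_iff corresp_map by blast

end

end

text \<open>The first isomorphism theorem: the cosets of \<open>H\<close> are the fibres of
  \<open>\<Phi>\<close>. The hypotheses speak of subtraction because the correspondence is
  compatible with differences by construction.\<close>

lemma quotient_module_isomorphicI:
  fixes M :: "('r, 'm::ab_group_add) module" and N :: "('r, 'n::ab_group_add) module"
  assumes M: "add M = (+)" and N: "add N = (+)"
    and diff: "\<And>x y. x \<in> carrier M \<Longrightarrow> y \<in> carrier M \<Longrightarrow> x - y \<in> carrier M \<and> \<Phi> (x - y) = \<Phi> x - \<Phi> y"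
    and scale: "\<And>r x. r \<in> carrier R \<Longrightarrow> x \<in> carrier M \<Longrightarrow> r \<odot>\<^bsub>M\<^esub> x \<in> carrier M \<and> \<Phi> (r \<odot>\<^bsub>M\<^esub> x) = r \<odot>\<^bsub>N\<^esub> \<Phi> x"
    and surj: "\<Phi> ` carrier M = carrier N"
    and ker: "\<And>x. x \<in> carrier M \<Longrightarrow> \<Phi> x = 0 \<longleftrightarrow> x \<in> H" and H: "H \<subseteq> carrier M" "carrier M \<noteq> {}"
  shows "module_isomorphic R (quotient_module M H) N"
proof -
  obtain x0 where "x0 \<in> carrier M" using H(2) by blast
  from diff[OF this this] have zero: "0 \<in> carrier M" "\<Phi> 0 = 0" by simp_all
  have add: "x + y \<in> carrier M \<and> \<Phi> (x + y) = \<Phi> x + \<Phi> y" if "x \<in> carrier M" "y \<in> carrier M" for x y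
    using diff[OF that(1), of "0 - y"] diff[OF zero(1) that(2)] zero(2) by simp
  have coset: "H +>\<^bsub>M\<^esub> x = {y \<in> carrier M. \<Phi> y = \<Phi> x}" if "x \<in> carrier M" for x
  proof -
    have "H +>\<^bsub>M\<^esub> x = (\<lambda>h. h + x) ` H"
      by (auto simp: a_r_coset_def r_coset_def M)
    also have "\<dots> = {y \<in> carrier M. \<Phi> y = \<Phi> x}"
    proof (intro equalityI subsetI)
      fix y assume "y \<in> (\<lambda>h. h + x) ` H"
      then obtain h where h: "h \<in> H" "y = h + x" by blast
      then have "h \<in> carrier M" "\<Phi> h = 0" using H(1) ker by auto
      then show "y \<in> {y \<in> carrier M. \<Phi> y = \<Phi> x}" using add[of h x] h that by simp
    next
      fix y assume "y \<in> {y \<in> carrier M. \<Phi> y = \<Phi> x}"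
      then have "y - x \<in> carrier M" "\<Phi> (y - x) = 0" using diff[of y x] that by auto
      then have "y - x \<in> H" using ker by simp
      then show "y \<in> (\<lambda>h. h + x) ` H" by (rule rev_image_eqI) simp
    qed
    finally show ?thesis .
  qed
  define fibre where "fibre c = {y \<in> carrier M. \<Phi> y = c}" for c
  have Q: "carrier (quotient_module M H) = fibre ` carrier N"
    using coset by (auto simp: quotient_module_def A_RCOSETS_def RCOSETS_def a_r_coset_def[symmetric]
        fibre_def surj[symmetric])
  have image: "\<Phi> ` fibre c = {c}" if "c \<in> carrier N" for c
  proof -
    obtain x where "x \<in> carrier M" "c = \<Phi> x" using \<open>c \<in> carrier N\<close> surj by blast
    then show ?thesis by (auto simp: fibre_def)
  qed
  \<comment> \<open>On a fibre \<open>\<Phi>\<close> takes a single value, so no representative has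
    to be chosen.\<close>
  define h where "h C = the_elem (\<Phi> ` C)" for C
  have h: "h (fibre c) = c" if "c \<in> carrier N" for c
    using image[OF that] by (simp add: h_def)
  have hI: "h C = c" if "\<Phi> ` C = {c}" for C c
    using that by (simp add: h_def)
  have "h \<in> module_iso R (quotient_module M H) N"
    unfolding module_iso_def iso_def bij_betw_def
  proof (intro CollectI conjI ballI)
    show "h \<in> Group.hom (add_monoid (quotient_module M H)) (add_monoid N)"
    proof (rule homI)
      fix C assume "C \<in> carrier (add_monoid (quotient_module M H))"
      then obtain c where c: "c \<in> carrier N" "C = fibre c" using Q by auto
      then show "h C \<in> carrier (add_monoid N)" using h by simp
      fix C' assume "C' \<in> carrier (add_monoid (quotient_module M H))"
      then obtain c' where c': "c' \<in> carrier N" "C' = fibre c'" using Q by auto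
      have "C <+>\<^bsub>M\<^esub> C' = (\<lambda>(x, y). x + y) ` (C \<times> C')"
        by (auto simp: set_add_def set_mult_def M)
      moreover have "\<Phi> ` (\<lambda>(x, y). x + y) ` (C \<times> C') = (\<lambda>(x, y). x + y) ` (\<Phi> ` C \<times> \<Phi> ` C')"
        using add c c' by (force simp: fibre_def image_iff)
      ultimately have "h (C <+>\<^bsub>M\<^esub> C') = c + c'"
        using image c c' by (intro hI) simp
      then show "h (C \<otimes>\<^bsub>add_monoid (quotient_module M H)\<^esub> C') = h C \<otimes>\<^bsub>add_monoid N\<^esub> h C'"
        using c c' h by (simp add: quotient_module_def N)
    qed
    show "inj_on h (carrier (add_monoid (quotient_module M H)))"
      using Q h by (auto simp: inj_on_def)
    show "h ` carrier (add_monoid (quotient_module M H)) = carrier (add_monoid N)"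
      using Q h by (auto simp: image_image)
    fix r C assume r: "r \<in> carrier R" and "C \<in> carrier (quotient_module M H)"
    then obtain c where c: "c \<in> carrier N" "C = fibre c" using Q by auto
    have "\<Phi> ` (\<Union>x\<in>C. H +>\<^bsub>M\<^esub> (r \<odot>\<^bsub>M\<^esub> x)) = {r \<odot>\<^bsub>N\<^esub> c}"
    proof -
      have 1: "H +>\<^bsub>M\<^esub> (r \<odot>\<^bsub>M\<^esub> x) = fibre (r \<odot>\<^bsub>N\<^esub> c)" if "x \<in> C" for x
      proof -
        have "x \<in> carrier M" "\<Phi> x = c" using that c(2) by (simp_all add: fibre_def)
        then show ?thesis
          using scale[OF r, of x] coset[of "r \<odot>\<^bsub>M\<^esub> x"] by (simp add: fibre_def)
      qed
      obtain x where x: "x \<in> carrier M" "\<Phi> x = c" using c(1) unfolding surj[symmetric] by auto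
      then have "x \<in> C" using c by (simp add: fibre_def)
      moreover have "r \<odot>\<^bsub>N\<^esub> c \<in> carrier N"
        using scale[OF r x(1)] unfolding x(2) surj[symmetric] by (metis imageI)
      ultimately show ?thesis using 1 image[of "r \<odot>\<^bsub>N\<^esub> c"] by auto
    qed
    then show "h (r \<odot>\<^bsub>quotient_module M H\<^esub> C) = r \<odot>\<^bsub>N\<^esub> h C"
      using hI h c by (simp add: quotient_module_def)
  qed
  then show ?thesis by (auto simp: module_isomorphic_def)
qed

section \<open>Identification with the defined Tor modules\<close>

lemma abelian_monoid_trivial: "abelian_monoid (trivial_module :: ('k::comm_ring_1 mpoly, 'k) module)"
  by (rule abelian_monoidI) (simp_all add: trivial_module_def ac_simps)

theorem theorem3p4:
  fixes m :: nat and K :: "nat set set"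
    and F :: "('x, 'k::comm_ring_1 mpoly, 'k mpoly set) free_cx"
  assumes "integers_or_prime_field TYPE('k)"
    and "matroid_on m K"
    and "SR_resolution m K F"
  shows "\<forall>(i::nat) (d::int).
    module_isomorphic (coeff_ring :: 'k ring) (SR_Tor F i d) (critical_module m K (- int i, d))"
proof (intro allI)
  fix i :: nat and d :: int
  obtain a where "exact_face_resolution m K (basis F) (bdeg F) (dmat F) a"
    using SR_resolution_imp[OF assms(2,3)] by blast
  then interpret R: exact_face_resolution m K "basis F" "bdeg F" "dmat F" a .
  let ?T = "trivial_module :: ('k mpoly, 'k) module"
  \<comment> \<open>The trivial grading leaves only the value 0 at basis elements of degree other
    than \<open>d\<close>, which is the support condition of \<open>fib\<close>.\<close>
  have comp: "tensor_component ?T trivial_grading F p d = R.fib d p" for p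
  proof -
    have "f \<in> tensor_component ?T trivial_grading F p d \<longleftrightarrow> f \<in> R.fib d p" for f
    proof (cases "\<forall>x. x \<notin> basis F p \<longrightarrow> f x = 0")
      case True
      then have "{x \<in> basis F p. f x \<noteq> 0} = {x. f x \<noteq> 0}" by auto
      then show ?thesis
        using True by (auto simp: tensor_component_def copower_def trivial_module_def trivial_grading_def
            R.fib_def split: if_splits)
    next
      case False
      then show ?thesis
        by (auto simp: tensor_component_def copower_def trivial_module_def R.fib_def)
    qed
    then show ?thesis by blast
  qed
  have diff: "tensor_diff F ?T p f = R.fib_diff p f" if "f \<in> R.fib d (Suc p)" for p f
  proof
    fix y
    have "{x \<in> basis F (Suc p). f x \<noteq> 0} = {x. f x \<noteq> 0}" using that by (auto simp: R.fib_def)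
    moreover have "finsum ?T g A = sum g A" for g and A :: "'x set"
      by (rule finsum_eq_sum[OF abelian_monoid_trivial]) (simp_all add: trivial_module_def)
    ultimately show "tensor_diff F ?T p f y = R.fib_diff p f y"
      by (simp add: tensor_diff_def R.fib_diff_def) (simp add: trivial_module_def)
  qed
  have cyc: "tor_cycles ?T trivial_grading F i d = R.cycles d i"
  proof -
    have zero: "\<zero>\<^bsub>copower ?T (basis F j)\<^esub> = 0" for j
      by (simp add: copower_def trivial_module_def zero_fun_def)
    show ?thesis
      unfolding tor_cycles_def comp R.cycles_def zero using diff by auto
  qed
  have bnd: "tor_boundaries ?T trivial_grading F i d = R.fib_diff i ` R.fib d (Suc i)"
    unfolding tor_boundaries_def comp by (intro image_cong refl diff)
  let ?\<Phi> = "R.corresp_map d i"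
  \<comment> \<open>The free module asks for finitely supported functions; finiteness of the index
    set makes this agree with the image of \<open>corresp_map\<close>.\<close>
  have "finite (critical_gens m K)"
    by (rule finite_subset[of _ "Pow {1..m} \<times> Pow {1..m}"])
      (auto simp: critical_gens_def generators_def)
  then have fin: "finite {x \<in> R.crit_gens i d. P x}" for P
    by (simp add: R.crit_gens_def)
  let ?M = "(restrict_scalars const (copower ?T (basis F i)))\<lparr>carrier := R.cycles d i\<rparr>"
  show "module_isomorphic (coeff_ring :: 'k ring) (SR_Tor F i d) (critical_module m K (- int i, d))"
    unfolding SR_Tor_def Tor_def cyc bnd
  proof (rule quotient_module_isomorphicI[where \<Phi> = ?\<Phi>])
    show "add ?M = (+)"
      by (simp add: restrict_scalars_def copower_def trivial_module_def fun_eq_iff)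
    show "add (critical_module m K (- int i, d) :: ('k, gen \<Rightarrow> 'k) module) = (+)"
      by (simp add: critical_module_def free_module_def copower_def regular_module_def
          ring_of_type_algebra_def fun_eq_iff)
    show "?\<Phi> ` carrier ?M = carrier (critical_module m K (- int i, d))"
      using R.corresp_map_image[of d i] fin by (simp add: critical_module_def free_module_def copower_def regular_module_def
          ring_of_type_algebra_def R.crit_gens_def[symmetric])
    show "carrier ?M \<noteq> {}"
      using R.corresp_map_image[of d i] by auto
    show "x - y \<in> carrier ?M \<and> ?\<Phi> (x - y) = ?\<Phi> x - ?\<Phi> y" if "x \<in> carrier ?M" "y \<in> carrier ?M" for x y
      using R.corresp_map_diff that by simp
    show "?\<Phi> x = 0 \<longleftrightarrow> x \<in> R.fib_diff i ` R.fib d (Suc i)" if "x \<in> carrier ?M" for x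
      using R.corresp_map_zero_iff that by simp
    show "R.fib_diff i ` R.fib d (Suc i) \<subseteq> carrier ?M" using R.boundaries_subset_cycles by simp
    fix r :: 'k and x assume x: "x \<in> carrier ?M"
    have "r \<odot>\<^bsub>?M\<^esub> x = (\<lambda>t. r * x t)"
      by (simp add: restrict_scalars_def copower_def trivial_module_def const_def)
    moreover have "r \<odot>\<^bsub>critical_module m K (- int i, d)\<^esub> c = (\<lambda>g. r * c g)" for c :: "gen \<Rightarrow> 'k"
      by (simp add: critical_module_def free_module_def copower_def regular_module_def ring_of_type_algebra_def)
    ultimately show "r \<odot>\<^bsub>?M\<^esub> x \<in> carrier ?M \<and> ?\<Phi> (r \<odot>\<^bsub>?M\<^esub> x) = r \<odot>\<^bsub>critical_module m K (- int i, d)\<^esub> ?\<Phi> x"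
      using R.corresp_map_scale[of x d i r] x by simp
  qed
qed

end
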